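(* Let $n\ge 3$ and $1<p<\frac{n+2}{n-2}$. Let $\psi\in C^2([0,+\infty))$ be positive on $(0,+\infty)$ with $\psi(0)=\psi''(0)=0$, $\psi'(0)=1$, $\psi'(r)\ge 0$ for every $r>0$, and $$\lim_{r\to+\infty}\frac{\psi'(r)}{\psi(r)}=l\in(0,+\infty].$$ If $l=+\infty$, assume in addition that $\left[\log\left(\frac{\psi'(r)}{\psi(r)}\right)\right]'=O(1)$ as $r\to+\infty$. Fix any $r_0\ge 0$ such that $\psi'>0$ on $[r_0,+\infty)$ (with $r_0=0$ allowed if $\psi'>0$ everywhere). Let $u$ be a radial positive solution of $-\Delta_g u=|u|^{p-1}u$ on $M$. (i) If $u\in H^1(M)$, then there exists $L\in(-\infty,0)$ such that $\lim_{r\to+\infty}\psi^{n-1}(r)u'(r)=L$. Moreover $$\lim_{r\to+\infty}\psi^{n-1}(r)u(r)=\frac{|L|}{(n-1)l}\quad\text{if } l<+\infty,\qquad \lim_{r\to+\infty}\frac{u(r)}{\int_r^{+\infty}\psi^{1-n}(s)\,ds}=|L|\quad\text{if } l=+\infty.$$ (ii) If $u\notin H^1(M)$ and $\frac{\psi}{\psi'}\in L^1(r_0,\infty)$, then $\lim_{r\to+\infty}u(r)\in(0,+\infty)$. (iii) If $u\notin H^1(M)$ and $\frac{\psi}{\psi'}\notin L^1(r_0,\infty)$, then $u$ vanishes at infinity with rate $$\lim_{r\to+\infty}\left(\int_{r_0}^r\frac{\psi(s)}{\psi'(s)}\,ds\right)^{1/(p-1)}u(r)=\left(\frac{n-1}{p-1}\right)^{1/(p-1)}.$$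 In particular, when $l<+\infty$, $$\lim_{r\to+\infty}r^{1/(p-1)}u(r)=\left(\frac{l(n-1)}{p-1}\right)^{1/(p-1)}.$$
   Context: $(M,g)$ is the $n$-dimensional Riemannian model with pole $o$ and metric $ds^2=dr^2+\psi(r)^2d\Theta^2$ in polar coordinates $(r,\Theta)\in(0,\infty)\times\mathbb{S}^{n-1}$ around $o$ ($M$ is diffeomorphic to $\mathbb{R}^n$). A function is radial if it depends only on $r$, the distance from $o$; for radial $f$, $\Delta_g f=f''+(n-1)\frac{\psi'}{\psi}f'$, so a radial solution $u$ of the equation satisfies $u''+(n-1)\frac{\psi'}{\psi}u'+|u|^{p-1}u=0$ for $r>0$, $u'(0)=0$. $H^1(M)=\{u\in L^2(V_g):\nabla_g u\in L^2(V_g)\}$, with $V_g$ the Riemannian measure and $\nabla_g$ the Riemannian gradient. *)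

theory Defs
  imports "HOL-Analysis.Analysis" "HOL-Library.Landau_Symbols"
begin

definition C1_map :: "('a::real_normed_vector \<Rightarrow> 'b::real_normed_vector) \<Rightarrow> bool" where
  "C1_map f \<longleftrightarrow>
     (\<exists>f' :: 'a \<Rightarrow> 'a \<Rightarrow>\<^sub>L 'b.
        (\<forall>x. (f has_derivative blinfun_apply (f' x)) (at x)) \<and> continuous_on UNIV f')"

definition C2_map :: "('a::real_normed_vector \<Rightarrow> 'b::real_normed_vector) \<Rightarrow> bool" where
  "C2_map f \<longleftrightarrow>
     (\<exists>f' :: 'a \<Rightarrow> 'a \<Rightarrow>\<^sub>L 'b.
        (\<forall>x. (f has_derivative blinfun_apply (f' x)) (at x)) \<and> C1_map f')"

text \<open>
  Riemannian notions in a single global chart: a metric is given as a map sending a point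
  to a bilinear form on the tangent space, and vector fields by their components.
\<close>

type_synonym 'n metric = "real^'n \<Rightarrow> real^'n \<Rightarrow> real^'n \<Rightarrow> real"

definition vol_density :: "'n::finite metric \<Rightarrow> real^'n \<Rightarrow> real" where
  "vol_density g x = sqrt (det (\<chi> i j. g x (axis i 1) (axis j 1)))"

definition riem_measure :: "'n::finite metric \<Rightarrow> (real^'n) measure" where
  "riem_measure g = density lborel (\<lambda>x. ennreal (vol_density g x))"

definition riem_grad :: "'n::finite metric \<Rightarrow> (real^'n \<Rightarrow> real) \<Rightarrow> real^'n \<Rightarrow> real^'n" where
  "riem_grad g f x = (THE X. \<forall>v. g x X v = frechet_derivative f (at x) v)"

definition riem_div :: "'n::finite metric \<Rightarrow> (real^'n \<Rightarrow> real^'n) \<Rightarrow> real^'n \<Rightarrow> real" where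
  "riem_div g Y x =
     (\<Sum>i\<in>UNIV. frechet_derivative (\<lambda>y. vol_density g y *\<^sub>R Y y) (at x) (axis i 1) $ i)
       / vol_density g x"

definition laplace_beltrami :: "'n::finite metric \<Rightarrow> (real^'n \<Rightarrow> real) \<Rightarrow> real^'n \<Rightarrow> real" where
  "laplace_beltrami g f = riem_div g (riem_grad g f)"

definition L2_fun :: "'n::finite metric \<Rightarrow> (real^'n \<Rightarrow> real) \<Rightarrow> bool" where
  "L2_fun g f \<longleftrightarrow> f \<in> borel_measurable (riem_measure g) \<and>
     integrable (riem_measure g) (\<lambda>x. (f x)\<^sup>2)"

definition L2_field :: "'n::finite metric \<Rightarrow> (real^'n \<Rightarrow> real^'n) \<Rightarrow> bool" where
  "L2_field g X \<longleftrightarrow> X \<in> borel_measurable (riem_measure g) \<and>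
     integrable (riem_measure g) (\<lambda>x. g x (X x) (X x))"

text \<open>
  The gradient in the Sobolev space is the distributional one. Test fields are of class
  \<open>C\<^sup>1\<close> because the metrics considered below are only \<open>C\<^sup>1\<close> at the pole; by mollification
  this is the same as testing with smooth fields. The integrals are only meaningful
  when \<open>f\<close> and \<open>X\<close> are locally integrable, which is ensured where the notion is used.
\<close>

definition weak_grad :: "'n::finite metric \<Rightarrow> (real^'n \<Rightarrow> real) \<Rightarrow> (real^'n \<Rightarrow> real^'n) \<Rightarrow> bool" where
  "weak_grad g f X \<longleftrightarrow>
     (\<forall>Y :: real^'n \<Rightarrow> real^'n. C1_map Y \<longrightarrow> compact (closure {x. Y x \<noteq> 0}) \<longrightarrow>
        (\<integral>x. g x (X x) (Y x) \<partial>riem_measure g) = - (\<integral>x. f x * riem_div g Y x \<partial>riem_measure g))"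

definition sobolev_H1 :: "'n::finite metric \<Rightarrow> (real^'n \<Rightarrow> real) set" where
  "sobolev_H1 g = {f. L2_fun g f \<and> (\<exists>X. L2_field g X \<and> weak_grad g f X)}"

text \<open>
  The model metric \<open>dr\<^sup>2 + \<psi>(r)\<^sup>2 d\<Theta>\<^sup>2\<close> in the chart \<open>x = r\<Theta>\<close>, with the pole at the origin,
  so that the distance from the pole is \<open>r = norm x\<close>. On a tangent vector \<open>v\<close> at \<open>x \<noteq> 0\<close>,
  \<open>dr\<close> is \<open>sgn x \<bullet> v\<close> and \<open>d\<Theta>\<close> is the component of \<open>v\<close> orthogonal to \<open>x\<close>, divided by \<open>r\<close>.
  The value at the pole is the continuous extension, as \<open>\<psi>(r)/r\<close> tends to \<open>\<psi>'(0) = 1\<close>.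
\<close>

definition model_metric :: "(real \<Rightarrow> real) \<Rightarrow> 'n::finite metric" where
  "model_metric \<psi> x v w =
     (if x = 0 then v \<bullet> w
      else (sgn x \<bullet> v) * (sgn x \<bullet> w)
         + (\<psi> (norm x))\<^sup>2 * ((v \<bullet> w - (sgn x \<bullet> v) * (sgn x \<bullet> w)) / (norm x)\<^sup>2))"

definition lane_emden_solution :: "'n::finite metric \<Rightarrow> real \<Rightarrow> (real^'n \<Rightarrow> real) \<Rightarrow> bool" where
  "lane_emden_solution g p u \<longleftrightarrow> C2_map u \<and>
     (\<forall>x. - laplace_beltrami g u x = \<bar>u x\<bar> powr (p - 1) * u x)"

end

theory Submission imports Defs "HOL-Real_Asymp.Real_Asymp" begin

text \<open>
  Write \<open>m = n - 1\<close>, \<open>Q = \<psi>' / \<psi>\<close> and \<open>u x = v (norm x)\<close>. On radial functions the Laplacian is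
  \<open>v'' + m Q v'\<close>, so the flux \<open>- \<psi> ^ m * v'\<close> has derivative \<open>\<psi> ^ m * v powr p\<close>: it vanishes at
  the pole, hence it is positive and increasing, and \<open>v\<close> is decreasing. What remains to be
  understood is the logarithmic decay rate \<open>- v' / v\<close>.

  \<^bold>\<open>Dichotomy.\<close> Measure that rate in units of a function \<open>q\<close> with \<open>Q / q \<longlongrightarrow> 1\<close> and \<open>q' / q\<^sup>2 \<longlongrightarrow> 0\<close>:
  the constant \<open>q = l\<close> when \<open>l\<close> is finite, and \<open>q = Q\<close> when \<open>l = \<infinity>\<close>, where the bound on
  \<open>(ln Q)'\<close> says exactly that \<open>Q' / Q\<^sup>2 \<longlongrightarrow> 0\<close>. The normalized rate \<open>y = - v' / (v q)\<close> solves the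
  Riccati equation \<open>y' = q (y (y - a) + b)\<close> with \<open>a \<longlongrightarrow> m\<close> and \<open>b = v powr (p - 1) / q\<^sup>2 \<longlongrightarrow> 0\<close>. A
  positive global solution cannot stay above the unstable root \<open>m\<close>, as it would blow up in finite
  time, and once it falls below \<open>m\<close> it is driven to \<open>0\<close>. So \<open>y \<longlongrightarrow> m\<close> (fast decay) or \<open>y \<longlongrightarrow> 0\<close>
  (slow decay): \<open>riccati_dichotomy\<close>, \<open>lane_emden_ode.slow_or_fast\<close>. For finite \<open>l\<close>, \<open>b \<longlongrightarrow> 0\<close> means
  \<open>v \<longlongrightarrow> 0\<close>, and a positive limit of \<open>v\<close> would keep \<open>v'\<close> below a negative constant.

  \<^bold>\<open>Sobolev space.\<close> The radial densities of the mass and of the energy are \<open>\<psi> ^ m * v\<^sup>2\<close> and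
  \<open>\<psi> ^ m * v'\<^sup>2\<close>. Under fast decay both have logarithmic derivative asymptotic to \<open>- m q\<close>, so they
  are integrable; under slow decay the first one is eventually nondecreasing, so it is not. Polar
  coordinates turn this into: \<open>u\<close> is in \<open>H\<^sup>1\<close> exactly under fast decay. That the classical
  gradient is the weak one (\<open>weak_grad_u\<close>) is integration by parts; at the pole it uses that
  \<open>\<psi>(r) / r\<close> extends to a function of class \<open>C\<^sup>1\<close> with vanishing derivative, because
  \<open>\<psi>''(0) = 0\<close>.

  \<^bold>\<open>Fast decay.\<close> The logarithmic derivative of the flux is \<open>v powr (p - 1) / (y q)\<close>, which is
  integrable as \<open>v\<close> decays exponentially. So the flux has a finite limit \<open>\<bar>L\<bar>\<close>, and
  \<open>\<psi> ^ m * v\<close> is the flux divided by \<open>y q\<close>. If \<open>l = \<infinity>\<close>, integrating \<open>- v' = flux / \<psi> ^ m\<close>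
  with the monotone flux squeezes \<open>v\<close> between two multiples of the tail integral of
  \<open>\<psi> powr - m\<close>.

  \<^bold>\<open>Slow decay.\<close> Now \<open>Y = - q v' / v powr p\<close> solves the linear equation \<open>Y' = q (1 - \<alpha> Y)\<close> with
  \<open>\<alpha> \<longlongrightarrow> m\<close>, so \<open>Y \<longlongrightarrow> 1 / m\<close>. In other words the derivative of \<open>v powr (1 - p)\<close> is asymptotic to
  \<open>(p - 1) / m * \<psi> / \<psi>'\<close>. If \<open>\<psi> / \<psi>'\<close> is integrable then \<open>v powr (1 - p)\<close> stays bounded and \<open>v\<close>
  has a positive limit; otherwise l'Hospital's rule gives the stated rate.
\<close>

section \<open>Barriers and scalar differential inequalities\<close>

lemma DERIV_le_imp_linear_bound:
  fixes f f' :: "real \<Rightarrow> real"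
  assumes "\<And>r. r \<ge> a \<Longrightarrow> (f has_real_derivative f' r) (at r)"
    and "\<And>r. r \<ge> a \<Longrightarrow> f' r \<le> d" and "a \<le> r"
  shows "f r \<le> f a + d * (r - a)"
proof -
  have "f a - d * a \<ge> f r - d * r"
  proof (rule DERIV_nonpos_imp_nonincreasing[of a r "\<lambda>s. f s - d * s"])
    fix s assume s: "a \<le> s" "s \<le> r"
    have "((\<lambda>s. f s - d * s) has_real_derivative f' s - d) (at s)"
      by (auto intro!: derivative_eq_intros assms(1) s)
    then show "\<exists>y. ((\<lambda>s. f s - d * s) has_real_derivative y) (at s) \<and> y \<le> 0"
      using assms(2)[OF s(1)] by force
  qed fact
  then show ?thesis by (simp add: algebra_simps)
qed

text \<open>
  At the first time at which \<open>f\<close> would reach the level \<open>K\<close>, its derivative there would have to be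
  nonnegative.
\<close>

lemma barrier_not_crossed:
  fixes f f' :: "real \<Rightarrow> real"
  assumes der: "\<And>r. r \<ge> a \<Longrightarrow> (f has_real_derivative f' r) (at r)"
    and neg: "\<And>r. r \<ge> a \<Longrightarrow> f r = K \<Longrightarrow> f' r < 0"
    and start: "f a < K" and "a \<le> r"
  shows "f r < K"
proof (rule ccontr)
  assume "\<not> f r < K"
  define S where "S = {s\<in>{a..r}. f s \<ge> K}"
  have cont: "continuous_on {a..r} f"
    using DERIV_isCont[OF der] by (intro continuous_at_imp_continuous_on) auto
  have "closed S"
    unfolding S_def
    by (
        rule continuous_on_closed_Collect_le[of "{a..r}" "\<lambda>_. K" f]) (auto intro: cont)
  have "r \<in> S" using \<open>\<not> f r < K\<close> \<open>a \<le> r\<close> by (auto simp: S_def)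
  define t where "t = Inf S"
  have bd: "bdd_below S" by (auto simp: S_def intro!: bdd_belowI[of _ a])
  have tS: "t \<in> S"
    unfolding t_def using \<open>closed S\<close> \<open>r \<in> S\<close> bd by (intro closed_contains_Inf) auto
  then have t: "a < t" "t \<le> r" "f t \<ge> K"
    using start by (auto simp: S_def less_le)
  have below: "f s < K" if "a \<le> s" "s < t" for s
    using cInf_lower[OF _ bd, of s] that t unfolding t_def[symmetric] by (force simp: S_def)
  have isC: "isCont f t" using DERIV_isCont[OF der] t by auto
  have "f t \<le> K"
  proof (rule tendsto_upperbound)
    show "(f \<longlongrightarrow> f t) (at_left t)"
      using isC by (simp add: isCont_def filterlim_at_split)
    show "\<forall>\<^sub>F s in at_left t. f s \<le> K"
      using eventually_at_left_real[OF t(1)] by eventually_elim (auto intro: less_imp_le below)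
  qed simp
  then have ft: "f t = K" using t by simp
  obtain d where d: "d > 0" "\<And>h. h > 0 \<Longrightarrow> h < d \<Longrightarrow> f t < f (t - h)"
    using DERIV_neg_dec_left[OF der neg] t ft by (metis less_imp_le)
  \<comment> \<open>A step to the left of \<open>t\<close>, within reach of the derivative and not beyond \<open>a\<close>.\<close>
  define h where "h = min (d / 2) ((t - a) / 2)"
  have "h > 0" "h < d" "a \<le> t - h" using d t by (auto simp: h_def min_def field_simps)
  then show False using d(2)[of h] below[of "t - h"] ft by auto
qed

text \<open>
  Above the barrier \<open>f\<close> drops at a definite speed, so it gets below in finite time; on the barrier
  it still drops, so it never returns.
\<close>

lemma eventually_below_barrier:
  fixes f f' :: "real \<Rightarrow> real"
  assumes der: "\<And>r. r \<ge> a \<Longrightarrow> (f has_real_derivative f' r) (at r)"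
    and neg: "\<And>r. r \<ge> a \<Longrightarrow> f r \<ge> K \<Longrightarrow> f' r \<le> - d" and "d > 0"
  shows "\<forall>\<^sub>F r in at_top. f r < K"
proof -
  have "\<exists>b\<ge>a. f b < K"
  proof (rule ccontr)
    assume "\<not> ?thesis"
    then have *: "f r \<ge> K" if "r \<ge> a" for r using that by (auto simp: not_less)
    define r where "r = a + (\<bar>f a - K\<bar> + 1) / d"
    have "r \<ge> a" using \<open>d > 0\<close> by (simp add: r_def)
    have "f r \<le> f a + (- d) * (r - a)"
      by (rule DERIV_le_imp_linear_bound[of a f f']) (use der neg * \<open>r \<ge> a\<close> in auto)
    also have "\<dots> < K" using \<open>d > 0\<close> by (simp add: r_def)
    finally show False using *[OF \<open>r \<ge> a\<close>] by simp
  qed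
  then obtain b where b: "b \<ge> a" "f b < K" by blast
  have "f r < K" if "r \<ge> b" for r
  proof (rule barrier_not_crossed[of b f f'])
    show "f' s < 0" if "b \<le> s" "f s = K" for s
      using neg[of s] that b \<open>d > 0\<close> by auto
  qed (use der b that in auto)
  then show ?thesis using eventually_at_top_linorder by blast
qed

lemma not_always_decreasing_if_positive:
  fixes f f' :: "real \<Rightarrow> real"
  assumes der: "\<And>r. r \<ge> a \<Longrightarrow> (f has_real_derivative f' r) (at r)"
    and neg: "\<And>r. r \<ge> a \<Longrightarrow> f' r \<le> - d" and "d > 0"
    and pos: "\<And>r. r \<ge> a \<Longrightarrow> f r > 0"
  shows False
proof -
  have "\<forall>\<^sub>F r in at_top. f r < 0"
    by (rule eventually_below_barrier[OF der neg \<open>d > 0\<close>])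
  moreover have "\<forall>\<^sub>F r in at_top. f r > 0"
    using pos eventually_at_top_linorder by blast
  ultimately have "\<forall>\<^sub>F r::real in at_top. False" by eventually_elim simp
  then show False by simp
qed

text \<open>
  The right-hand side is quadratic in \<open>y\<close>, so above its larger root \<open>y\<close> would blow up in finite time.
  That is read off from \<open>1 / y\<close>, which stays positive but would have a derivative bounded away from \<open>0\<close>.
\<close>

lemma riccati_bounded_above:
  fixes y q a b :: "real \<Rightarrow> real"
  assumes der: "\<And>r. r \<ge> R \<Longrightarrow> (y has_real_derivative q r * (y r * (y r - a r) + b r)) (at r)"
    and q: "\<And>r. r \<ge> R \<Longrightarrow> q r \<ge> c" "c > 0"
    and pos: "\<And>r. r \<ge> R \<Longrightarrow> y r > 0" "\<And>r. r \<ge> R \<Longrightarrow> b r \<ge> 0"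
    and a: "(a \<longlongrightarrow> m) at_top" and "m > 0" "e > 0"
  shows "\<forall>\<^sub>F r in at_top. y r \<le> m + e"
proof -
  have "\<forall>\<^sub>F r in at_top. a r < m + e / 2"
    using order_tendstoD(2)[OF a, of "m + e / 2"] \<open>e > 0\<close> by simp
  then have "\<forall>\<^sub>F r in at_top. r \<ge> R \<and> a r < m + e / 2"
    using eventually_ge_at_top[of R] by eventually_elim simp
  then obtain S where S: "\<And>r. r \<ge> S \<Longrightarrow> r \<ge> R \<and> a r < m + e / 2"
    unfolding eventually_at_top_linorder by blast
  have "y s \<le> m + e" if "s \<ge> S" for s
  proof (rule ccontr)
    assume s: "\<not> y s \<le> m + e"
    \<comment> \<open>Above the larger root the quadratic term wins, and the reciprocal of \<open>y\<close> reaches \<open>0\<close> in finite time.\<close>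
    define f where "f = (\<lambda>r. 1 / y r)"
    define f' where "f' = (\<lambda>r. - q r * (y r * (y r - a r) + b r) / (y r)\<^sup>2)"
    define d where "d = 1 - (m + e / 2) / (m + e)"
    have "d > 0" using \<open>m > 0\<close> \<open>e > 0\<close> by (simp add: d_def field_simps)
    have derf: "(f has_real_derivative f' r) (at r)" if "r \<ge> s" for r
    proof -
      have "r \<ge> R" using S[of r] that \<open>s \<ge> S\<close> by auto
      then show ?thesis unfolding f_def f'_def using pos(1)[of r]
        by (auto intro!: derivative_eq_intros der simp: power2_eq_square)
    qed
    have neg: "f' r \<le> - (c * d)" if "r \<ge> s" "y r \<ge> m + e" for r
    proof -
      have r: "r \<ge> R" "a r < m + e / 2" using S[of r] that \<open>s \<ge> S\<close> by auto
      have y: "y r > 0" by (rule pos(1)[OF r(1)])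
      have "f' r = - (q r * (1 - a r / y r + b r / (y r)\<^sup>2))"
        using y by (simp add: f'_def field_simps power2_eq_square)
      moreover have "q r * (1 - a r / y r + b r / (y r)\<^sup>2) \<ge> c * d"
      proof (rule mult_mono)
        have "a r / y r \<le> (m + e / 2) / y r" using r y by (intro divide_right_mono) auto
        also have "\<dots> \<le> (m + e / 2) / (m + e)"
          using that \<open>m > 0\<close> \<open>e > 0\<close> by (intro divide_left_mono) auto
        finally show "d \<le> 1 - a r / y r + b r / (y r)\<^sup>2"
          using divide_nonneg_nonneg[OF pos(2)[OF r(1)] zero_le_power2[of "y r"]] unfolding d_def by linarith
      qed (use q(1)[of r] r \<open>d > 0\<close> \<open>c > 0\<close> in auto)
      ultimately show ?thesis by simp
    qed
    have iff: "f r \<le> 1 / (m + e) \<longleftrightarrow> y r \<ge> m + e" "f r < 1 / (m + e) \<longleftrightarrow> y r > m + e" if "r \<ge> s" for r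
      using S[of r] that \<open>s \<ge> S\<close> pos(1)[of r] \<open>m > 0\<close> \<open>e > 0\<close> by (auto simp: f_def field_simps)
    have stay: "f r < 1 / (m + e)" if "r \<ge> s" for r
    proof (rule barrier_not_crossed[of s f f'])
      show "f' t < 0" if "s \<le> t" "f t = 1 / (m + e)" for t
      proof -
        have "y t \<ge> m + e" using iff(1)[of t] that by simp
        moreover have "c * d > 0" using \<open>c > 0\<close> \<open>d > 0\<close> by simp
        ultimately show ?thesis using neg[of t] that by linarith
      qed
    qed (use derf s iff that in auto)
    show False
    proof (rule not_always_decreasing_if_positive[of s f f' "c * d"])
      show "f r > 0" if "s \<le> r" for r
        using pos(1)[of r] S[of r] that \<open>s \<ge> S\<close> by (auto simp: f_def)
    qed (use derf neg stay iff \<open>c > 0\<close> \<open>d > 0\<close> in \<open>auto intro: less_imp_le\<close>)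
  qed
  then show ?thesis using eventually_at_top_linorder by blast
qed

text \<open>
  For large \<open>r\<close> the equation is a small perturbation of \<open>y' = q y (y - m)\<close>, which repels from \<open>m\<close> and
  attracts to \<open>0\<close>. Since \<open>y\<close> cannot exceed \<open>m\<close> by a fixed amount, either it is squeezed against
  \<open>m\<close>, or it falls below \<open>m\<close> once by a fixed amount and is then pushed down to \<open>0\<close>.
\<close>

lemma riccati_dichotomy:
  fixes y q a b :: "real \<Rightarrow> real"
  assumes der: "\<And>r. r \<ge> R \<Longrightarrow> (y has_real_derivative q r * (y r * (y r - a r) + b r)) (at r)"
    and q: "\<And>r. r \<ge> R \<Longrightarrow> q r \<ge> c" "c > 0"
    and pos: "\<And>r. r \<ge> R \<Longrightarrow> y r > 0" "\<And>r. r \<ge> R \<Longrightarrow> b r \<ge> 0"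
    and a: "(a \<longlongrightarrow> m) at_top" and b: "(b \<longlongrightarrow> 0) at_top" and "m > 0"
  shows "(y \<longlongrightarrow> 0) at_top \<or> (y \<longlongrightarrow> m) at_top"
proof -
  have drop: "\<forall>\<^sub>F r in at_top. y r < e"
    if e: "0 < e" "e < m / 2" and freq: "\<exists>\<^sub>F r in at_top. y r < m - e" for e
  proof -
    have "\<forall>\<^sub>F r in at_top. a r > m - e / 2"
      using order_tendstoD(1)[OF a, of "m - e / 2"] e by simp
    moreover have "\<forall>\<^sub>F r in at_top. b r < e\<^sup>2 / 4"
      using order_tendstoD(2)[OF b, of "e\<^sup>2 / 4"] e by simp
    ultimately have "\<forall>\<^sub>F r in at_top. r \<ge> R \<and> a r > m - e / 2 \<and> b r < e\<^sup>2 / 4"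
      using eventually_ge_at_top[of R] by eventually_elim simp
    then obtain S where S: "\<And>r. r \<ge> S \<Longrightarrow> r \<ge> R \<and> a r > m - e / 2 \<and> b r < e\<^sup>2 / 4"
      unfolding eventually_at_top_linorder by blast
    have "\<exists>s\<ge>S. y s < m - e"
      using freq unfolding frequently_def eventually_at_top_linorder by auto
    then obtain s where s: "s \<ge> S" "y s < m - e" by blast
    define f' where "f' = (\<lambda>r. q r * (y r * (y r - a r) + b r))"
    have derf: "(y has_real_derivative f' r) (at r)" if "r \<ge> s" for r
      unfolding f'_def using S[of r] that s by (intro der) auto
    have neg: "f' r \<le> - (c * (e\<^sup>2 / 4))" if "r \<ge> s" "e \<le> y r" "y r \<le> m - e" for r
    proof -
      have r: "r \<ge> R" "a r > m - e / 2" "b r < e\<^sup>2 / 4" using S[of r] that s by auto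
      have "e * (e / 2) \<le> y r * (a r - y r)" using r that e by (intro mult_mono) auto
      then have "y r * (y r - a r) + b r \<le> - (e\<^sup>2 / 4)"
        using r by (simp add: algebra_simps power2_eq_square)
      then have "c * (e\<^sup>2 / 4) \<le> q r * - (y r * (y r - a r) + b r)"
        using q(1)[of r] r \<open>c > 0\<close> by (intro mult_mono) auto
      then show ?thesis unfolding f'_def mult_minus_right by linarith
    qed
    have pd: "c * (e\<^sup>2 / 4) > 0" using \<open>c > 0\<close> e by simp
    have stay: "y r < m - e" if "r \<ge> s" for r
    proof (rule barrier_not_crossed[of s y f'])
      show "f' t < 0" if "s \<le> t" "y t = m - e" for t
        using neg[of t] that e pd by auto
    qed (use derf s that in auto)
    show ?thesis
      by (rule eventually_below_barrier[of s y f' e "c * (e\<^sup>2 / 4)"])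
        (use derf neg stay pd in \<open>auto intro: less_imp_le\<close>)
  qed
  have evpos: "\<forall>\<^sub>F r in at_top. y r > 0" using pos(1) eventually_at_top_linorder by blast
  \<comment> \<open>If \<open>y\<close> is below \<open>m - e0\<close> at arbitrarily large radii for one \<open>e0 < m / 2\<close>, it ends up below \<open>e0\<close>, hence below \<open>m - e\<close> for all \<open>e < m / 2\<close>.\<close>
  show ?thesis
  proof (cases "\<exists>e. 0 < e \<and> e < m / 2 \<and> (\<exists>\<^sub>F r in at_top. y r < m - e)")
    case True
    then obtain e0 where e0: "0 < e0" "e0 < m / 2" "\<exists>\<^sub>F r in at_top. y r < m - e0" by blast
    have ev: "\<forall>\<^sub>F r in at_top. y r < e" if "0 < e" "e < m / 2" for e
    proof (rule drop[OF that])
      have "\<forall>\<^sub>F r in at_top. y r < m - e"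
        using drop[OF e0] by eventually_elim (use e0 that in auto)
      then show "\<exists>\<^sub>F r in at_top. y r < m - e" by (rule eventually_frequently[rotated]) simp
    qed
    have "(y \<longlongrightarrow> 0) at_top"
    proof (rule order_tendstoI)
      fix e :: real assume "e < 0"
      then show "\<forall>\<^sub>F r in at_top. e < y r" using evpos by (auto elim: eventually_mono)
    next
      fix e :: real assume "0 < e"
      then have "\<forall>\<^sub>F r in at_top. y r < min e (m / 3)" using \<open>m > 0\<close> by (intro ev) auto
      then show "\<forall>\<^sub>F r in at_top. y r < e" by eventually_elim simp
    qed
    then show ?thesis ..
  next
    case False
    have "(y \<longlongrightarrow> m) at_top"
    proof (rule order_tendstoI)
      fix k assume "k < m"
      define e where "e = min ((m - k) / 2) (m / 3)"
      have e: "0 < e" "e < m / 2" "k < m - e"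
        using \<open>k < m\<close> \<open>m > 0\<close> by (auto simp: e_def min_def field_simps)
      then have "\<forall>\<^sub>F r in at_top. \<not> y r < m - e" using False by (auto simp: frequently_def)
      then show "\<forall>\<^sub>F r in at_top. k < y r" by eventually_elim (use e in auto)
    next
      fix k assume "m < k"
      then have "\<forall>\<^sub>F r in at_top. y r \<le> m + (k - m) / 2"
        by (intro riccati_bounded_above[OF der q pos a \<open>m > 0\<close>]) auto
      then show "\<forall>\<^sub>F r in at_top. y r < k" by eventually_elim (use \<open>m < k\<close> in \<open>auto simp: field_simps\<close>)
    qed
    then show ?thesis ..
  qed
qed

text \<open>
  The equilibrium \<open>1 / a\<close> moves towards \<open>1 / m\<close> and attracts at a rate bounded below, so barriers
  slightly above and slightly below \<open>1 / m\<close> confine \<open>Y\<close>.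
\<close>

lemma linear_relaxation_limit:
  fixes Y q a :: "real \<Rightarrow> real"
  assumes der: "\<And>r. r \<ge> R \<Longrightarrow> (Y has_real_derivative q r * (1 - a r * Y r)) (at r)"
    and q: "\<And>r. r \<ge> R \<Longrightarrow> q r \<ge> c" "c > 0"
    and pos: "\<And>r. r \<ge> R \<Longrightarrow> Y r > 0"
    and a: "(a \<longlongrightarrow> m) at_top" and "m > 0"
  shows "(Y \<longlongrightarrow> 1 / m) at_top"
proof (rule order_tendstoI)
  fix k assume k: "1 / m < k"
  have "k > 0" using k \<open>m > 0\<close> by (meson less_trans zero_less_divide_1_iff)
  define d where "d = (m * k - 1) / 2"
  have "d > 0" using k \<open>m > 0\<close> by (simp add: d_def field_simps)
  have "(1 + d) / k < m" using \<open>k > 0\<close> k \<open>m > 0\<close> by (simp add: d_def field_simps)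
  then have "\<forall>\<^sub>F r in at_top. a r > (1 + d) / k" by (rule order_tendstoD(1)[OF a])
  then have "\<forall>\<^sub>F r in at_top. r \<ge> R \<and> a r > (1 + d) / k"
    using eventually_ge_at_top[of R] by eventually_elim simp
  then obtain S where S: "\<And>r. r \<ge> S \<Longrightarrow> r \<ge> R \<and> a r > (1 + d) / k"
    unfolding eventually_at_top_linorder by blast
  show "\<forall>\<^sub>F r in at_top. Y r < k"
  proof (rule eventually_below_barrier[of S Y "\<lambda>r. q r * (1 - a r * Y r)" k "c * d"])
    fix r assume r: "S \<le> r" "k \<le> Y r"
    have "(1 + d) / k > 0" using \<open>k > 0\<close> \<open>d > 0\<close> by simp
    then have "(1 + d) / k * k \<le> a r * Y r" using S[of r] r \<open>k > 0\<close> by (intro mult_mono) auto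
    then have "d \<le> a r * Y r - 1" using \<open>k > 0\<close> by simp
    then have "c * d \<le> q r * (a r * Y r - 1)"
      using q(1)[of r] S[of r] r \<open>c > 0\<close> \<open>d > 0\<close> by (intro mult_mono) auto
    then show "q r * (1 - a r * Y r) \<le> - (c * d)" by (simp add: algebra_simps)
  qed (use der S \<open>c > 0\<close> \<open>d > 0\<close> in auto)
next
  fix k assume k: "k < 1 / m"
  show "\<forall>\<^sub>F r in at_top. k < Y r"
  proof (cases "k \<le> 0")
    case True
    then show ?thesis using pos unfolding eventually_at_top_linorder by (meson le_less_trans)
  next
    case False
    then have "k > 0" by simp
    define d where "d = (1 - m * k) / 2"
    have "d > 0" using k \<open>m > 0\<close> by (simp add: d_def field_simps)
    have "m < (1 - d) / k" using \<open>k > 0\<close> k \<open>m > 0\<close> by (simp add: d_def field_simps)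
    then have "\<forall>\<^sub>F r in at_top. a r < (1 - d) / k" by (rule order_tendstoD(2)[OF a])
    moreover have "\<forall>\<^sub>F r in at_top. a r > 0" using order_tendstoD(1)[OF a \<open>m > 0\<close>] .
    ultimately have "\<forall>\<^sub>F r in at_top. r \<ge> R \<and> 0 < a r \<and> a r < (1 - d) / k"
      using eventually_ge_at_top[of R] by eventually_elim simp
    then obtain S where S: "\<And>r. r \<ge> S \<Longrightarrow> r \<ge> R \<and> 0 < a r \<and> a r < (1 - d) / k"
      unfolding eventually_at_top_linorder by blast
    have "\<forall>\<^sub>F r in at_top. - Y r < - k"
    proof (rule eventually_below_barrier[of S "\<lambda>r. - Y r" "\<lambda>r. - (q r * (1 - a r * Y r))" "- k" "c * d"])
      fix r assume r: "S \<le> r" "- k \<le> - Y r"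
      have "a r * Y r \<le> (1 - d) / k * k" using S[of r] r \<open>k > 0\<close> \<open>d > 0\<close> pos[of r]
        by (intro mult_mono) (auto intro: less_imp_le less_trans)
      then have "d \<le> 1 - a r * Y r" using \<open>k > 0\<close> by simp
      then have "c * d \<le> q r * (1 - a r * Y r)"
        using q(1)[of r] S[of r] r \<open>c > 0\<close> \<open>d > 0\<close> by (intro mult_mono) auto
      then show "- (q r * (1 - a r * Y r)) \<le> - (c * d)" by simp
    qed (use der S \<open>c > 0\<close> \<open>d > 0\<close> in \<open>auto intro!: DERIV_minus\<close>)
    then show ?thesis by simp
  qed
qed

section \<open>Limits and integrals on half-lines\<close>

lemma bounded_mono_tendsto_at_top:
  fixes f :: "real \<Rightarrow> real"
  assumes mono: "\<And>r s. a \<le> r \<Longrightarrow> r \<le> s \<Longrightarrow> f r \<le> f s" and bound: "\<And>r. a \<le> r \<Longrightarrow> f r \<le> B"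
  obtains T where "(f \<longlongrightarrow> T) at_top" "\<And>r. a \<le> r \<Longrightarrow> f r \<le> T"
proof
  define T where "T = (SUP r\<in>{a..}. f r)"
  have bdd: "bdd_above (f ` {a..})" using bound by (auto intro!: bdd_aboveI)
  show le: "f r \<le> T" if "a \<le> r" for r unfolding T_def using that bdd by (intro cSUP_upper) auto
  show "(f \<longlongrightarrow> T) at_top"
  proof (rule increasing_tendsto)
    show "\<forall>\<^sub>F r in at_top. f r \<le> T" using le eventually_at_top_linorder by blast
    fix x assume "x < T"
    then obtain s where s: "s \<ge> a" "x < f s"
      unfolding T_def using less_cSUP_iff[OF _ bdd] by auto
    then have "x < f r" if "r \<ge> s" for r using mono[of s r] that by auto
    then show "\<forall>\<^sub>F r in at_top. x < f r" using eventually_at_top_linorder by blast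
  qed
qed

lemma improper_FTC_nonneg:
  fixes f F :: "real \<Rightarrow> real"
  assumes der: "\<And>x. a \<le> x \<Longrightarrow> (F has_real_derivative f x) (at x)"
    and cont: "continuous_on {a..} f" and nonneg: "\<And>x. a \<le> x \<Longrightarrow> 0 \<le> f x"
    and lim: "(F \<longlongrightarrow> T) at_top"
  shows "set_integrable lborel {a..} f" "(LBINT x:{a..}. f x) = T - F a"
proof -
  define g where "g = (\<lambda>x. indicator {a..} x *\<^sub>R f x)"
  have gm: "g \<in> borel_measurable borel"
    unfolding g_def by (rule borel_measurable_continuous_on_indicator[OF _ cont]) simp
  have "(\<integral>\<^sup>+x. ennreal (g x) * indicator {a ..} x \<partial>lborel) = T - F a"
    by (rule nn_integral_FTC_atLeast[OF gm _ _ lim]) (auto simp: g_def der nonneg)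
  moreover have "(\<lambda>x. ennreal (g x) * indicator {a ..} x) = (\<lambda>x. ennreal (g x))"
    by (auto simp: g_def indicator_def)
  ultimately have nn: "(\<integral>\<^sup>+x. ennreal (g x) \<partial>lborel) = ennreal (T - F a)" by simp
  have g0: "g x \<ge> 0" for x using nonneg[of x] by (auto simp: g_def indicator_def)
  have "F a \<le> T"
  proof (rule tendsto_lowerbound[OF lim])
    have "F a \<le> F x" if "a \<le> x" for x
      by (rule DERIV_nonneg_imp_nondecreasing[OF that]) (use der nonneg in auto)
    then show "\<forall>\<^sub>F x in at_top. F a \<le> F x" using eventually_at_top_linorder by blast
  qed simp
  have "has_bochner_integral lborel g (T - F a)"
    by (rule has_bochner_integral_nn_integral) (use gm g0 nn \<open>F a \<le> T\<close> in auto)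
  then show "set_integrable lborel {a..} f" "(LBINT x:{a..}. f x) = T - F a"
    by (auto simp: set_integrable_def set_lebesgue_integral_def g_def has_bochner_integral_iff)
qed

text \<open>
  The differential inequality makes \<open>F r * exp (c * r)\<close> nonincreasing.
\<close>

lemma exponential_decay:
  fixes F F' :: "real \<Rightarrow> real"
  assumes der: "\<And>r. r \<ge> a \<Longrightarrow> (F has_real_derivative F' r) (at r)"
    and nonneg: "\<And>r. r \<ge> a \<Longrightarrow> F r \<ge> 0"
    and le: "\<And>r. r \<ge> a \<Longrightarrow> F' r \<le> - c * F r" and "c > 0"
  shows "(F \<longlongrightarrow> 0) at_top" "set_integrable lborel {a..} F"
proof -
  define K where "K = F a * exp (c * a)"
  have bound: "F r \<le> K * exp (- c * r)" if "r \<ge> a" for r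
  proof -
    have "F r * exp (c * r) \<le> F a * exp (c * a)"
    proof (rule DERIV_nonpos_imp_nonincreasing[OF that])
      fix x assume x: "a \<le> x" "x \<le> r"
      have "((\<lambda>r. F r * exp (c * r)) has_real_derivative (F' x + c * F x) * exp (c * x)) (at x)"
        by (auto intro!: derivative_eq_intros der x simp: algebra_simps)
      then show "\<exists>y. ((\<lambda>r. F r * exp (c * r)) has_real_derivative y) (at x) \<and> y \<le> 0"
        using le[OF x(1)] by (auto simp: mult_le_0_iff)
    qed
    then show ?thesis by (simp add: K_def exp_minus field_simps)
  qed
  have e0: "((\<lambda>r. exp (- c * r)) \<longlongrightarrow> 0) at_top"
    using \<open>c > 0\<close> by real_asymp
  have "((\<lambda>r. K * exp (- c * r)) \<longlongrightarrow> K * 0) at_top"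
    by (intro tendsto_intros e0)
  then have lim: "((\<lambda>r. K * exp (- c * r)) \<longlongrightarrow> 0) at_top" by simp
  show "(F \<longlongrightarrow> 0) at_top"
    by (rule tendsto_sandwich[OF _ _ tendsto_const lim])
      (use nonneg bound eventually_at_top_linorder in blast)+
  have "K \<ge> 0" using nonneg[of a] by (simp add: K_def)
  have lim2: "((\<lambda>r. - (K / c) * exp (- c * r)) \<longlongrightarrow> - (K / c) * 0) at_top"
    by (intro tendsto_intros e0)
  have int: "set_integrable lborel {a..} (\<lambda>r. K * exp (- c * r))"
    by (rule improper_FTC_nonneg(1)[OF _ _ _ lim2])
      (use \<open>K \<ge> 0\<close> \<open>c > 0\<close> in \<open>auto intro!: derivative_eq_intros continuous_intros\<close>)
  have cont: "continuous_on {a..} F"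
    using DERIV_isCont[OF der] by (intro continuous_at_imp_continuous_on) auto
  have meas: "(\<lambda>x. indicator {a..} x *\<^sub>R F x) \<in> borel_measurable lborel"
    using borel_measurable_continuous_on_indicator[OF _ cont] by simp
  show "set_integrable lborel {a..} F"
    using int unfolding set_integrable_def
    by (rule Bochner_Integration.integrable_bound[OF _ meas])
      (use nonneg bound \<open>K \<ge> 0\<close> in \<open>auto simp: indicator_def\<close>)
qed

lemma set_integrable_bounded_interval:
  fixes f :: "real \<Rightarrow> real"
  assumes "continuous_on {a..} f"
  shows "set_integrable lborel {a<..<r} f" "set_integrable lborel {a..r} f"
proof -
  show 1: "set_integrable lborel {a..r} f"
    by (rule borel_integrable_atLeastAtMost'[OF continuous_on_subset[OF assms]]) auto
  show "set_integrable lborel {a<..<r} f"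
    by (rule set_integrable_subset[OF 1]) auto
qed

lemma primitive_deriv:
  fixes f :: "real \<Rightarrow> real"
  assumes f: "continuous_on {a..} f" and r: "r > a"
  shows "((\<lambda>r. LBINT s:{a<..<r}. f s) has_real_derivative f r) (at r)"
proof -
  have eq: "(LBINT s:{a<..<x}. f s) = integral {a..x} f" for x
    using set_borel_integral_eq_integral(2)[OF set_integrable_bounded_interval(1)[OF f, of x]]
    by (simp add: integral_open_interval_real)
  have "((\<lambda>x. integral {a..x} f) has_real_derivative f r) (at r within {a..r+1})"
    by (rule integral_has_real_derivative) (use r in \<open>auto intro: continuous_on_subset[OF f]\<close>)
  moreover have "at r within {a..r+1} = at r" by (rule at_within_interior) (use r in auto)
  ultimately show ?thesis unfolding eq by simp
qed

lemma primitive_mono: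
  fixes f :: "real \<Rightarrow> real"
  assumes f: "continuous_on {a..} f" and pos: "\<And>x. x \<ge> a \<Longrightarrow> f x \<ge> 0" and "a < r" "r \<le> s"
  shows "(LBINT s:{a<..<r}. f s) \<le> (LBINT s:{a<..<s}. f s)"
proof (rule DERIV_nonneg_imp_nondecreasing[OF \<open>r \<le> s\<close>])
  fix x assume "r \<le> x"
  then have "a < x" using \<open>a < r\<close> by simp
  then show "\<exists>y. ((\<lambda>r. LBINT s:{a<..<r}. f s) has_real_derivative y) (at x) \<and> 0 \<le> y"
    using primitive_deriv[OF f] pos[of x] by (intro exI[of _ "f x"]) auto
qed

lemma primitive_bounded:
  fixes f :: "real \<Rightarrow> real"
  assumes f: "continuous_on {a..} f" and pos: "\<And>x. x \<ge> a \<Longrightarrow> f x \<ge> 0"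
    and int: "set_integrable lborel {a<..} f"
  shows "(LBINT s:{a<..<r}. f s) \<le> (LBINT s:{a<..}. f s)"
  unfolding set_lebesgue_integral_def
  by (rule integral_mono)
    (use int set_integrable_bounded_interval(1)[OF f] pos in
      \<open>auto simp: set_integrable_def indicator_def\<close>)

text \<open>
  A bounded primitive of a nonnegative function would converge, and the function would be integrable.
\<close>

lemma primitive_at_top:
  fixes f :: "real \<Rightarrow> real"
  assumes f: "continuous_on {a..} f" and pos: "\<And>x. x \<ge> a \<Longrightarrow> f x \<ge> 0"
    and int: "\<not> set_integrable lborel {a<..} f"
  shows "filterlim (\<lambda>r. LBINT s:{a<..<r}. f s) at_top at_top"
proof -
  define H where "H = (\<lambda>r. LBINT s:{a<..<r}. f s)"
  have mono: "H r \<le> H s" if "a + 1 \<le> r" "r \<le> s" for r s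
    unfolding H_def by (rule primitive_mono[OF f pos]) (use that in auto)
  have "\<exists>r\<ge>a+1. H r > Z" for Z
  proof (rule ccontr)
    assume "\<not> ?thesis"
    then have bd: "H r \<le> Z" if "r \<ge> a + 1" for r using that by (auto simp: not_less)
    obtain T where T: "(H \<longlongrightarrow> T) at_top"
      by (rule bounded_mono_tendsto_at_top[of "a + 1" H Z]) (use mono bd in auto)
    have "set_integrable lborel {a+1..} f"
    proof (rule improper_FTC_nonneg(1)[OF _ _ _ T])
      show "(H has_real_derivative f x) (at x)" if "a + 1 \<le> x" for x
        unfolding H_def by (rule primitive_deriv[OF f]) (use that in auto)
    qed (use pos in \<open>auto intro: continuous_on_subset[OF f]\<close>)
    then have "set_integrable lborel ({a..a+1} \<union> {a+1..}) f"
      by (intro set_integrable_Un set_integrable_bounded_interval(2)[OF f]) auto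
    then have "set_integrable lborel {a<..} f"
      by (rule set_integrable_subset) auto
    with int show False by simp
  qed
  then have "\<forall>\<^sub>F r in at_top. Z \<le> H r" for Z
    using mono unfolding eventually_at_top_linorder by (meson less_imp_le order_trans)
  then show ?thesis by (simp add: filterlim_at_top H_def)
qed

lemma not_set_integrable_bounded_below:
  fixes f :: "real \<Rightarrow> real"
  assumes k: "k > 0" "\<And>r. r \<ge> S \<Longrightarrow> k \<le> f r"
  shows "\<not> set_integrable lborel {S..} f"
proof
  assume int: "set_integrable lborel {S..} f"
  have "integrable lborel (\<lambda>x. indicator {S..} x * k)"
    by (rule Bochner_Integration.integrable_bound[OF int[unfolded set_integrable_def]])
      (use k in \<open>auto simp: indicator_def intro!: AE_I2 order_trans[OF _ abs_ge_self]\<close>)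
  then have "integrable lborel (indicat_real {S..})"
    using k by simp
  then have fin: "emeasure lborel {S..} < \<infinity>"
    by (subst (asm) integrable_indicator_iff) auto
  have "of_nat j \<le> emeasure lborel {S..}" for j
  proof -
    have "emeasure lborel {S..S + real j} \<le> emeasure lborel {S..}"
      by (rule emeasure_mono) auto
    then show ?thesis by (simp add: ennreal_of_nat_eq_real_of_nat)
  qed
  moreover obtain j where "emeasure lborel {S..} < of_nat j"
    using ennreal_Ex_less_of_nat fin by (metis infinity_ennreal_def)
  ultimately show False by (meson not_less)
qed

section \<open>The radial equation near infinity\<close>

text \<open>
  The radial equation on a half-line, away from the pole. The function \<open>q\<close> is a regularized stand-in
  for \<open>\<psi>' / \<psi>\<close>: when this quotient has a finite limit its derivative is not under control, and the
  constant limit is used instead; when it diverges, the quotient itself is used. The last three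
  assumptions are what both choices have in common.
\<close>

locale lane_emden_ode =
  fixes \<psi> \<psi>' v v' q q' :: "real \<Rightarrow> real" and m :: nat and p R c :: real
  assumes m: "m > 0" and p: "p > 1"
    and psi_deriv: "\<And>r. r \<ge> R \<Longrightarrow> (\<psi> has_real_derivative \<psi>' r) (at r)"
    and psi_pos: "\<And>r. r \<ge> R \<Longrightarrow> \<psi> r > 0"
    and v_deriv: "\<And>r. r \<ge> R \<Longrightarrow> (v has_real_derivative v' r) (at r)"
    and v'_deriv: "\<And>r. r \<ge> R \<Longrightarrow>
      (v' has_real_derivative - (real m * (\<psi>' r / \<psi> r) * v' r) - v r powr p) (at r)"
    and v_pos: "\<And>r. r \<ge> R \<Longrightarrow> v r > 0"
    and v'_neg: "\<And>r. r \<ge> R \<Longrightarrow> v' r < 0"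
    and q_deriv: "\<And>r. r \<ge> R \<Longrightarrow> (q has_real_derivative q' r) (at r)"
    and q_ge: "\<And>r. r \<ge> R \<Longrightarrow> q r \<ge> c" and c_pos: "c > 0"
    and q_asymp: "((\<lambda>r. (\<psi>' r / \<psi> r) / q r) \<longlongrightarrow> 1) at_top"
    and q'_small: "((\<lambda>r. q' r / (q r)\<^sup>2) \<longlongrightarrow> 0) at_top"
    and forcing_small: "((\<lambda>r. v r powr (p - 1) / (q r)\<^sup>2) \<longlongrightarrow> 0) at_top"
begin

definition Q :: "real \<Rightarrow> real" where "Q r = \<psi>' r / \<psi> r"

text \<open>
  The logarithmic decay rate of \<open>v\<close> in units of \<open>q\<close>; its limit separates the two regimes.
\<close>

definition y :: "real \<Rightarrow> real" where "y r = - v' r / (v r * q r)"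

definition flux :: "real \<Rightarrow> real" where "flux r = - (\<psi> r ^ m * v' r)"

lemma q_pos: "r \<ge> R \<Longrightarrow> q r > 0"
  using q_ge[of r] c_pos by linarith

lemma y_pos: "r \<ge> R \<Longrightarrow> y r > 0"
  using v_pos[of r] v'_neg[of r] q_pos[of r] by (simp add: y_def field_simps)

lemma v'_eq: "r \<ge> R \<Longrightarrow> v' r = - (y r * q r * v r)"
  using v_pos[of r] q_pos[of r] by (simp add: y_def)

lemma powr_p_eq: "r \<ge> R \<Longrightarrow> v r powr p = v r * v r powr (p - 1)"
  using v_pos[of r] by (metis add.commute diff_add_cancel powr_add powr_one less_imp_le)

lemma Q_asymp: "((\<lambda>r. Q r / q r) \<longlongrightarrow> 1) at_top"
  using q_asymp by (simp add: Q_def)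

lemma v''_eq: "r \<ge> R \<Longrightarrow>
  (v' has_real_derivative - (real m * Q r * v' r) - v r * v r powr (p - 1)) (at r)"
  using v'_deriv[of r] powr_p_eq[of r] by (simp add: Q_def)

lemma eventually_ge_R: "\<forall>\<^sub>F r in at_top. r \<ge> R"
  by (rule eventually_ge_at_top)

lemma psi_power_pos: "r \<ge> R \<Longrightarrow> \<psi> r ^ m > 0"
  by (simp add: psi_pos)

lemma psi_power_deriv:
  "r \<ge> R \<Longrightarrow> ((\<lambda>r. \<psi> r ^ m) has_real_derivative real m * Q r * \<psi> r ^ m) (at r)"
proof -
  assume r: "r \<ge> R"
  have "\<psi> r ^ m = \<psi> r * \<psi> r ^ (m - Suc 0)"
    using m by (metis Suc_pred power_Suc)
  then show ?thesis
    using psi_pos[OF r] unfolding Q_def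
    by (auto intro!: derivative_eq_intros psi_deriv r simp: field_simps)
qed

lemma y_deriv:
  assumes r: "r \<ge> R"
  shows "(y has_real_derivative
    q r * (y r * (y r - (real m * (Q r / q r) + q' r / (q r)\<^sup>2)) + v r powr (p - 1) / (q r)\<^sup>2)) (at r)"
proof -
  have nz: "v r \<noteq> 0" "q r \<noteq> 0" using v_pos[OF r] q_pos[OF r] by auto
  have "(y has_real_derivative (- (- (real m * Q r * v' r) - v r * v r powr (p - 1)) * (v r * q r)
      - (- v' r) * (v' r * q r + v r * q' r)) / ((v r * q r) * (v r * q r))) (at r)"
    unfolding y_def using nz
    by (intro DERIV_cong[OF DERIV_divide[OF DERIV_minus[OF v''_eq[OF r]] DERIV_mult[OF v_deriv[OF r] q_deriv[OF r]]]])
      (auto simp: algebra_simps)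
  also have "(- (- (real m * Q r * v' r) - v r * v r powr (p - 1)) * (v r * q r)
      - (- v' r) * (v' r * q r + v r * q' r)) / ((v r * q r) * (v r * q r)) =
    q r * (y r * (y r - (real m * (Q r / q r) + q' r / (q r)\<^sup>2)) + v r powr (p - 1) / (q r)\<^sup>2)"
    using nz unfolding y_def by (simp add: field_simps power2_eq_square)
  finally show ?thesis .
qed

lemma slow_or_fast: "(y \<longlongrightarrow> 0) at_top \<or> (y \<longlongrightarrow> real m) at_top"
proof (rule riccati_dichotomy[OF y_deriv q_ge c_pos y_pos])
  have "((\<lambda>r. real m * (Q r / q r) + q' r / (q r)\<^sup>2) \<longlongrightarrow> real m * 1 + 0) at_top"
    by (intro tendsto_intros Q_asymp q'_small)
  then show "((\<lambda>r. real m * (Q r / q r) + q' r / (q r)\<^sup>2) \<longlongrightarrow> real m) at_top" by simp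
qed (use m forcing_small in auto)

lemma v_antimono: "R \<le> r \<Longrightarrow> r \<le> s \<Longrightarrow> v s \<le> v r"
proof (rule DERIV_nonpos_imp_nonincreasing[of r s])
  fix x assume "R \<le> r" "r \<le> x"
  then have "R \<le> x" by simp
  then show "\<exists>z. (v has_real_derivative z) (at x) \<and> z \<le> 0"
    using v_deriv[of x] v'_neg[of x] by (intro exI[of _ "v' x"]) auto
qed

text \<open>
  The common form of the decay estimates below: the logarithmic derivative is asymptotic to
  a negative multiple of \<open>q\<close>, and \<open>q\<close> is bounded away from \<open>0\<close>.
\<close>

lemma log_derivative_decay:
  fixes F k :: "real \<Rightarrow> real"
  assumes der: "\<And>r. r \<ge> R \<Longrightarrow> (F has_real_derivative F r * (q r * k r)) (at r)"
    and nonneg: "\<And>r. r \<ge> R \<Longrightarrow> F r \<ge> 0"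
    and k: "(k \<longlongrightarrow> - \<kappa>) at_top" and "\<kappa> > 0"
  shows "(F \<longlongrightarrow> 0) at_top" "\<exists>S\<ge>R. \<forall>r\<ge>S. set_integrable lborel {r..} F"
proof -
  have "\<forall>\<^sub>F r in at_top. k r < - (\<kappa> / 2)"
    using order_tendstoD(2)[OF k, of "- (\<kappa> / 2)"] \<open>\<kappa> > 0\<close> by simp
  then have "\<forall>\<^sub>F r in at_top. r \<ge> R \<and> k r < - (\<kappa> / 2)"
    using eventually_ge_R by eventually_elim simp
  then obtain S where S: "\<And>r. r \<ge> S \<Longrightarrow> r \<ge> R \<and> k r < - (\<kappa> / 2)"
    unfolding eventually_at_top_linorder by blast
  have le: "F r * (q r * k r) \<le> - (c * (\<kappa> / 2)) * F r" if "r \<ge> S" for r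
  proof -
    have "c * (\<kappa> / 2) \<le> q r * (- k r)"
      using S[OF that] q_ge[of r] c_pos \<open>\<kappa> > 0\<close> by (intro mult_mono) auto
    then have "F r * (c * (\<kappa> / 2)) \<le> F r * (q r * (- k r))"
      using nonneg[of r] S[OF that] by (intro mult_left_mono) auto
    then show ?thesis by (simp add: algebra_simps)
  qed
  have pos: "c * (\<kappa> / 2) > 0" using c_pos \<open>\<kappa> > 0\<close> by simp
  have decay: "(F \<longlongrightarrow> 0) at_top" "set_integrable lborel {r..} F" if "r \<ge> S" for r
    using exponential_decay[of r F "\<lambda>r. F r * (q r * k r)" "c * (\<kappa> / 2)"] der nonneg le S that pos
    by auto
  show "(F \<longlongrightarrow> 0) at_top" by (rule decay(1)[OF order_refl])
  show "\<exists>S\<ge>R. \<forall>r\<ge>S. set_integrable lborel {r..} F" using decay(2) S by blast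
qed

lemma mass_density_deriv:
  assumes r: "r \<ge> R"
  shows "((\<lambda>r. \<psi> r ^ m * (v r)\<^sup>2) has_real_derivative
    (\<psi> r ^ m * (v r)\<^sup>2) * (q r * (real m * (Q r / q r) - 2 * y r))) (at r)"
  using v_pos[OF r] q_pos[OF r]
  by (intro DERIV_cong[OF DERIV_mult[OF psi_power_deriv[OF r] DERIV_power[OF v_deriv[OF r], of 2]]])
    (simp add: v'_eq[OF r] field_simps power2_eq_square)

lemma energy_density_deriv:
  assumes r: "r \<ge> R"
  shows "((\<lambda>r. \<psi> r ^ m * (v' r)\<^sup>2) has_real_derivative
    (\<psi> r ^ m * (v' r)\<^sup>2) * (q r * (2 * ((v r powr (p - 1) / (q r)\<^sup>2) / y r) - real m * (Q r / q r)))) (at r)"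
  using v_pos[OF r] q_pos[OF r] y_pos[OF r]
  by (intro DERIV_cong[OF DERIV_mult[OF psi_power_deriv[OF r] DERIV_power[OF v''_eq[OF r], of 2]]])
    (simp add: v'_eq[OF r] field_simps power2_eq_square)

lemma inverse_psi_power_deriv:
  assumes r: "r \<ge> R"
  shows "((\<lambda>r. 1 / \<psi> r ^ m) has_real_derivative 1 / \<psi> r ^ m * (q r * (- (real m * (Q r / q r))))) (at r)"
  using psi_pos[OF r] q_pos[OF r]
  by (intro DERIV_cong[OF DERIV_divide[OF DERIV_const psi_power_deriv[OF r]]])
    (auto simp: field_simps)

text \<open>
  The first-order term of the equation is absorbed by the integrating factor \<open>\<psi> ^ m\<close>.
\<close>

lemma flux_deriv:
  assumes r: "r \<ge> R"
  shows "(flux has_real_derivative \<psi> r ^ m * v r * v r powr (p - 1)) (at r)"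
  unfolding flux_def
  by (intro DERIV_cong[OF DERIV_minus[OF DERIV_mult[OF psi_power_deriv[OF r] v''_eq[OF r]]]])
    (simp add: algebra_simps)

lemma flux_pos: "r \<ge> R \<Longrightarrow> flux r > 0"
  using psi_pos[of r] v'_neg[of r] by (simp add: flux_def mult_less_0_iff)

lemma flux_mono: "R \<le> r \<Longrightarrow> r \<le> s \<Longrightarrow> flux r \<le> flux s"
proof (rule DERIV_nonneg_imp_nondecreasing[of r s])
  fix x assume "R \<le> r" "r \<le> x"
  then have "R \<le> x" by simp
  then show "\<exists>z. (flux has_real_derivative z) (at x) \<and> 0 \<le> z"
    using flux_deriv[of x] psi_pos[of x] v_pos[of x]
    by (intro exI[of _ "\<psi> x ^ m * v x * v x powr (p - 1)"]) auto
qed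

lemma flux_eq: "r \<ge> R \<Longrightarrow> flux r = \<psi> r ^ m * v r * (y r * q r)"
  by (simp add: flux_def v'_eq)

lemma inverse_psi_power_integrable:
  "\<exists>S\<ge>R. \<forall>r\<ge>S. set_integrable lborel {r..} (\<lambda>s. 1 / \<psi> s ^ m)"
proof -
  have "((\<lambda>r. - (real m * (Q r / q r))) \<longlongrightarrow> - (real m * 1)) at_top"
    by (intro tendsto_intros Q_asymp)
  then have k: "((\<lambda>r. - (real m * (Q r / q r))) \<longlongrightarrow> - real m) at_top" by simp
  show ?thesis
    by (rule log_derivative_decay(2)[OF inverse_psi_power_deriv _ k])
      (use psi_power_pos m in \<open>auto simp: less_imp_le\<close>)
qed

context
  assumes fast: "(y \<longlongrightarrow> real m) at_top"
begin

lemma fast_decay_rate: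
  obtains S where "S \<ge> R" "\<And>r. r \<ge> S \<Longrightarrow> real m / 2 * c \<le> y r * q r"
proof -
  have "\<forall>\<^sub>F r in at_top. real m / 2 < y r"
    using order_tendstoD(1)[OF fast, of "real m / 2"] m by simp
  then have "\<forall>\<^sub>F r in at_top. r \<ge> R \<and> real m / 2 < y r"
    using eventually_ge_R by eventually_elim simp
  then obtain S where S: "\<And>r. r \<ge> S \<Longrightarrow> r \<ge> R \<and> real m / 2 < y r"
    unfolding eventually_at_top_linorder by blast
  have "real m / 2 * c \<le> y r * q r" if "r \<ge> S" for r
    using S[OF that] q_ge[of r] c_pos by (intro mult_mono) auto
  then show ?thesis using that S by blast
qed

lemma fast_v_tendsto: "(v \<longlongrightarrow> 0) at_top"
proof -
  have der: "(v has_real_derivative v r * (q r * - y r)) (at r)" if "r \<ge> R" for r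
    using v_deriv[OF that] v'_eq[OF that] by (simp add: algebra_simps)
  have k: "((\<lambda>r. - y r) \<longlongrightarrow> - real m) at_top" by (intro tendsto_intros fast)
  show ?thesis
    by (rule log_derivative_decay(1)[OF der _ k]) (use v_pos m in \<open>auto intro: less_imp_le\<close>)
qed

text \<open>
  Since \<open>(ln flux)' = v powr (p - 1) / (y q)\<close> while \<open>(v powr (p - 1))' = - (p - 1) (y q) v powr (p - 1)\<close>,
  and \<open>y q\<close> is bounded below, a multiple of \<open>v powr (p - 1)\<close> compensates the growth of \<open>ln flux\<close>.
\<close>

lemma fast_flux_limit:
  obtains L where "L > 0" "(flux \<longlongrightarrow> L) at_top" "\<And>r. r \<ge> R \<Longrightarrow> flux r \<le> L"
proof -
  obtain S where S: "S \<ge> R" "\<And>r. r \<ge> S \<Longrightarrow> real m / 2 * c \<le> y r * q r"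
    by (rule fast_decay_rate) blast
  define z where "z = real m / 2 * c"
  have z: "z > 0" using m c_pos by (simp add: z_def)
  \<comment> \<open>The factor makes the derivative \<open>v powr (p - 1) * (1 / (y q) - y q / z\<^sup>2)\<close>, which is at most \<open>0\<close> as \<open>y q \<ge> z\<close>.\<close>
  define G where "G = (\<lambda>r. ln (flux r) + v r powr (p - 1) / ((p - 1) * z\<^sup>2))"
  have Gle: "G r \<le> G S" if "r \<ge> S" for r
  proof (rule DERIV_nonpos_imp_nonincreasing[OF that])
    fix x assume "S \<le> x" "x \<le> r"
    then have x: "x \<ge> R" "z \<le> y x * q x" using S by (auto simp: z_def)
    have pos: "flux x > 0" "v x > 0" "y x > 0" "q x > 0" "\<psi> x > 0"
      using flux_pos v_pos y_pos q_pos psi_pos x by auto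
    have "((\<lambda>r. v r powr (p - 1)) has_real_derivative (p - 1) * v x powr (p - 1) * (- (y x * q x))) (at x)"
    proof -
      have "v x powr (p - 1 - 1) * v' x = v x powr (p - 1) * (- (y x * q x))"
        using pos v'_eq[OF x(1)] by (simp add: powr_diff field_simps power2_eq_square)
      then show ?thesis
        using DERIV_fun_powr[OF v_deriv[OF x(1)] pos(2), of "p - 1"]
        by (simp add: algebra_simps)
    qed
    moreover have "((\<lambda>r. ln (flux r)) has_real_derivative v x powr (p - 1) / (y x * q x)) (at x)"
      using DERIV_ln_divide[OF pos(1)] flux_deriv[OF x(1)] pos flux_eq[OF x(1)]
      by (auto intro!: derivative_eq_intros simp: field_simps)
    ultimately have D: "(G has_real_derivative v x powr (p - 1) / (y x * q x)
        + (p - 1) * v x powr (p - 1) * (- (y x * q x)) / ((p - 1) * z\<^sup>2)) (at x)"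
      unfolding G_def by (intro DERIV_add DERIV_cdivide)
    have "1 / (y x * q x) \<le> (y x * q x) / z\<^sup>2"
    proof -
      have "z\<^sup>2 \<le> (y x * q x)\<^sup>2" using x z by (intro power_mono) auto
      then show ?thesis using pos z by (simp add: field_simps power2_eq_square)
    qed
    then have "v x powr (p - 1) * (1 / (y x * q x)) \<le> v x powr (p - 1) * ((y x * q x) / z\<^sup>2)"
      by (intro mult_left_mono) auto
    moreover have "(p - 1) * v x powr (p - 1) * (- (y x * q x)) / ((p - 1) * z\<^sup>2)
        = - (v x powr (p - 1) * ((y x * q x) / z\<^sup>2))"
      using p z by (simp add: divide_simps)
    ultimately have "v x powr (p - 1) / (y x * q x)
        + (p - 1) * v x powr (p - 1) * (- (y x * q x)) / ((p - 1) * z\<^sup>2) \<le> 0"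
      by simp
    with D show "\<exists>w. (G has_real_derivative w) (at x) \<and> w \<le> 0" by blast
  qed
  have bound: "flux r \<le> exp (G S)" if "r \<ge> S" for r
  proof -
    have "ln (flux r) \<le> G r" using p by (simp add: G_def)
    then have "ln (flux r) \<le> G S" using Gle[OF that] by simp
    then have "exp (ln (flux r)) \<le> exp (G S)" by simp
    then show ?thesis using flux_pos[of r] that S by simp
  qed
  obtain L where L: "(flux \<longlongrightarrow> L) at_top" "\<And>r. r \<ge> S \<Longrightarrow> flux r \<le> L"
    by (rule bounded_mono_tendsto_at_top[of S flux]) (use flux_mono S bound in auto)
  have le: "flux r \<le> L" if "r \<ge> R" for r
    using flux_mono[OF that, of "max r S"] L(2)[of "max r S"] by simp
  then have "L > 0" using less_le_trans[OF flux_pos[of R] le[of R]] by simp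
  with L le that show ?thesis by blast
qed

lemma fast_mass_finite:
  "\<exists>S\<ge>R. \<forall>r\<ge>S. set_integrable lborel {r..} (\<lambda>s. \<psi> s ^ m * (v s)\<^sup>2)"
proof -
  have "((\<lambda>r. real m * (Q r / q r) - 2 * y r) \<longlongrightarrow> real m * 1 - 2 * real m) at_top"
    by (intro tendsto_intros Q_asymp fast)
  then have k: "((\<lambda>r. real m * (Q r / q r) - 2 * y r) \<longlongrightarrow> - real m) at_top" by simp
  show ?thesis
    by (rule log_derivative_decay(2)[OF mass_density_deriv _ k])
      (use psi_power_pos m in \<open>auto simp: less_imp_le\<close>)
qed

lemma fast_energy_finite:
  "\<exists>S\<ge>R. \<forall>r\<ge>S. set_integrable lborel {r..} (\<lambda>s. \<psi> s ^ m * (v' s)\<^sup>2)"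
proof -
  have "((\<lambda>r. 2 * ((v r powr (p - 1) / (q r)\<^sup>2) / y r) - real m * (Q r / q r))
      \<longlongrightarrow> 2 * (0 / real m) - real m * 1) at_top"
    using m by (intro tendsto_intros Q_asymp fast forcing_small) auto
  then have k: "((\<lambda>r. 2 * ((v r powr (p - 1) / (q r)\<^sup>2) / y r) - real m * (Q r / q r))
      \<longlongrightarrow> - real m) at_top" by simp
  show ?thesis
    by (rule log_derivative_decay(2)[OF energy_density_deriv _ k])
      (use psi_power_pos m in \<open>auto simp: less_imp_le\<close>)
qed

lemma fast_profile_finite:
  assumes L: "(flux \<longlongrightarrow> L) at_top" and q: "(q \<longlongrightarrow> l) at_top" and "l > 0"
  shows "((\<lambda>r. \<psi> r ^ m * v r) \<longlongrightarrow> L / (real m * l)) at_top"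
proof -
  have "((\<lambda>r. flux r / (y r * q r)) \<longlongrightarrow> L / (real m * l)) at_top"
    using m \<open>l > 0\<close> by (intro tendsto_intros L fast q) auto
  moreover have "\<forall>\<^sub>F r in at_top. flux r / (y r * q r) = \<psi> r ^ m * v r"
    using eventually_ge_R
  proof eventually_elim
    case (elim r)
    then show ?case using y_pos[of r] q_pos[of r] by (simp add: flux_eq)
  qed
  ultimately show ?thesis by (rule Lim_transform_eventually)
qed

text \<open>
  As \<open>v\<close> tends to \<open>0\<close>, it is the tail integral of \<open>- v' = flux / \<psi> ^ m\<close>, and the increasing flux lies
  between its value at \<open>r\<close> and its limit.
\<close>

lemma fast_profile_infinite:
  assumes L: "(flux \<longlongrightarrow> L) at_top" "\<And>r. r \<ge> R \<Longrightarrow> flux r \<le> L"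
  shows "((\<lambda>r. v r / (LBINT s:{r..}. 1 / \<psi> s ^ m)) \<longlongrightarrow> L) at_top"
proof -
  obtain S where S: "S \<ge> R" "\<And>r. r \<ge> S \<Longrightarrow> set_integrable lborel {r..} (\<lambda>s. 1 / \<psi> s ^ m)"
    using inverse_psi_power_integrable by blast
  have bounds: "flux r \<le> v r / (LBINT s:{r..}. 1 / \<psi> s ^ m) \<and> v r / (LBINT s:{r..}. 1 / \<psi> s ^ m) \<le> L"
    if "r \<ge> S" for r
  proof -
    define J where "J = (LBINT s:{r..}. 1 / \<psi> s ^ m)"
    have r: "r \<ge> R" using that S by simp
    have lim: "((\<lambda>s. - v s) \<longlongrightarrow> - 0) at_top" by (intro tendsto_intros fast_v_tendsto)
    have cont: "continuous_on {r..} (\<lambda>s. - v' s)"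
      using DERIV_isCont[OF v'_deriv] r by (intro continuous_at_imp_continuous_on) auto
    have der: "((\<lambda>s. - v s) has_real_derivative - v' s) (at s)" if "r \<le> s" for s
      using v_deriv[of s] that r by (auto intro!: derivative_eq_intros)
    have v'n: "0 \<le> - v' s" if "r \<le> s" for s
      using v'_neg[of s] that r by auto
    note FTC = improper_FTC_nonneg[OF der cont v'n lim]
    have eq: "- v' s = flux s * (1 / \<psi> s ^ m)" if "s \<ge> r" for s
      using psi_pos[of s] that r by (simp add: flux_def)
    note int = S(2)[OF that]
    have "flux r * J = (LBINT s:{r..}. flux r * (1 / \<psi> s ^ m))"
      unfolding J_def by (rule set_integral_mult_right[symmetric])
    also have "\<dots> \<le> (LBINT s:{r..}. - v' s)"
    proof (rule set_integral_mono)
      fix s assume "s \<in> {r..}"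
      then have s: "r \<le> s" by simp
      then show "flux r * (1 / \<psi> s ^ m) \<le> - v' s"
        unfolding eq[OF s] using psi_pos[of s] r flux_mono[OF r s] by (intro mult_right_mono) auto
    qed (use int FTC(1) in \<open>auto intro!: set_integrable_mult_right simp del: times_divide_eq_right\<close>)
    also have "\<dots> = v r" using FTC(2) by simp
    finally have 1: "flux r * J \<le> v r" .
    have "v r = (LBINT s:{r..}. - v' s)" using FTC(2) by simp
    also have "\<dots> \<le> (LBINT s:{r..}. L * (1 / \<psi> s ^ m))"
    proof (rule set_integral_mono)
      fix s assume "s \<in> {r..}"
      then have s: "r \<le> s" by simp
      then show "- v' s \<le> L * (1 / \<psi> s ^ m)"
        unfolding eq[OF s] using psi_pos[of s] r L(2)[of s] by (intro mult_right_mono) auto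
    qed (use int FTC(1) in \<open>auto intro!: set_integrable_mult_right simp del: times_divide_eq_right\<close>)
    also have "\<dots> = L * J" unfolding J_def by (rule set_integral_mult_right)
    finally have 2: "v r \<le> L * J" .
    have "L > 0" using flux_pos[OF r] L(2)[OF r] by simp
    have "J > 0" using 2 v_pos[OF r] \<open>L > 0\<close> by (meson less_le_trans zero_less_mult_pos)
    with 1 2 show ?thesis unfolding J_def[symmetric] by (simp add: field_simps)
  qed
  have ev: "\<forall>\<^sub>F r in at_top. S \<le> r" by (rule eventually_ge_at_top)
  show ?thesis
    by (rule tendsto_sandwich[OF _ _ L(1) tendsto_const]; rule eventually_mono[OF ev]) (use bounds in auto)
qed

end

context
  assumes slow: "(y \<longlongrightarrow> 0) at_top"
begin

text \<open>
  The logarithmic derivative of \<open>\<psi> ^ m * v\<^sup>2\<close> is \<open>q (m Q / q - 2 y)\<close>, which is eventually positive.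
\<close>

lemma slow_mass_infinite:
  obtains S k where "S \<ge> R" "k > 0" "\<And>r. r \<ge> S \<Longrightarrow> k \<le> \<psi> r ^ m * (v r)\<^sup>2"
proof -
  have "((\<lambda>r. real m * (Q r / q r) - 2 * y r) \<longlongrightarrow> real m * 1 - 2 * 0) at_top"
    by (intro tendsto_intros Q_asymp slow)
  then have "\<forall>\<^sub>F r in at_top. 0 < real m * (Q r / q r) - 2 * y r"
    by (rule order_tendstoD) (use m in simp)
  then have "\<forall>\<^sub>F r in at_top. r \<ge> R \<and> 0 < real m * (Q r / q r) - 2 * y r"
    using eventually_ge_R by eventually_elim simp
  then obtain S where S: "\<And>r. r \<ge> S \<Longrightarrow> r \<ge> R \<and> 0 < real m * (Q r / q r) - 2 * y r"
    unfolding eventually_at_top_linorder by blast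
  have "\<psi> S ^ m * (v S)\<^sup>2 \<le> \<psi> r ^ m * (v r)\<^sup>2" if "r \<ge> S" for r
  proof (rule DERIV_nonneg_imp_nondecreasing[OF that])
    fix x assume "S \<le> x" "x \<le> r"
    then have x: "x \<ge> R" "0 < real m * (Q x / q x) - 2 * y x" using S by auto
    show "\<exists>z. ((\<lambda>r. \<psi> r ^ m * (v r)\<^sup>2) has_real_derivative z) (at x) \<and> 0 \<le> z"
      by (rule exI, rule conjI, rule mass_density_deriv[OF x(1)])
        (use x psi_pos[OF x(1)] q_pos[OF x(1)] in simp)
  qed
  moreover have "\<psi> S ^ m * (v S)\<^sup>2 > 0" using psi_pos[of S] v_pos[of S] S by simp
  ultimately show ?thesis using that S by blast
qed

text \<open>
  To leading order the equation becomes \<open>m Q v' = - v powr p\<close>: the second derivative is negligible. This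
  is made precise by the linear equation for \<open>- q v' / v powr p\<close>.
\<close>

lemma slow_gradient_limit: "((\<lambda>r. - (Q r * v' r / v r powr p)) \<longlongrightarrow> 1 / real m) at_top"
proof -
  define Y where "Y = (\<lambda>r. - (q r * v' r / v r powr p))"
  \<comment> \<open>The logarithmic derivatives of \<open>q\<close>, \<open>- v'\<close> and \<open>v powr p\<close> contribute the three terms of \<open>a\<close>.\<close>
  define a where "a = (\<lambda>r. real m * (Q r / q r) - q' r / (q r)\<^sup>2 - p * y r)"
  have Yd: "(Y has_real_derivative q r * (1 - a r * Y r)) (at r)" if r: "r \<ge> R" for r
  proof -
    have nz: "v r \<noteq> 0" "q r \<noteq> 0" "v r powr p \<noteq> 0" using v_pos[OF r] q_pos[OF r] by auto
    have "((\<lambda>r. v r powr p) has_real_derivative p * v r powr p * (v' r / v r)) (at r)"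
      using DERIV_fun_powr[OF v_deriv[OF r] v_pos[OF r], of p] v_pos[OF r]
      by (simp add: powr_diff field_simps)
    then have "(Y has_real_derivative
        - (((q' r * v' r + q r * (- (real m * Q r * v' r) - v r powr p)) * v r powr p
          - q r * v' r * (p * v r powr p * (v' r / v r))) / (v r powr p * v r powr p))) (at r)"
      unfolding Y_def using nz v'_deriv[OF r]
      by (intro DERIV_cong[OF DERIV_minus[OF DERIV_divide[OF DERIV_mult[OF q_deriv[OF r] v'_deriv[OF r]]]]])
        (auto simp: Q_def algebra_simps)
    also have "- (((q' r * v' r + q r * (- (real m * Q r * v' r) - v r powr p)) * v r powr p
          - q r * v' r * (p * v r powr p * (v' r / v r))) / (v r powr p * v r powr p))
       = q r * (1 - a r * Y r)"
      using nz unfolding a_def Y_def y_def by (simp add: field_simps power2_eq_square)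
    finally show ?thesis .
  qed
  have "(a \<longlongrightarrow> real m * 1 - 0 - p * 0) at_top"
    unfolding a_def by (intro tendsto_intros Q_asymp q'_small slow)
  then have al: "(a \<longlongrightarrow> real m) at_top" by simp
  have Yp: "Y r > 0" if "r \<ge> R" for r
    using v_pos[OF that] q_pos[OF that] v'_neg[OF that] by (simp add: Y_def field_simps mult_less_0_iff)
  have "(Y \<longlongrightarrow> 1 / real m) at_top"
    by (rule linear_relaxation_limit[OF Yd q_ge c_pos Yp al]) (use m in auto)
  then have "((\<lambda>r. (Q r / q r) * Y r) \<longlongrightarrow> 1 * (1 / real m)) at_top"
    by (intro tendsto_mult Q_asymp)
  moreover have "\<forall>\<^sub>F r in at_top. (Q r / q r) * Y r = - (Q r * v' r / v r powr p)"
    using eventually_ge_R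
  proof eventually_elim
    case (elim r)
    then show ?case using q_pos[of r] by (simp add: Y_def)
  qed
  ultimately show ?thesis by (simp add: tendsto_cong)
qed

lemma eventually_Q_pos: "\<forall>\<^sub>F r in at_top. Q r > 0"
proof -
  have "\<forall>\<^sub>F r in at_top. 0 < Q r / q r" using order_tendstoD(1)[OF Q_asymp, of 0] by simp
  then show ?thesis using eventually_ge_R
  proof eventually_elim
    case (elim r)
    then show ?case using q_pos[of r] by (simp add: zero_less_divide_iff)
  qed
qed

lemma v_power_deriv:
  "r \<ge> R \<Longrightarrow> ((\<lambda>r. v r powr (1 - p)) has_real_derivative (1 - p) * (v' r / v r powr p)) (at r)"
  using DERIV_fun_powr[OF v_deriv[of r] v_pos[of r], of "1 - p"] v_pos[of r]
  by (simp add: powr_minus divide_inverse mult_ac)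

text \<open>
  The derivative of \<open>v powr (1 - p)\<close> is \<open>(1 - p) v' / v powr p\<close>, which is asymptotic to
  \<open>(p - 1) / m\<close> times the derivative of \<open>H\<close>.
\<close>

lemma slow_decay_rate:
  assumes H: "\<forall>\<^sub>F r in at_top. (H has_real_derivative 1 / Q r) (at r)" "filterlim H at_top at_top"
  shows "((\<lambda>r. v r powr (1 - p) / H r) \<longlongrightarrow> (p - 1) / real m) at_top"
proof (rule lhospital_at_top_at_top[OF H(2)])
  show "\<forall>\<^sub>F r in at_top. 1 / Q r \<noteq> 0" using eventually_Q_pos by eventually_elim simp
  show "\<forall>\<^sub>F r in at_top. ((\<lambda>r. v r powr (1 - p)) has_real_derivative (1 - p) * (v' r / v r powr p)) (at r)"
    using eventually_ge_R by eventually_elim (rule v_power_deriv)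
  show "\<forall>\<^sub>F r in at_top. (H has_real_derivative 1 / Q r) (at r)" by fact
  have "((\<lambda>r. (p - 1) * (- (Q r * v' r / v r powr p))) \<longlongrightarrow> (p - 1) * (1 / real m)) at_top"
    by (intro tendsto_intros slow_gradient_limit)
  then show "((\<lambda>r. (1 - p) * (v' r / v r powr p) / (1 / Q r)) \<longlongrightarrow> (p - 1) / real m) at_top"
    by (simp add: algebra_simps diff_divide_distrib)
qed

text \<open>
  Here the growth of \<open>v powr (1 - p)\<close> is controlled by that of the bounded \<open>H\<close>, which keeps \<open>v\<close> away
  from \<open>0\<close>.
\<close>

lemma slow_positive_limit:
  assumes H: "\<forall>\<^sub>F r in at_top. (H has_real_derivative 1 / Q r) (at r)" "\<forall>\<^sub>F r in at_top. H r \<le> B"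
  shows "\<exists>C>0. (v \<longlongrightarrow> C) at_top"
proof -
  define K where "K = (p - 1) * (1 / real m + 1)"
  have "\<forall>\<^sub>F r in at_top. - (Q r * v' r / v r powr p) < 1 / real m + 1"
    using order_tendstoD(2)[OF slow_gradient_limit, of "1 / real m + 1"] by simp
  with eventually_ge_R eventually_Q_pos H
  have "\<forall>\<^sub>F r in at_top. r \<ge> R \<and> Q r > 0 \<and> (H has_real_derivative 1 / Q r) (at r) \<and> H r \<le> B
      \<and> - (Q r * v' r / v r powr p) < 1 / real m + 1"
    by eventually_elim simp
  then obtain S where S: "\<And>r. r \<ge> S \<Longrightarrow> r \<ge> R \<and> Q r > 0 \<and> (H has_real_derivative 1 / Q r) (at r)
      \<and> H r \<le> B \<and> - (Q r * v' r / v r powr p) < 1 / real m + 1"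
    unfolding eventually_at_top_linorder by blast
  have "K > 0" using p m by (simp add: K_def add_nonneg_pos)
  have drop: "v r powr (1 - p) - K * H r \<le> v S powr (1 - p) - K * H S" if "r \<ge> S" for r
  proof (rule DERIV_nonpos_imp_nonincreasing[OF that])
    fix x assume "S \<le> x" "x \<le> r"
    note x = S[OF \<open>S \<le> x\<close>]
    have D: "((\<lambda>r. v r powr (1 - p) - K * H r) has_real_derivative
        (1 - p) * (v' x / v x powr p) - K * (1 / Q x)) (at x)"
      by (intro DERIV_diff DERIV_cmult v_power_deriv) (use x in auto)
    have "(p - 1) * (- (Q x * v' x / v x powr p)) \<le> K"
      unfolding K_def using x p by (intro mult_left_mono) auto
    moreover have "(1 - p) * (v' x / v x powr p) - K * (1 / Q x)
        = ((p - 1) * (- (Q x * v' x / v x powr p)) - K) / Q x"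
      using x by (simp add: divide_simps) (simp add: algebra_simps)
    ultimately have "(1 - p) * (v' x / v x powr p) - K * (1 / Q x) \<le> 0"
      using x by (simp add: divide_le_0_iff)
    with D show "\<exists>w. ((\<lambda>r. v r powr (1 - p) - K * H r) has_real_derivative w) (at x) \<and> w \<le> 0" by blast
  qed
  have bd: "v r powr (1 - p) \<le> v S powr (1 - p) - K * H S + K * B" if "r \<ge> S" for r
  proof -
    have "K * H r \<le> K * B" using S[OF that] \<open>K > 0\<close> by (intro mult_left_mono) auto
    then show ?thesis using drop[OF that] by linarith
  qed
  define N where "N = v S powr (1 - p) - K * H S + K * B"
  have "v S > 0" using v_pos[of S] S[of S] by simp
  then have "N > 0"
    using less_le_trans[OF _ bd[of S], of 0] by (simp add: N_def)
  have lower: "N powr (- 1 / (p - 1)) \<le> v r" if "r \<ge> S" for r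
  proof -
    have vr: "v r > 0" using v_pos[of r] S[OF that] by simp
    have "N powr (- 1 / (p - 1)) \<le> (v r powr (1 - p)) powr (- 1 / (p - 1))"
      using bd[OF that] vr p unfolding N_def[symmetric]
      by (intro powr_mono2') auto
    also have "\<dots> = v r powr ((1 - p) * (- 1 / (p - 1)))" by (rule powr_powr)
    also have "(1 - p) * (- 1 / (p - 1)) = 1" using p by (simp add: divide_simps)
    also have "v r powr 1 = v r" using vr by simp
    finally show ?thesis .
  qed
  obtain T where T: "((\<lambda>r. - v r) \<longlongrightarrow> T) at_top"
    by (rule bounded_mono_tendsto_at_top[of S "\<lambda>r. - v r" "- (N powr (- 1 / (p - 1)))"])
      (use v_antimono S lower in auto)
  have lim: "(v \<longlongrightarrow> - T) at_top" using tendsto_minus[OF T] by simp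
  have "N powr (- 1 / (p - 1)) \<le> - T"
  proof (rule tendsto_lowerbound[OF lim])
    show "\<forall>\<^sub>F r in at_top. N powr (- 1 / (p - 1)) \<le> v r"
      using lower eventually_at_top_linorder by blast
  qed simp
  moreover have "N powr (- 1 / (p - 1)) > 0" using \<open>N > 0\<close> by simp
  ultimately have "- T > 0" by (rule less_le_trans[rotated])
  then show ?thesis using lim by blast
qed

end

end

section \<open>Radial functions in a model metric\<close>

text \<open>
  A rotation taking \<open>s\<close> to a coordinate axis diagonalizes the matrix, with eigenvalue \<open>a + b\<close> along \<open>s\<close> and
  \<open>a\<close> on its orthogonal complement.
\<close>

lemma det_rank_one_perturbation:
  fixes s :: "real^'n::finite"
  assumes "norm s = 1"
  shows "det (\<chi> i j. a * (if i = j then 1 else 0) + b * (s $ i * s $ j)) = a ^ (CARD('n) - 1) * (a + b)"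
    (is "det ?M = _")
proof -
  fix k :: 'n
  obtain A :: "real^'n^'n" where A: "orthogonal_matrix A" "A *v axis k 1 = s"
    by (rule orthogonal_matrix_exists_basis[OF assms])
  define d where "d = (\<lambda>i. if i = k then a + b else a)"
  define D :: "real^'n^'n" where "D = (\<chi> i j. if i = j then d i else 0)"
  have s: "s $ i = A $ i $ k" for i
    unfolding A(2)[symmetric] by (simp add: matrix_vector_mult_basis column_def)
  have "A ** transpose A = mat 1" using A(1) by (simp add: orthogonal_matrix_def)
  then have orth: "(\<Sum>l\<in>UNIV. A $ i $ l * A $ j $ l) = (if i = j then 1 else 0)" for i j
    by (auto simp: matrix_matrix_mult_def transpose_def mat_def vec_eq_iff)
  have "?M = A ** D ** transpose A"
  proof (intro vec_eq_iff[THEN iffD2] allI)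
    fix i j
    have "(A ** D ** transpose A) $ i $ j = (\<Sum>l\<in>UNIV. (A $ i $ l * d l) * A $ j $ l)"
      by (simp add: matrix_matrix_mult_def transpose_def D_def if_distrib[of "(*) _"] sum.delta cong: if_cong)
    also have "\<dots> = (\<Sum>l\<in>UNIV. a * (A $ i $ l * A $ j $ l) + (if l = k then b * (A $ i $ l * A $ j $ l) else 0))"
      by (intro sum.cong) (auto simp: d_def algebra_simps)
    also have "\<dots> = a * (\<Sum>l\<in>UNIV. A $ i $ l * A $ j $ l) + b * (A $ i $ k * A $ j $ k)"
      by (simp add: sum.distrib sum_distrib_left)
    finally show "?M $ i $ j = (A ** D ** transpose A) $ i $ j"
      by (simp add: orth s)
  qed
  then have "det ?M = det A * det A * det D" by (simp add: det_mul det_transpose)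
  also have "det A * det A = 1" using det_orthogonal_matrix[OF A(1)] by auto
  also have "det D = (\<Prod>i\<in>UNIV. if i = k then a + b else a)"
    by (subst det_diagonal) (auto simp: D_def d_def)
  also have "\<dots> = (a + b) * (\<Prod>i\<in>UNIV - {k}. a)"
    by (subst prod.remove[of _ k]) auto
  finally show ?thesis by (simp add: mult.commute card_Diff_singleton)
qed

text \<open>
  The factor by which the metric stretches directions orthogonal to the radius. The value at \<open>0\<close> is the
  limit of \<open>\<psi> r / r\<close> when \<open>\<psi> 0 = 0\<close> and \<open>\<psi>' 0 = 1\<close>.
\<close>

definition warp_ratio :: "(real \<Rightarrow> real) \<Rightarrow> real \<Rightarrow> real" where
  "warp_ratio \<psi> r = (if r = 0 then 1 else \<psi> r / r)"

text \<open>
  In the chart, the metric has matrix \<open>a\<close> times the identity plus \<open>1 - a\<close> times the projection to the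
  radius, where \<open>a\<close> is the square of the warp ratio.
\<close>

lemma vol_density_model_metric:
  fixes x :: "real^'n::finite"
  assumes "x \<noteq> 0 \<Longrightarrow> \<psi> (norm x) \<ge> 0"
  shows "vol_density (model_metric \<psi>) x = warp_ratio \<psi> (norm x) ^ (CARD('n) - 1)"
proof (cases "x = 0")
  case True
  have "(\<chi> i j. model_metric \<psi> x (axis i 1) (axis j 1)) = (mat 1 :: real^'n^'n)"
    by (auto simp: True model_metric_def mat_def vec_eq_iff inner_axis_axis)
  then show ?thesis by (simp add: True vol_density_def warp_ratio_def)
next
  case False
  define a where "a = warp_ratio \<psi> (norm x) ^ 2"
  have a: "a = (\<psi> (norm x))\<^sup>2 / (norm x)\<^sup>2" using False by (simp add: a_def warp_ratio_def power_divide)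
  have inner_axis_one: "sgn x \<bullet> axis i (1::real) = sgn x $ i" for i
    by (simp add: inner_axis)
  have inner_axis_axis': "axis i (1::real) \<bullet> axis j 1 = (if i = j then 1 else 0)" for i j :: 'n
    by (simp add: inner_axis_axis)
  have "(\<chi> i j. model_metric \<psi> x (axis i 1) (axis j 1))
      = (\<chi> i j. a * (if i = j then 1 else 0) + (1 - a) * (sgn x $ i * sgn x $ j))"
    using False
    by (auto simp: model_metric_def a vec_eq_iff inner_axis_axis' inner_axis_one algebra_simps
        diff_divide_distrib)
  moreover have "norm (sgn x) = 1" using False by (simp add: norm_sgn)
  ultimately have "vol_density (model_metric \<psi>) x = sqrt (a ^ (CARD('n) - 1) * (a + (1 - a)))"
    unfolding vol_density_def by (simp only: det_rank_one_perturbation)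
  also have "\<dots> = sqrt ((warp_ratio \<psi> (norm x) ^ (CARD('n) - 1))\<^sup>2)"
    by (simp add: a_def power_mult[symmetric] mult.commute)
  finally show ?thesis using assms False by (simp add: warp_ratio_def)
qed

lemma model_metric_radial:
  fixes x :: "real^'n::finite"
  assumes "x \<noteq> 0"
  shows "model_metric \<psi> x (a *\<^sub>R sgn x) w = a * (sgn x \<bullet> w)"
proof -
  have "sgn x \<bullet> sgn x = 1" using assms by (simp add: norm_eq_1[symmetric] norm_sgn)
  then show ?thesis using assms by (simp add: model_metric_def)
qed

lemma model_metric_diff_left:
  "model_metric \<psi> x (X - Y) w = model_metric \<psi> x X w - model_metric \<psi> x Y w"
  by (simp add: model_metric_def inner_diff_left inner_diff_right algebra_simps
      diff_divide_distrib add_divide_distrib)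

lemma model_metric_definite:
  fixes x :: "real^'n::finite"
  assumes "x \<noteq> 0" "\<psi> (norm x) > 0" "model_metric \<psi> x X X = 0"
  shows "X = 0"
proof -
  have "(sgn x \<bullet> X)\<^sup>2 \<le> (sgn x \<bullet> sgn x) * (X \<bullet> X)"
    by (rule Cauchy_Schwarz_ineq)
  also have "sgn x \<bullet> sgn x = 1" using assms(1) by (simp add: norm_eq_1[symmetric] norm_sgn)
  finally have cs: "0 \<le> X \<bullet> X - (sgn x \<bullet> X)\<^sup>2" by simp
  define k where "k = (\<psi> (norm x))\<^sup>2 / (norm x)\<^sup>2"
  have "k > 0" using assms by (simp add: k_def)
  have "(sgn x \<bullet> X)\<^sup>2 + k * (X \<bullet> X - (sgn x \<bullet> X)\<^sup>2) = 0"
    using assms by (simp add: model_metric_def k_def power2_eq_square)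
  moreover have "0 \<le> k * (X \<bullet> X - (sgn x \<bullet> X)\<^sup>2)" using cs \<open>k > 0\<close> by simp
  ultimately have "(sgn x \<bullet> X)\<^sup>2 = 0" "k * (X \<bullet> X - (sgn x \<bullet> X)\<^sup>2) = 0"
    using zero_le_power2[of "sgn x \<bullet> X"] by linarith+
  then show ?thesis using \<open>k > 0\<close> by simp
qed

text \<open>
  A radial covector is represented by the same radial vector as in the flat metric, because the
  metric is flat along the radius; definiteness gives uniqueness.
\<close>

lemma riem_grad_radial:
  fixes x :: "real^'n::finite"
  assumes x: "x \<noteq> 0" "\<psi> (norm x) > 0"
    and f: "frechet_derivative f (at x) = (\<lambda>h. a * (sgn x \<bullet> h))"
  shows "riem_grad (model_metric \<psi>) f x = a *\<^sub>R sgn x"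
  unfolding riem_grad_def
proof (rule the_equality)
  show "\<forall>w. model_metric \<psi> x (a *\<^sub>R sgn x) w = frechet_derivative f (at x) w"
    using x f by (simp add: model_metric_radial)
next
  fix X assume X: "\<forall>w. model_metric \<psi> x X w = frechet_derivative f (at x) w"
  have "model_metric \<psi> x (X - a *\<^sub>R sgn x) (X - a *\<^sub>R sgn x) = 0"
    using X by (subst model_metric_diff_left) (simp add: f model_metric_radial x)
  then show "X = a *\<^sub>R sgn x" using model_metric_definite[of x \<psi> "X - a *\<^sub>R sgn x"] x by simp
qed

text \<open>
  Multiplied by the volume density, a radial field becomes \<open>\<phi> (norm y) *\<^sub>R y\<close> with
  \<open>\<phi> r = \<psi> r ^ (N - 1) * a r / r ^ N\<close>, whose flat divergence is \<open>N \<phi> + r \<phi>'\<close>.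
\<close>

lemma riem_div_radial_field:
  fixes x :: "real^'n::finite"
  assumes x: "x \<noteq> 0"
    and pos: "\<And>r. r > 0 \<Longrightarrow> \<psi> r > 0"
    and Y: "\<And>y. y \<noteq> 0 \<Longrightarrow> Y y = a (norm y) *\<^sub>R sgn y"
    and flux: "((\<lambda>r. \<psi> r ^ (CARD('n) - 1) * a r) has_real_derivative w') (at (norm x))"
  shows "riem_div (model_metric \<psi>) Y x = w' / \<psi> (norm x) ^ (CARD('n) - 1)"
proof -
  define N where "N = CARD('n)"
  define r where "r = norm x"
  define w where "w = (\<lambda>r. \<psi> r ^ (N - 1) * a r)"
  have r: "r > 0" using x by (simp add: r_def)
  have N: "N = Suc (N - 1)" unfolding N_def by (simp add: Suc_leI)
  define phi where "phi = (\<lambda>r. w r / r ^ N)"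
  define phi' where "phi' = (w' * r ^ N - w r * (real N * r ^ (N - 1))) / (r ^ N * r ^ N)"
  have wd: "(w has_real_derivative w') (at r)" using flux by (simp add: w_def N_def r_def)
  have pd: "(phi has_real_derivative phi') (at r)"
    unfolding phi_def phi'_def using r
    by (intro DERIV_cong[OF DERIV_divide[OF wd DERIV_power[OF DERIV_ident, of N]]]) auto
  have nd: "(norm has_derivative (\<lambda>h. h \<bullet> sgn x)) (at x)"
    by (rule has_derivative_norm[OF x])
  have pnd: "((\<lambda>y. phi (norm y)) has_derivative (\<lambda>h. phi' * (h \<bullet> sgn x))) (at x)"
    using has_derivative_compose[OF nd, of phi "(*) phi'"] pd
    by (simp add: has_field_derivative_def r_def)
  have "((\<lambda>y. phi (norm y) *\<^sub>R y) has_derivative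
      (\<lambda>h. phi r *\<^sub>R h + (phi' * (h \<bullet> sgn x)) *\<^sub>R x)) (at x)"
    using has_derivative_scaleR[OF pnd has_derivative_ident] by (simp add: r_def)
  then have "((\<lambda>y. vol_density (model_metric \<psi>) y *\<^sub>R Y y) has_derivative
      (\<lambda>h. phi r *\<^sub>R h + (phi' * (h \<bullet> sgn x)) *\<^sub>R x)) (at x)"
  proof (rule has_derivative_transform_within_open[of _ _ _ _ "- {0}"])
    fix y :: "real^'n" assume "y \<in> - {0}"
    then have y: "y \<noteq> 0" by simp
    have "norm y ^ N = norm y ^ (N - 1) * norm y" by (subst N) simp
    then show "phi (norm y) *\<^sub>R y = vol_density (model_metric \<psi>) y *\<^sub>R Y y"
      using y pos[of "norm y"]
      by (subst vol_density_model_metric)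
        (auto simp: Y phi_def w_def warp_ratio_def sgn_div_norm power_divide N_def field_simps)
  qed (use x in auto)
  then have fd: "frechet_derivative (\<lambda>y. vol_density (model_metric \<psi>) y *\<^sub>R Y y) (at x) =
      (\<lambda>h. phi r *\<^sub>R h + (phi' * (h \<bullet> sgn x)) *\<^sub>R x)"
    by (rule frechet_derivative_at[symmetric])
  have "(\<Sum>i\<in>UNIV. frechet_derivative (\<lambda>y. vol_density (model_metric \<psi>) y *\<^sub>R Y y) (at x) (axis i 1) $ i)
      = (\<Sum>i\<in>UNIV. phi r + phi' * (sgn x $ i * x $ i))"
    unfolding fd by (intro sum.cong) (auto simp: inner_axis' mult_ac)
  also have "\<dots> = real N * phi r + phi' * (sgn x \<bullet> x)"
    by (simp add: sum.distrib sum_distrib_left N_def inner_vec_def)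
  also have "sgn x \<bullet> x = r"
    using x by (simp add: sgn_div_norm r_def power2_norm_eq_inner[symmetric] power2_eq_square)
  also have "real N * phi r + phi' * r = w' / r ^ (N - 1)"
  proof -
    have "r ^ N = r ^ (N - 1) * r" by (subst N) simp
    then show ?thesis using r unfolding phi_def phi'_def by (simp add: field_simps)
  qed
  finally show ?thesis
    using r pos[OF r] x unfolding riem_div_def
    by (subst vol_density_model_metric) (auto simp: warp_ratio_def r_def N_def power_divide)
qed

text \<open>
  The profile \<open>v\<close> is only determined on \<open>[0, \<infinity>)\<close>; its derivatives are therefore taken from the restriction
  of \<open>u\<close> to a ray from the pole, which is twice differentiable on the whole line.
\<close>

locale radial_C2_function =
  fixes u :: "real^'n::finite \<Rightarrow> real" and v :: "real \<Rightarrow> real"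
    and u' :: "real^'n \<Rightarrow> (real^'n) \<Rightarrow>\<^sub>L real"
    and u'' :: "real^'n \<Rightarrow> (real^'n) \<Rightarrow>\<^sub>L ((real^'n) \<Rightarrow>\<^sub>L real)"
  assumes radial: "\<And>x. u x = v (norm x)"
    and u_deriv: "\<And>x. (u has_derivative blinfun_apply (u' x)) (at x)"
    and u'_deriv: "\<And>x. (u' has_derivative blinfun_apply (u'' x)) (at x)"
begin

definition e :: "real^'n" where "e = axis (SOME k. True) 1"

definition dv :: "real \<Rightarrow> real" where "dv r = u' (r *\<^sub>R e) e"

definition ddv :: "real \<Rightarrow> real" where "ddv r = u'' (r *\<^sub>R e) e e"

lemma norm_e: "norm e = 1" by (simp add: e_def)

lemma ray_deriv: "((\<lambda>r. r *\<^sub>R e) has_derivative (\<lambda>h. h *\<^sub>R e)) (at r)"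
  by (intro derivative_eq_intros) auto

lemma v_deriv: "r > 0 \<Longrightarrow> (v has_real_derivative dv r) (at r)"
proof -
  assume r: "r > 0"
  have "((\<lambda>r. u (r *\<^sub>R e)) has_derivative (\<lambda>h. u' (r *\<^sub>R e) (h *\<^sub>R e))) (at r)"
    by (rule has_derivative_compose[OF ray_deriv u_deriv])
  then have "((\<lambda>r. u (r *\<^sub>R e)) has_real_derivative dv r) (at r)"
    by (simp add: has_field_derivative_def dv_def blinfun.scaleR_right mult_commute_abs)
  moreover have "\<forall>\<^sub>F s in nhds r. u (s *\<^sub>R e) = v s"
    by (rule eventually_mono[OF eventually_nhds_in_open[of "{0<..}" r]])
      (use r in \<open>auto simp: radial norm_e\<close>)
  ultimately show ?thesis using DERIV_cong_ev[OF refl _ refl] by metis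
qed

lemma dv_deriv: "(dv has_real_derivative ddv r) (at r)"
proof -
  have "((\<lambda>r. u' (r *\<^sub>R e)) has_derivative (\<lambda>h. u'' (r *\<^sub>R e) (h *\<^sub>R e))) (at r)"
    by (rule has_derivative_compose[OF ray_deriv u'_deriv])
  then have "((\<lambda>r. u' (r *\<^sub>R e) e) has_derivative (\<lambda>h. u'' (r *\<^sub>R e) (h *\<^sub>R e) e)) (at r)"
    by (rule bounded_linear.has_derivative[OF blinfun.bounded_linear_left])
  then show ?thesis
    by (simp add: has_field_derivative_def dv_def[abs_def] ddv_def blinfun.scaleR_right
        blinfun.scaleR_left mult_commute_abs)
qed

lemma v_cont: "continuous_on {0..} v"
proof -
  have u: "continuous_on UNIV u"
    using has_derivative_continuous[OF u_deriv] by (intro continuous_at_imp_continuous_on) auto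
  have "continuous_on {0..} (\<lambda>r. u (r *\<^sub>R e))"
    by (rule continuous_on_compose2[OF u]) (auto intro: continuous_intros)
  then show ?thesis
    by (rule continuous_on_cong[THEN iffD1, rotated -1]) (auto simp: radial norm_e)
qed

lemma dv_cont: "continuous_on UNIV dv"
  using DERIV_isCont[OF dv_deriv] by (intro continuous_at_imp_continuous_on) auto

lemma u'_radial: "x \<noteq> 0 \<Longrightarrow> blinfun_apply (u' x) = (\<lambda>h. dv (norm x) * (sgn x \<bullet> h))"
proof -
  assume x: "x \<noteq> 0"
  have "((\<lambda>y. v (norm y)) has_derivative (\<lambda>h. dv (norm x) * (h \<bullet> sgn x))) (at x)"
    using has_derivative_compose[OF has_derivative_norm[OF x], of v "(*) (dv (norm x))"]
      v_deriv[of "norm x"] x by (simp add: has_field_derivative_def)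
  then have "(u has_derivative (\<lambda>h. dv (norm x) * (h \<bullet> sgn x))) (at x)"
    by (simp add: radial[abs_def])
  from has_derivative_unique[OF u_deriv this] show ?thesis
    by (simp add: inner_commute)
qed

text \<open>
  Along any line through the pole, \<open>u\<close> is an even function.
\<close>

lemma u'_zero: "u' 0 h = 0"
proof -
  have r: "((\<lambda>t. t *\<^sub>R h) has_derivative (\<lambda>k. k *\<^sub>R h)) (at (0::real))"
    by (intro derivative_eq_intros) auto
  have "((\<lambda>t. u (t *\<^sub>R h)) has_derivative (\<lambda>k. u' (0 *\<^sub>R h) (k *\<^sub>R h))) (at (0::real))"
    by (rule has_derivative_compose[OF r u_deriv])
  then have 1: "((\<lambda>t. u (t *\<^sub>R h)) has_real_derivative u' 0 h) (at 0)"
    by (simp add: has_field_derivative_def blinfun.scaleR_right mult_commute_abs)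
  then have "((\<lambda>t. u (- t *\<^sub>R h)) has_real_derivative - u' 0 h) (at 0)"
    using DERIV_chain2[of "\<lambda>t. u (t *\<^sub>R h)" "u' 0 h" uminus 0 "-1" UNIV] 1
    by (simp add: DERIV_minus[OF DERIV_ident, simplified])
  moreover have "(\<lambda>t. u (- t *\<^sub>R h)) = (\<lambda>t. u (t *\<^sub>R h))" by (simp add: radial)
  ultimately have "((\<lambda>t. u (t *\<^sub>R h)) has_real_derivative - u' 0 h) (at 0)" by simp
  from DERIV_unique[OF 1 this] show ?thesis by simp
qed

lemma riem_grad_u:
  assumes "\<And>r. r > 0 \<Longrightarrow> \<psi> r > 0" "x \<noteq> 0"
  shows "riem_grad (model_metric \<psi>) u x = dv (norm x) *\<^sub>R sgn x"
  using assms by (intro riem_grad_radial)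
    (auto simp: frechet_derivative_at[OF u_deriv, symmetric] u'_radial)

lemma laplace_u:
  assumes pos: "\<And>r. r > 0 \<Longrightarrow> \<psi> r > 0"
    and der: "(\<psi> has_real_derivative \<psi>') (at r)" and r: "r > 0"
  shows "laplace_beltrami (model_metric \<psi>) u (r *\<^sub>R e)
    = ddv r + real (CARD('n) - 1) * (\<psi>' / \<psi> r) * dv r"
proof -
  define m where "m = CARD('n) - 1"
  have pr: "\<psi> r > 0" by (rule pos[OF r])
  have nr: "norm (r *\<^sub>R e) = r" using r by (simp add: norm_e)
  then have ne: "r *\<^sub>R e \<noteq> 0" using r by (metis less_irrefl norm_zero)
  have "((\<lambda>r. \<psi> r ^ m * dv r) has_real_derivative
      real m * \<psi> r ^ (m - 1) * \<psi>' * dv r + \<psi> r ^ m * ddv r) (at r)"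
    by (intro DERIV_cong[OF DERIV_mult[OF DERIV_power[OF der] dv_deriv]]) (simp add: algebra_simps)
  then have "laplace_beltrami (model_metric \<psi>) u (r *\<^sub>R e)
      = (real m * \<psi> r ^ (m - 1) * \<psi>' * dv r + \<psi> r ^ m * ddv r) / \<psi> r ^ m"
    unfolding laplace_beltrami_def m_def
    by (intro riem_div_radial_field[where x = "r *\<^sub>R e" and \<psi> = \<psi> and a = dv, unfolded nr]
        ne pos riem_grad_u[OF pos])
  also have "real m * \<psi> r ^ (m - 1) = real m * (\<psi> r ^ m / \<psi> r)"
    using pr by (cases m) auto
  finally have "laplace_beltrami (model_metric \<psi>) u (r *\<^sub>R e)
      = (real m * (\<psi> r ^ m / \<psi> r) * \<psi>' * dv r + \<psi> r ^ m * ddv r) / \<psi> r ^ m" .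
  then show ?thesis using pr by (simp add: m_def add_divide_distrib)
qed

end

section \<open>Polar coordinates and integration by parts\<close>

text \<open>
  Integration in polar coordinates: both sides agree on the half-lines \<open>{..a}\<close>, where this is the volume of
  a ball.
\<close>

lemma distr_norm_lborel:
  "distr (lborel :: 'a::euclidean_space measure) borel norm =
    density lborel (\<lambda>r. ennreal (indicator {0..} r *
      (unit_ball_vol (real DIM('a)) * (real DIM('a) * r ^ (DIM('a) - 1)))))"
    (is "?M = density lborel ?d")
proof -
  define D where "D = DIM('a)"
  define w where "w = unit_ball_vol (real D)"
  have D: "D > 0" by (simp add: D_def)
  have w: "w > 0" by (simp add: w_def)
  have sets_borel: "sets (borel :: real measure) = sigma_sets UNIV (range atMost)"
    using borel_eq_atMost[where 'a = real] by (metis sets_measure_of top_greatest Pow_UNIV)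
  have dm: "(\<lambda>r::real. indicator {0..} r * (w * (real D * r ^ (D - 1)))) \<in> borel_measurable borel"
    by measurable
  show ?thesis
  proof (rule measure_eqI_generator_eq[of "range atMost" UNIV ?M _ "\<lambda>i. {..real i}"])
    show "Int_stable (range (atMost :: real \<Rightarrow> real set))"
      by (auto simp: Int_stable_def)
    show "range (atMost :: real \<Rightarrow> real set) \<subseteq> Pow UNIV" by simp
    show "(\<Union>i. {..real i}) = UNIV" by (auto simp: real_arch_simple)
    show "emeasure ?M {..real i} \<noteq> \<infinity>" for i
    proof -
      have "emeasure ?M {..real i} = emeasure lborel (cball (0::'a) (real i))"
        by (subst emeasure_distr) (auto intro!: arg_cong[where f = "emeasure lborel"])
      then show ?thesis by (simp add: emeasure_cball)
    qed
    show "emeasure ?M X = emeasure (density lborel ?d) X" if X_in: "X \<in> range atMost" for X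
    proof -
      obtain a where X: "X = {..a}" using X_in by auto
      have "emeasure ?M X = emeasure lborel (cball (0::'a) a)"
        unfolding X by (subst emeasure_distr) (auto intro!: arg_cong[where f = "emeasure lborel"])
      also have "\<dots> = (if a < 0 then 0 else ennreal (w * a ^ D))"
        by (auto simp: emeasure_cball w_def D_def)
      also have "\<dots> = emeasure (density lborel ?d) X"
      proof -
        have "emeasure (density lborel ?d) X = (\<integral>\<^sup>+r. ?d r * indicator {..a} r \<partial>lborel)"
          unfolding X using dm by (subst emeasure_density) (auto simp: w_def D_def)
        also have "\<dots> = (\<integral>\<^sup>+r. ennreal (w * (real D * r ^ (D - 1))) * indicator {0..a} r \<partial>lborel)"
          by (intro nn_integral_cong) (auto simp: indicator_def w_def D_def)
        also have "\<dots> = (if a < 0 then 0 else ennreal (w * a ^ D))"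
        proof (cases "a < 0")
          case False
          have "(\<integral>\<^sup>+r. ennreal (w * (real D * r ^ (D - 1))) * indicator {0..a} r \<partial>lborel)
              = ennreal (w * a ^ D - w * 0 ^ D)"
            using False w
            by (intro nn_integral_FTC_Icc) (auto intro!: derivative_eq_intros)
          then show ?thesis using False D by (simp add: power_0_left)
        qed simp
        finally show ?thesis by simp
      qed
      finally show ?thesis .
    qed
  qed (auto simp: sets_borel)
qed

lemma integrable_radial_iff:
  fixes h :: "real \<Rightarrow> real"
  assumes h: "continuous_on {0..} h"
  shows "integrable lborel (\<lambda>x::'a::euclidean_space. h (norm x)) \<longleftrightarrow>
    set_integrable lborel {0..} (\<lambda>r. r ^ (DIM('a) - 1) * h r)"
proof -
  define D where "D = DIM('a)"
  define w where "w = unit_ball_vol (real D) * real D"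
  have w: "w > 0" by (simp add: w_def D_def)
  define k where "k = (\<lambda>r. indicator {0..} r *\<^sub>R h r)"
  have km: "k \<in> borel_measurable borel"
    unfolding k_def by (rule borel_measurable_continuous_on_indicator[OF _ h]) simp
  have "integrable lborel (\<lambda>x::'a. h (norm x)) \<longleftrightarrow> integrable lborel (\<lambda>x::'a. k (norm x))"
    by (simp add: k_def)
  also have "\<dots> \<longleftrightarrow> integrable (distr (lborel :: 'a measure) borel norm) k"
    by (rule integrable_distr_eq[symmetric]) (use km in auto)
  also have "\<dots> \<longleftrightarrow> integrable lborel (\<lambda>r. (indicator {0..} r * (unit_ball_vol (real DIM('a)) *
      (real DIM('a) * r ^ (DIM('a) - 1)))) *\<^sub>R k r)"
    unfolding distr_norm_lborel
    by (rule integrable_density) (use km in \<open>auto simp: indicator_def\<close>)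
  also have "(\<lambda>r. (indicator {0..} r * (unit_ball_vol (real DIM('a)) *
      (real DIM('a) * r ^ (DIM('a) - 1)))) *\<^sub>R k r)
      = (\<lambda>r. w * (indicator {0..} r *\<^sub>R (r ^ (D - 1) * h r)))"
    by (auto simp: k_def w_def D_def indicator_def)
  also have "integrable lborel \<dots> \<longleftrightarrow> set_integrable lborel {0..} (\<lambda>r. r ^ (D - 1) * h r)"
    unfolding set_integrable_def using w by (subst integrable_mult_left_iff) auto
  finally show ?thesis by (simp add: D_def)
qed

text \<open>
  A class of functions stable under products for which integration by parts holds. It is wider than
  \<open>C\<^sup>1\<close> in that no continuity of the derivative is required, so that a radial function can be
  treated at the pole without a separate argument.
\<close>

definition locally_bounded_derivative ::
  "('a::real_normed_vector \<Rightarrow> real) \<Rightarrow> ('a \<Rightarrow> 'a \<Rightarrow> real) \<Rightarrow> bool" where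
  "locally_bounded_derivative f f' \<longleftrightarrow>
    (\<forall>x. (f has_derivative f' x) (at x)) \<and>
    (\<forall>R. \<exists>B. \<forall>x h. norm x \<le> R \<longrightarrow> \<bar>f' x h\<bar> \<le> B * norm h)"

lemma continuous_bounded_on_cball:
  fixes f :: "'a::euclidean_space \<Rightarrow> 'b::real_normed_vector"
  assumes "continuous_on UNIV f"
  shows "\<exists>B\<ge>0. \<forall>x. norm x \<le> R \<longrightarrow> norm (f x) \<le> B"
proof -
  have "compact (f ` cball 0 R)"
    using assms by (intro compact_continuous_image) (auto intro: continuous_on_subset)
  then obtain B where B: "\<forall>y \<in> f ` cball 0 R. norm y \<le> B"
    using compact_imp_bounded bounded_iff by metis
  then show ?thesis by (intro exI[of _ "max B 0"]) (force simp: image_iff)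
qed

lemma locally_bounded_derivative_C1:
  fixes f :: "'a::euclidean_space \<Rightarrow> real" and f' :: "'a \<Rightarrow> 'a \<Rightarrow>\<^sub>L real"
  assumes "\<And>x. (f has_derivative blinfun_apply (f' x)) (at x)" "continuous_on UNIV f'"
  shows "locally_bounded_derivative f (\<lambda>x. blinfun_apply (f' x))"
  unfolding locally_bounded_derivative_def
proof (intro conjI allI)
  fix R
  obtain B where B: "\<forall>x. norm x \<le> R \<longrightarrow> norm (f' x) \<le> B"
    using continuous_bounded_on_cball[OF assms(2)] by blast
  have "\<bar>f' x h\<bar> \<le> B * norm h" if "norm x \<le> R" for x h
    using norm_blinfun[of "f' x" h] mult_right_mono[OF B[rule_format, OF that] norm_ge_zero[of h]] by simp
  then show "\<exists>B. \<forall>x h. norm x \<le> R \<longrightarrow> \<bar>f' x h\<bar> \<le> B * norm h" by blast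
qed (use assms in auto)

lemma locally_bounded_derivative_continuous:
  "locally_bounded_derivative f f' \<Longrightarrow> continuous_on UNIV f"
  unfolding locally_bounded_derivative_def
  by (intro continuous_at_imp_continuous_on) (meson has_derivative_continuous)

lemma locally_bounded_derivative_mult:
  fixes f g :: "'a::euclidean_space \<Rightarrow> real"
  assumes f: "locally_bounded_derivative f f'" and g: "locally_bounded_derivative g g'"
  shows "locally_bounded_derivative (\<lambda>x. f x * g x) (\<lambda>x h. f x * g' x h + f' x h * g x)"
  unfolding locally_bounded_derivative_def
proof (intro conjI allI)
  show "((\<lambda>x. f x * g x) has_derivative (\<lambda>h. f x * g' x h + f' x h * g x)) (at x)" for x
    using f g by (intro has_derivative_mult) (auto simp: locally_bounded_derivative_def)
  fix R
  obtain A where A: "A \<ge> 0" "\<And>x. norm x \<le> R \<Longrightarrow> \<bar>f x\<bar> \<le> A"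
    using continuous_bounded_on_cball[OF locally_bounded_derivative_continuous[OF f]] by (metis real_norm_def)
  obtain B where B: "B \<ge> 0" "\<And>x. norm x \<le> R \<Longrightarrow> \<bar>g x\<bar> \<le> B"
    using continuous_bounded_on_cball[OF locally_bounded_derivative_continuous[OF g]] by (metis real_norm_def)
  obtain A' where A': "\<And>x h. norm x \<le> R \<Longrightarrow> \<bar>f' x h\<bar> \<le> A' * norm h"
    using f unfolding locally_bounded_derivative_def by blast
  obtain B' where B': "\<And>x h. norm x \<le> R \<Longrightarrow> \<bar>g' x h\<bar> \<le> B' * norm h"
    using g unfolding locally_bounded_derivative_def by blast
  have "\<bar>f x * g' x h + f' x h * g x\<bar> \<le> (A * B' + A' * B) * norm h" if "norm x \<le> R" for x h
  proof -
    have "\<bar>f x\<bar> * \<bar>g' x h\<bar> \<le> A * (B' * norm h)"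
      using A B' that by (intro mult_mono) auto
    moreover have "\<bar>f' x h\<bar> * \<bar>g x\<bar> \<le> (A' * norm h) * B"
      using B A'[OF that, of h] that by (intro mult_mono) (auto intro: order_trans[OF abs_ge_zero])
    ultimately show ?thesis
      using abs_triangle_ineq[of "f x * g' x h" "f' x h * g x"] by (simp add: abs_mult algebra_simps)
  qed
  then show "\<exists>C. \<forall>x h. norm x \<le> R \<longrightarrow> \<bar>f x * g' x h + f' x h * g x\<bar> \<le> C * norm h" by blast
qed

text \<open>
  Difference quotients have integral \<open>0\<close> by translation invariance, and they converge boundedly to the
  derivative by the mean value theorem.
\<close>

lemma integral_derivative_compact_support:
  fixes f :: "'a::euclidean_space \<Rightarrow> real"
  assumes f: "locally_bounded_derivative f f'" and supp: "\<And>x. norm x > R \<Longrightarrow> f x = 0"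
  shows "integrable lborel (\<lambda>x. f' x b)" "(\<integral>x. f' x b \<partial>lborel) = 0"
proof -
  have cont: "continuous_on UNIV f" by (rule locally_bounded_derivative_continuous[OF f])
  have der: "(f has_derivative f' x) (at x)" for x
    using f by (auto simp: locally_bounded_derivative_def)
  \<comment> \<open>Difference quotients with step at most \<open>1\<close> vanish beyond \<open>R + norm b\<close>; on the ball of that radius they only see points of norm at most \<open>R + 2 * norm b\<close>.\<close>
  obtain B where B: "\<And>x h. norm x \<le> R + 2 * norm b \<Longrightarrow> \<bar>f' x h\<bar> \<le> B * norm h"
    using f unfolding locally_bounded_derivative_def by blast
  define t where "t = (\<lambda>k. inverse (real (Suc k)))"
  have t: "0 < t k" "t k \<le> 1" for k by (auto simp: t_def inverse_le_1_iff)
  define q where "q = (\<lambda>k x. (f (x + t k *\<^sub>R b) - f x) / t k)"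
  have fm: "f \<in> borel_measurable borel"
    using cont by (rule borel_measurable_continuous_onI)
  have qm: "q k \<in> borel_measurable lborel" for k
    unfolding q_def using fm by measurable
  have fint: "integrable lborel f"
  proof -
    have "f = (\<lambda>x. indicator (cball 0 R) x *\<^sub>R f x)"
      using supp by (auto simp: indicator_def fun_eq_iff)
    moreover have "integrable lborel (\<lambda>x. indicator (cball 0 R) x *\<^sub>R f x)"
      using cont by (intro borel_integrable_compact) (auto intro: continuous_on_subset)
    ultimately show ?thesis by simp
  qed
  have shift: "integrable lborel (\<lambda>x. f (x + c)) \<and> (\<integral>x. f (x + c) \<partial>lborel) = (\<integral>x. f x \<partial>lborel)" for c
  proof -
    have "integrable (distr lborel borel ((+) c)) f" using fint by (simp add: lborel_distr_plus)
    then have "integrable lborel (\<lambda>x. f (c + x))" by (subst (asm) integrable_distr_eq) (use fm in auto)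
    moreover have "(\<integral>x. f x \<partial>lborel) = (\<integral>x. f x \<partial>(distr lborel borel ((+) c)))"
      by (simp add: lborel_distr_plus)
    then have "(\<integral>x. f x \<partial>lborel) = (\<integral>x. f (c + x) \<partial>lborel)"
      by (subst (asm) integral_distr) (use fm in auto)
    ultimately show ?thesis by (simp add: add.commute)
  qed
  have q0: "(\<integral>x. q k x \<partial>lborel) = 0" for k
    unfolding q_def using shift[of "t k *\<^sub>R b"] fint by simp
  define w where "w = (\<lambda>x::'a. indicator (cball 0 (R + norm b)) x *\<^sub>R (B * norm b))"
  have wint: "integrable lborel w"
    unfolding w_def by (intro borel_integrable_compact) auto
  have bound: "\<bar>q k x\<bar> \<le> w x" for k x
  proof (cases "norm x \<le> R + norm b")
    case True
    have nb: "norm (x + t k *\<^sub>R b) \<le> R + 2 * norm b"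
    proof -
      have "norm (t k *\<^sub>R b) \<le> norm b" using t[of k] by (simp add: mult_left_le_one_le)
      then show ?thesis using norm_triangle_ineq[of x "t k *\<^sub>R b"] True by linarith
    qed
    have "norm (f (x + t k *\<^sub>R b) - f x) \<le> B * norm ((x + t k *\<^sub>R b) - x)"
    proof (rule differentiable_bound[of "cball 0 (R + 2 * norm b)" f f'])
      show "(f has_derivative f' z) (at z within cball 0 (R + 2 * norm b))" for z
        by (rule has_derivative_at_withinI[OF der])
      show "onorm (f' z) \<le> B" if "z \<in> cball 0 (R + 2 * norm b)" for z
        by (rule onorm_le) (use B that in auto)
      show "x \<in> cball 0 (R + 2 * norm b)" using True norm_ge_zero[of b] unfolding mem_cball_0 by linarith
    qed (use nb in auto)
    then show ?thesis using t[of k] True by (simp add: q_def w_def field_simps)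
  next
    case False
    have "norm (t k *\<^sub>R b) \<le> norm b" using t[of k] by (simp add: mult_left_le_one_le)
    then have "norm (x + t k *\<^sub>R b) > R" using norm_diff_ineq[of x "t k *\<^sub>R b"] False by linarith
    moreover have "norm x > R" using False norm_ge_zero[of b] by linarith
    ultimately show ?thesis using supp False by (simp add: q_def w_def)
  qed
  have lim: "(\<lambda>k. q k x) \<longlonglongrightarrow> f' x b" for x
  proof -
    have ray: "((\<lambda>s. x + s *\<^sub>R b) has_derivative (\<lambda>s. s *\<^sub>R b)) (at (0::real))"
      by (auto intro!: derivative_eq_intros)
    have "((\<lambda>s. f (x + s *\<^sub>R b)) has_derivative (\<lambda>s. f' (x + 0 *\<^sub>R b) (s *\<^sub>R b))) (at (0::real))"
      by (rule has_derivative_compose[OF ray der])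
    moreover have "f' x (s *\<^sub>R b) = f' x b * s" for s
      using linear_cmul[OF has_derivative_linear[OF der[of x]]] by simp
    ultimately have "((\<lambda>s. f (x + s *\<^sub>R b)) has_real_derivative f' x b) (at 0)"
      by (simp add: has_field_derivative_def mult_commute_abs)
    then have d: "((\<lambda>s. (f (x + s *\<^sub>R b) - f x) / s) \<longlongrightarrow> f' x b) (at 0)"
      by (simp add: DERIV_def)
    have "filterlim t (at 0) sequentially"
      unfolding filterlim_at using t(1) LIMSEQ_inverse_real_of_nat
      by (auto simp: t_def)
    from filterlim_compose[OF d this] show ?thesis by (simp add: q_def)
  qed
  have f'm: "(\<lambda>x. f' x b) \<in> borel_measurable lborel"
    by (rule borel_measurable_LIMSEQ_metric[OF qm lim])
  show "integrable lborel (\<lambda>x. f' x b)"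
    by (rule integrable_dominated_convergence[where s = q and w = w, OF f'm qm wint]) (use lim bound in auto)
  have "(\<lambda>k. \<integral>x. q k x \<partial>lborel) \<longlonglongrightarrow> (\<integral>x. f' x b \<partial>lborel)"
    by (rule integral_dominated_convergence[where s = q and w = w, OF f'm qm wint]) (use lim bound in auto)
  then show "(\<integral>x. f' x b \<partial>lborel) = 0" unfolding q0 by (simp add: LIMSEQ_const_iff)
qed

text \<open>
  Away from the pole this is the chain rule; at the pole, where the norm is not differentiable, the
  vanishing of \<open>s' 0\<close> makes the increment \<open>o (norm h)\<close>.
\<close>

lemma locally_bounded_derivative_radial:
  fixes s s' :: "real \<Rightarrow> real"
  assumes der: "\<And>r. r \<ge> 0 \<Longrightarrow> (s has_real_derivative s' r) (at r within {0..})"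
    and cont: "continuous_on {0..} s'" and zero: "s' 0 = 0"
  shows "locally_bounded_derivative (\<lambda>x::'a::euclidean_space. s (norm x))
    (\<lambda>x h. s' (norm x) * (sgn x \<bullet> h))"
  unfolding locally_bounded_derivative_def
proof (intro conjI allI)
  fix x :: 'a
  show "((\<lambda>x. s (norm x)) has_derivative (\<lambda>h. s' (norm x) * (sgn x \<bullet> h))) (at x)"
  proof (cases "x = 0")
    case False
    have "(s has_real_derivative s' (norm x)) (at (norm x))"
      using der[of "norm x"] at_within_interior[of "norm x" "{0..}"] False by simp
    then have "((\<lambda>x. s (norm x)) has_derivative (\<lambda>h. s' (norm x) * (h \<bullet> sgn x))) (at x)"
      using has_derivative_compose[OF has_derivative_norm[OF False], of s "(*) (s' (norm x))"]
      by (simp add: has_field_derivative_def)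
    then show ?thesis by (simp add: inner_commute)
  next
    case True
    have l: "((\<lambda>r. (s r - s 0) / r) \<longlongrightarrow> 0) (at 0 within {0..})"
      using der[of 0] zero by (simp add: has_field_derivative_iff)
    have "filterlim norm (at 0 within {0..}) (at (0::'a))"
      unfolding filterlim_at using tendsto_norm[OF tendsto_ident_at, of "0::'a" UNIV]
      by (auto simp: eventually_at_filter)
    from filterlim_compose[OF l this]
    have "((\<lambda>h::'a. (s (norm h) - s 0) / norm h) \<longlongrightarrow> 0) (at 0)" .
    then have "((\<lambda>h::'a. norm (s (norm h) - s 0) / norm h) \<longlongrightarrow> 0) (at 0)"
      using tendsto_norm_zero by fastforce
    then show ?thesis by (simp add: True has_derivative_at zero bounded_linear_zero)
  qed
next
  fix R
  have "compact (s' ` {0..R})"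
    using cont by (intro compact_continuous_image) (auto intro: continuous_on_subset)
  then obtain B where B: "\<And>r. 0 \<le> r \<Longrightarrow> r \<le> R \<Longrightarrow> \<bar>s' r\<bar> \<le> B"
    using compact_imp_bounded bounded_iff by (metis atLeastAtMost_iff imageI real_norm_def)
  have "\<bar>s' (norm x) * (sgn x \<bullet> h)\<bar> \<le> B * norm h" if "norm x \<le> R" for x h :: 'a
  proof -
    have "\<bar>sgn x \<bullet> h\<bar> \<le> norm (sgn x) * norm h" by (rule Cauchy_Schwarz_ineq2)
    also have "\<dots> \<le> 1 * norm h" by (intro mult_right_mono) (auto simp: norm_sgn)
    finally show ?thesis
      unfolding abs_mult using B[of "norm x"] that
      by (intro mult_mono) (auto intro: order_trans[OF abs_ge_zero])
  qed
  then show "\<exists>B. \<forall>(x::'a) h. norm x \<le> R \<longrightarrow> \<bar>s' (norm x) * (sgn x \<bullet> h)\<bar> \<le> B * norm h" by blast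
qed

section \<open>The Riemannian measure of a warped metric\<close>

locale warping_function =
  fixes \<psi> \<psi>' \<psi>'' :: "real \<Rightarrow> real"
  assumes psi_deriv_within: "\<And>r. r \<ge> 0 \<Longrightarrow> (\<psi> has_real_derivative \<psi>' r) (at r within {0..})"
    and psi'_deriv_within: "\<And>r. r \<ge> 0 \<Longrightarrow> (\<psi>' has_real_derivative \<psi>'' r) (at r within {0..})"
    and psi''_cont: "continuous_on {0..} \<psi>''"
    and psi_pos: "\<And>r. r > 0 \<Longrightarrow> \<psi> r > 0"
    and psi_0: "\<psi> 0 = 0" "\<psi>' 0 = 1" "\<psi>'' 0 = 0"
begin

lemma at_interior: "r > 0 \<Longrightarrow> at r within {0..} = at (r::real)"
  by (rule at_within_interior) simp

lemma psi_deriv: "r > 0 \<Longrightarrow> (\<psi> has_real_derivative \<psi>' r) (at r)"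
  using psi_deriv_within[of r] by (simp add: at_interior)

lemma psi'_deriv: "r > 0 \<Longrightarrow> (\<psi>' has_real_derivative \<psi>'' r) (at r)"
  using psi'_deriv_within[of r] by (simp add: at_interior)

lemma psi_cont: "continuous_on {0..} \<psi>"
  by (rule DERIV_continuous_on[OF psi_deriv_within]) simp

lemma psi'_cont: "continuous_on {0..} \<psi>'"
  by (rule DERIV_continuous_on[OF psi'_deriv_within]) simp

definition ratio' :: "real \<Rightarrow> real" where
  "ratio' r = (if r = 0 then 0 else (r * \<psi>' r - \<psi> r) / r\<^sup>2)"

text \<open>
  The numerator \<open>r * \<psi>' r - \<psi> r\<close> vanishes at \<open>0\<close> and has derivative \<open>r * \<psi>'' r\<close>, so by the mean value
  theorem the quotient is at most \<open>\<bar>\<psi>''\<bar>\<close> at some point between \<open>0\<close> and \<open>r\<close>, and \<open>\<psi>'' 0 = 0\<close>.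
\<close>

lemma ratio'_small:
  assumes "e > 0"
  obtains d where "d > 0" "\<And>r. 0 \<le> r \<Longrightarrow> r < d \<Longrightarrow> \<bar>ratio' r\<bar> < e"
proof -
  have "\<exists>d>0. \<forall>r\<in>{0..}. dist r 0 < d \<longrightarrow> dist (\<psi>'' r) (\<psi>'' 0) < e"
    using psi''_cont \<open>e > 0\<close> unfolding continuous_on_iff by (elim ballE[of _ _ 0]) auto
  then obtain d where d: "d > 0" "\<And>r. 0 \<le> r \<Longrightarrow> dist r 0 < d \<Longrightarrow> dist (\<psi>'' r) (\<psi>'' 0) < e"
    by auto
  have "\<bar>ratio' r\<bar> < e" if r: "0 \<le> r" "r < d" for r
  proof (cases "r = 0")
    case False
    then have "0 < r" using r by simp
    define k where "k = (\<lambda>r. r * \<psi>' r - \<psi> r)"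
    have kc: "continuous_on {0..r} k"
      unfolding k_def
      by (intro continuous_intros continuous_on_subset[OF psi_cont] continuous_on_subset[OF psi'_cont]) auto
    have kd: "(k has_derivative (*) (x * \<psi>'' x)) (at x)" if "0 < x" for x
    proof -
      have "(k has_real_derivative x * \<psi>'' x) (at x)"
        unfolding k_def using psi_deriv[OF that] psi'_deriv[OF that]
        by (auto intro!: derivative_eq_intros)
      then show ?thesis by (simp add: has_field_derivative_def)
    qed
    obtain xi where xi: "0 < xi" "xi < r" "k r - k 0 = xi * \<psi>'' xi * (r - 0)"
      using mvt[OF \<open>0 < r\<close> kc, of "\<lambda>x. (*) (x * \<psi>'' x)"] kd by blast
    then have "ratio' r = xi * \<psi>'' xi * r / r\<^sup>2"
      using False by (simp add: ratio'_def k_def psi_0)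
    then have "\<bar>ratio' r\<bar> = (xi / r) * \<bar>\<psi>'' xi\<bar>"
      using \<open>0 < r\<close> xi by (simp add: power2_eq_square abs_mult)
    also have "\<dots> \<le> 1 * \<bar>\<psi>'' xi\<bar>" using xi \<open>0 < r\<close> by (intro mult_right_mono) auto
    also have "\<dots> < e" using d(2)[of xi] xi r by (simp add: psi_0 dist_real_def)
    finally show ?thesis .
  qed (use \<open>e > 0\<close> in \<open>simp add: ratio'_def\<close>)
  then show ?thesis using that d(1) by blast
qed

lemma ratio'_cont: "continuous_on {0..} ratio'"
proof -
  have "continuous (at r within {0..}) ratio'" if "r \<ge> 0" for r
  proof (cases "r = 0")
    case True
    have "\<exists>d>0. \<forall>x\<in>{0..}. dist x 0 < d \<longrightarrow> dist (ratio' x) (ratio' 0) < e" if e: "e > 0" for e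
    proof -
      obtain d where "d > 0" "\<And>r. 0 \<le> r \<Longrightarrow> r < d \<Longrightarrow> \<bar>ratio' r\<bar> < e"
        by (rule ratio'_small[OF e]) blast
      then show ?thesis by (intro exI[of _ d]) (auto simp: dist_real_def ratio'_def)
    qed
    then show ?thesis by (simp add: True continuous_within_eps_delta)
  next
    case False
    then have r: "r > 0" using that by simp
    have "isCont (\<lambda>r. (r * \<psi>' r - \<psi> r) / r\<^sup>2) r"
      using r DERIV_isCont[OF psi_deriv[OF r]] DERIV_isCont[OF psi'_deriv[OF r]]
      by (intro continuous_intros) auto
    moreover have "\<forall>\<^sub>F x in nhds r. (x * \<psi>' x - \<psi> x) / x\<^sup>2 = ratio' x"
      by (rule eventually_mono[OF eventually_nhds_in_open[of "{0<..}" r]])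
        (use r in \<open>auto simp: ratio'_def\<close>)
    ultimately have "isCont ratio' r" by (metis isCont_cong)
    then show ?thesis by (rule continuous_at_imp_continuous_at_within)
  qed
  then show ?thesis by (simp add: continuous_on_eq_continuous_within)
qed

lemma warp_ratio_deriv_pos:
  assumes r: "r > 0"
  shows "(warp_ratio \<psi> has_real_derivative ratio' r) (at r)"
proof -
  have "((\<lambda>r. \<psi> r / r) has_real_derivative ratio' r) (at r)"
    using r by (intro DERIV_cong[OF DERIV_divide[OF psi_deriv[OF r] DERIV_ident]])
      (auto simp: ratio'_def power2_eq_square algebra_simps)
  moreover have "\<forall>\<^sub>F s in nhds r. \<psi> s / s = warp_ratio \<psi> s"
    by (rule eventually_mono[OF eventually_nhds_in_open[of "{0<..}" r]])
      (use r in \<open>auto simp: warp_ratio_def\<close>)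
  ultimately show ?thesis by (metis DERIV_cong_ev)
qed

lemma warp_ratio_cont_0: "continuous (at 0 within {0..}) (warp_ratio \<psi>)"
proof -
  have "((\<lambda>r. \<psi> r / r) \<longlongrightarrow> 1) (at 0 within {0..})"
    using psi_deriv_within[of 0] by (simp add: has_field_derivative_iff psi_0)
  then have "(warp_ratio \<psi> \<longlongrightarrow> 1) (at 0 within {0..})"
    by (rule Lim_transform_eventually) (auto simp: eventually_at_filter warp_ratio_def)
  then show ?thesis by (simp add: continuous_within warp_ratio_def)
qed

lemma warp_ratio_cont: "continuous_on {0..} (warp_ratio \<psi>)"
proof -
  have "continuous (at r within {0..}) (warp_ratio \<psi>)" if "r \<ge> 0" for r
    using warp_ratio_cont_0 DERIV_isCont[OF warp_ratio_deriv_pos, of r] that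
      continuous_at_imp_continuous_at_within[of r] by (cases "r = 0") auto
  then show ?thesis by (simp add: continuous_on_eq_continuous_within)
qed

lemma warp_ratio_deriv:
  assumes r: "r \<ge> 0"
  shows "(warp_ratio \<psi> has_real_derivative ratio' r) (at r within {0..})"
proof (cases "r = 0")
  case False
  then show ?thesis using warp_ratio_deriv_pos[of r] r
    by (simp add: at_interior)
next
  case True
  have "((\<lambda>r. (warp_ratio \<psi> r - 1) / r) \<longlongrightarrow> 0) (at 0 within {0..})"
    unfolding tendsto_iff
  proof (intro allI impI)
    fix e :: real assume e: "e > 0"
    obtain d where d: "d > 0" "\<And>r. 0 \<le> r \<Longrightarrow> r < d \<Longrightarrow> \<bar>ratio' r\<bar> < e"
      by (rule ratio'_small[OF e]) blast
    have "\<bar>(warp_ratio \<psi> r - 1) / r\<bar> < e" if r: "0 < r" "r < d" for r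
    proof -
      have wd: "(warp_ratio \<psi> has_derivative (*) (ratio' x)) (at x)" if "0 < x" for x
        using warp_ratio_deriv_pos[OF that] by (simp add: has_field_derivative_def)
      have wc: "continuous_on {0..r} (warp_ratio \<psi>)"
        by (rule continuous_on_subset[OF warp_ratio_cont]) auto
      obtain xi where xi: "0 < xi" "xi < r"
        "warp_ratio \<psi> r - warp_ratio \<psi> 0 = ratio' xi * (r - 0)"
        using mvt[OF \<open>0 < r\<close> wc, of "\<lambda>x. (*) (ratio' x)"] wd by blast
      moreover have "warp_ratio \<psi> 0 = 1" by (simp add: warp_ratio_def)
      ultimately show ?thesis using d(2)[of xi] r by simp
    qed
    then show "\<forall>\<^sub>F r in at 0 within {0..}. dist ((warp_ratio \<psi> r - 1) / r) 0 < e"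
      unfolding eventually_at using d(1) by (intro exI[of _ d]) (auto simp: dist_real_def)
  qed
  then show ?thesis using True
    by (simp add: has_field_derivative_iff ratio'_def warp_ratio_def[of _ 0])
qed

lemma warp_ratio_pos: "r \<ge> 0 \<Longrightarrow> warp_ratio \<psi> r > 0"
  using psi_pos[of r] by (auto simp: warp_ratio_def)

lemma vol_density_eq:
  "vol_density (model_metric \<psi>) (x::real^'n::finite) = warp_ratio \<psi> (norm x) ^ (CARD('n) - 1)"
  using psi_pos[of "norm x"] by (intro vol_density_model_metric) (auto intro: less_imp_le)

lemma vol_density_pos: "vol_density (model_metric \<psi>) (x::real^'n::finite) > 0"
  unfolding vol_density_eq by (simp add: warp_ratio_pos)

definition vol' :: "real^'n::finite \<Rightarrow> real^'n \<Rightarrow> real" where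
  "vol' x h = real (CARD('n) - 1) * (ratio' (norm x) * warp_ratio \<psi> (norm x) ^ (CARD('n) - 1 - 1)) * (sgn x \<bullet> h)"

text \<open>
  Including at the pole: there the derivative of the warp ratio vanishes.
\<close>

lemma vol_density_deriv:
  "locally_bounded_derivative (vol_density (model_metric \<psi> :: 'n::finite metric)) vol'"
proof -
  define m where "m = CARD('n) - 1"
  have "locally_bounded_derivative (\<lambda>x::real^'n. warp_ratio \<psi> (norm x) ^ m)
      (\<lambda>x h. (real m * (ratio' (norm x) * warp_ratio \<psi> (norm x) ^ (m - 1))) * (sgn x \<bullet> h))"
  proof (rule locally_bounded_derivative_radial)
    show "((\<lambda>r. warp_ratio \<psi> r ^ m) has_real_derivative
        real m * (ratio' r * warp_ratio \<psi> r ^ (m - 1))) (at r within {0..})" if "r \<ge> 0" for r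
      using DERIV_power[OF warp_ratio_deriv[OF that], of m] by (simp add: mult_ac)
    show "continuous_on {0..} (\<lambda>r. real m * (ratio' r * warp_ratio \<psi> r ^ (m - 1)))"
      by (intro continuous_intros ratio'_cont warp_ratio_cont)
  qed (simp add: ratio'_def)
  then show ?thesis
    by (simp add: vol_density_eq[abs_def] vol'_def[abs_def] m_def)
qed

lemma vol_density_cont: "continuous_on UNIV (vol_density (model_metric \<psi> :: 'n::finite metric))"
  by (rule locally_bounded_derivative_continuous[OF vol_density_deriv])

lemma vol_density_measurable [measurable]:
  "vol_density (model_metric \<psi> :: 'n::finite metric) \<in> borel_measurable borel"
  by (rule borel_measurable_continuous_onI[OF vol_density_cont])

lemma measurable_riem_measure:
  "(f :: real^'n::finite \<Rightarrow> 'b::topological_space) \<in> borel_measurable (riem_measure (model_metric \<psi>))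
    \<longleftrightarrow> f \<in> borel_measurable borel"
  by (simp add: riem_measure_def cong: measurable_cong_sets)

text \<open>
  The volume density \<open>(\<psi> r / r) ^ (N - 1)\<close> turns the weight \<open>r ^ (N - 1)\<close> of polar coordinates into
  \<open>\<psi> r ^ (N - 1)\<close>.
\<close>

lemma integrable_riem_measure_radial:
  assumes f: "continuous_on {0..} f"
  shows "integrable (riem_measure (model_metric \<psi>)) (\<lambda>x::real^'n::finite. f (norm x)) \<longleftrightarrow>
    set_integrable lborel {0..} (\<lambda>r. \<psi> r ^ (CARD('n) - 1) * f r)"
proof -
  define m where "m = CARD('n) - 1"
  have cont: "continuous_on {0..} (\<lambda>r. warp_ratio \<psi> r ^ m * f r)"
    by (intro continuous_intros warp_ratio_cont f)
  have "(\<lambda>x::real^'n. f (norm x)) \<in> borel_measurable borel"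
    by (intro borel_measurable_continuous_onI continuous_on_compose2[OF f] continuous_intros) auto
  then have "integrable (riem_measure (model_metric \<psi>)) (\<lambda>x::real^'n. f (norm x)) \<longleftrightarrow>
      integrable lborel (\<lambda>x::real^'n. vol_density (model_metric \<psi>) x *\<^sub>R f (norm x))"
    unfolding riem_measure_def
    by (intro integrable_density) (auto intro: less_imp_le[OF vol_density_pos])
  also have "\<dots> \<longleftrightarrow> integrable lborel (\<lambda>x::real^'n. warp_ratio \<psi> (norm x) ^ m * f (norm x))"
    by (simp add: vol_density_eq m_def)
  also have "\<dots> \<longleftrightarrow> set_integrable lborel {0..} (\<lambda>r. r ^ m * (warp_ratio \<psi> r ^ m * f r))"
    using integrable_radial_iff[OF cont, where 'a = "real^'n"] by (simp add: m_def)
  also have "\<dots> \<longleftrightarrow> set_integrable lborel {0..} (\<lambda>r. \<psi> r ^ m * f r)"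
    unfolding set_integrable_def
  proof (rule integrable_cong_AE)
    have "continuous_on {0..} (\<lambda>x. x ^ m * (warp_ratio \<psi> x ^ m * f x))"
      by (intro continuous_intros cont)
    from borel_measurable_continuous_on_indicator[OF _ this]
    show "(\<lambda>x. indicator {0..} x *\<^sub>R (x ^ m * (warp_ratio \<psi> x ^ m * f x))) \<in> borel_measurable lborel"
      by simp
    have "continuous_on {0..} (\<lambda>x. \<psi> x ^ m * f x)"
      by (intro continuous_intros psi_cont f)
    from borel_measurable_continuous_on_indicator[OF _ this]
    show "(\<lambda>x. indicator {0..} x *\<^sub>R (\<psi> x ^ m * f x)) \<in> borel_measurable lborel"
      by simp
    have "AE x in lborel. x \<noteq> (0::real)" by (rule AE_lborel_singleton)
    then show "AE x in lborel. indicator {0..} x *\<^sub>R (x ^ m * (warp_ratio \<psi> x ^ m * f x))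
        = indicator {0..} x *\<^sub>R (\<psi> x ^ m * f x)"
      by eventually_elim (auto simp: warp_ratio_def power_divide)
  qed
  finally show ?thesis by (simp add: m_def)
qed

end

section \<open>The Sobolev space of radial functions\<close>

locale radial_function_on_model = radial_C2_function u v u' u'' + warping_function \<psi> \<psi>' \<psi>''
  for u :: "real^'n::finite \<Rightarrow> real" and v u' u'' \<psi> \<psi>' \<psi>''
begin

text \<open>
  The Euclidean gradient, which for a radial function is also the Riemannian one; this form is visibly
  continuous at the pole.
\<close>

definition grad :: "real^'n \<Rightarrow> real^'n" where
  "grad x = (\<Sum>i\<in>UNIV. u' x (axis i 1) *\<^sub>R axis i 1)"

lemma u'_cont: "continuous_on UNIV u'"
  using has_derivative_continuous[OF u'_deriv] by (intro continuous_at_imp_continuous_on) auto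

lemma u_cont: "continuous_on UNIV u"
  using has_derivative_continuous[OF u_deriv] by (intro continuous_at_imp_continuous_on) auto

lemma grad_cont: "continuous_on UNIV grad"
  unfolding grad_def by (intro continuous_intros u'_cont)

lemma grad_component: "grad x $ i = u' x (axis i 1)"
  by (simp add: grad_def axis_def if_distrib[of "(*) _"] sum.delta cong: if_cong)

lemma u'_sum: "u' x h = (\<Sum>i\<in>UNIV. u' x (axis i 1) * h $ i)"
proof -
  have "u' x h = u' x (\<Sum>i\<in>UNIV. h $ i *\<^sub>R axis i 1)"
    using basis_expansion[of h] by (simp add: scalar_mult_eq_scaleR)
  then show ?thesis by (simp add: blinfun.sum_right blinfun.scaleR_right mult.commute)
qed

lemma grad_eq: "grad x = (if x = 0 then 0 else dv (norm x) *\<^sub>R sgn x)"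
proof (cases "x = 0")
  case True
  then show ?thesis by (simp add: grad_def u'_zero)
next
  case False
  have "grad x $ i = (dv (norm x) *\<^sub>R sgn x) $ i" for i
    unfolding grad_component u'_radial[OF False] by (simp add: inner_axis)
  then have "grad x = dv (norm x) *\<^sub>R sgn x" unfolding vec_eq_iff by blast
  with False show ?thesis by simp
qed

lemma metric_grad: "model_metric \<psi> x (grad x) h = u' x h"
proof (cases "x = 0")
  case True
  then show ?thesis by (simp add: grad_eq u'_zero model_metric_def)
next
  case False
  then show ?thesis by (simp add: grad_eq model_metric_radial u'_radial)
qed

lemma metric_grad_grad: "model_metric \<psi> x (grad x) (grad x) = (dv (norm x))\<^sup>2"
proof (cases "x = 0")
  case True
  then show ?thesis by (simp add: metric_grad u'_zero dv_def)
next
  case False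
  then have "sgn x \<bullet> sgn x = 1" by (simp add: norm_eq_1[symmetric] norm_sgn)
  then show ?thesis using False
    by (simp add: grad_eq model_metric_radial power2_eq_square)
qed

text \<open>
  The density times \<open>u * riem_div Y + g (grad u, Y)\<close> is the flat divergence of the compactly supported field
  \<open>u x * vol_density x *\<^sub>R Y x\<close>.
\<close>

lemma weak_grad_u: "weak_grad (model_metric \<psi>) u grad"
  unfolding weak_grad_def
proof (intro allI impI)
  fix Y :: "real^'n \<Rightarrow> real^'n"
  assume "C1_map Y" and comp: "compact (closure {x. Y x \<noteq> 0})"
  then obtain Y' :: "real^'n \<Rightarrow> (real^'n) \<Rightarrow>\<^sub>L (real^'n)"
    where Yd: "\<And>x. (Y has_derivative blinfun_apply (Y' x)) (at x)" and Yc: "continuous_on UNIV Y'"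
    unfolding C1_map_def by auto
  have Ycont: "continuous_on UNIV Y"
    using has_derivative_continuous[OF Yd] by (intro continuous_at_imp_continuous_on) auto
  obtain R where R: "\<And>x. Y x \<noteq> 0 \<Longrightarrow> norm x \<le> R"
    using compact_imp_bounded[OF comp] closure_subset[of "{x. Y x \<noteq> 0}"]
    unfolding bounded_iff by (metis (mono_tags, lifting) mem_Collect_eq subset_iff)
  define V where "V = vol_density (model_metric \<psi> :: 'n metric)"
  \<comment> \<open>\<open>W x h i\<close> is the derivative of the component \<open>i\<close> of \<open>V *\<^sub>R Y\<close> in direction \<open>h\<close>, and \<open>D\<close> is the flat divergence of this field.\<close>
  define W where "W = (\<lambda>x h i. V x * Y' x h $ i + vol' x h * Y x $ i)"
  define D where "D = (\<lambda>x. \<Sum>i\<in>UNIV. W x (axis i 1) i)"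
  have Yi: "locally_bounded_derivative (\<lambda>x. Y x $ i) (\<lambda>x h. Y' x h $ i)" for i
  proof -
    have component: "blinfun_apply (blinfun_inner_left (axis i 1) o\<^sub>L Y' x) = (\<lambda>h. Y' x h $ i)" for x
      by (auto simp: fun_eq_iff inner_axis)
    have "locally_bounded_derivative (\<lambda>x. Y x $ i)
        (\<lambda>x. blinfun_apply (blinfun_inner_left (axis i 1) o\<^sub>L Y' x))"
    proof (rule locally_bounded_derivative_C1)
      show "((\<lambda>x. Y x $ i) has_derivative blinfun_apply (blinfun_inner_left (axis i 1) o\<^sub>L Y' x)) (at x)" for x
        using bounded_linear.has_derivative[OF bounded_linear_vec_nth[of i] Yd[of x]]
        unfolding component .
      show "continuous_on UNIV (\<lambda>x. blinfun_inner_left (axis i 1) o\<^sub>L Y' x)"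
        by (intro continuous_intros Yc)
    qed
    then show ?thesis unfolding component .
  qed
  have Vd: "locally_bounded_derivative V vol'" unfolding V_def by (rule vol_density_deriv)
  have VY: "locally_bounded_derivative (\<lambda>x. V x * Y x $ i) (\<lambda>x h. W x h i)" for i
    unfolding W_def by (rule locally_bounded_derivative_mult[OF Vd Yi])
  have ud: "locally_bounded_derivative u (\<lambda>x. blinfun_apply (u' x))"
    by (rule locally_bounded_derivative_C1[OF u_deriv u'_cont])
  have uVY: "locally_bounded_derivative (\<lambda>x. u x * (V x * Y x $ i))
      (\<lambda>x h. u x * W x h i + u' x h * (V x * Y x $ i))" for i
    by (rule locally_bounded_derivative_mult[OF ud VY])
  have supp: "Y x = 0" if "norm x > R" for x using R[of x] that by force
  have int1: "integrable lborel (\<lambda>x. u x * W x (axis i 1) i + u' x (axis i 1) * (V x * Y x $ i))"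
    and int0: "(\<integral>x. u x * W x (axis i 1) i + u' x (axis i 1) * (V x * Y x $ i) \<partial>lborel) = 0" for i
    using integral_derivative_compact_support[OF uVY, of R] supp by auto
  have Wint: "integrable lborel (\<lambda>x. W x (axis i 1) i)" for i
    using integral_derivative_compact_support(1)[OF VY, of R] supp by auto
  have Dm: "D \<in> borel_measurable borel"
    unfolding D_def using borel_measurable_integrable[OF Wint] by (intro borel_measurable_sum) simp
  have Vpos: "V x > 0" for x unfolding V_def by (rule vol_density_pos)
  have Vm: "V \<in> borel_measurable borel" unfolding V_def by (rule vol_density_measurable)
  have um: "u \<in> borel_measurable borel" by (rule borel_measurable_continuous_onI[OF u_cont])
  have div: "riem_div (model_metric \<psi>) Y x = D x / V x" for x
  proof -
    have "((\<lambda>y. V y *\<^sub>R Y y) has_derivative (\<lambda>h. V x *\<^sub>R Y' x h + vol' x h *\<^sub>R Y x)) (at x)"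
      using Vd Yd by (intro has_derivative_scaleR) (auto simp: locally_bounded_derivative_def)
    then have "frechet_derivative (\<lambda>y. V y *\<^sub>R Y y) (at x) = (\<lambda>h. V x *\<^sub>R Y' x h + vol' x h *\<^sub>R Y x)"
      by (rule frechet_derivative_at[symmetric])
    then show ?thesis by (simp add: riem_div_def D_def W_def V_def)
  qed
  have cont1: "continuous_on UNIV (\<lambda>x. V x * u' x (Y x))"
    using locally_bounded_derivative_continuous[OF Vd]
    by (intro continuous_intros u'_cont Ycont)
  have gint: "integrable lborel (\<lambda>x. V x * u' x (Y x))"
  proof -
    have "(\<lambda>x. V x * u' x (Y x)) = (\<lambda>x. indicator (cball 0 R) x *\<^sub>R (V x * u' x (Y x)))"
      using supp by (auto simp: fun_eq_iff indicator_def)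
    moreover have "integrable lborel (\<lambda>x. indicator (cball 0 R) x *\<^sub>R (V x * u' x (Y x)))"
      by (intro borel_integrable_compact continuous_on_subset[OF cont1]) auto
    ultimately show ?thesis by simp
  qed
  have sum_eq: "(\<Sum>i\<in>UNIV. u x * W x (axis i 1) i + u' x (axis i 1) * (V x * Y x $ i))
      = u x * D x + V x * u' x (Y x)" for x
    unfolding D_def u'_sum[of x "Y x"]
    by (simp add: sum.distrib sum_distrib_left mult_ac)
  have sint: "integrable lborel (\<lambda>x. u x * D x + V x * u' x (Y x))"
    unfolding sum_eq[symmetric] by (intro Bochner_Integration.integrable_sum int1)
  have s0: "(\<integral>x. u x * D x + V x * u' x (Y x) \<partial>lborel) = 0"
    unfolding sum_eq[symmetric] by (subst Bochner_Integration.integral_sum) (use int1 int0 in auto)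
  have uD: "integrable lborel (\<lambda>x. u x * D x)"
    using Bochner_Integration.integrable_diff[OF sint gint] by simp
  have "(\<integral>x. model_metric \<psi> x (grad x) (Y x) \<partial>riem_measure (model_metric \<psi>))
      = (\<integral>x. V x *\<^sub>R u' x (Y x) \<partial>lborel)"
    unfolding riem_measure_def metric_grad V_def[symmetric]
  proof (rule integral_density)
    show "(\<lambda>x. u' x (Y x)) \<in> borel_measurable lborel"
      by simp (intro borel_measurable_continuous_onI continuous_intros u'_cont Ycont)
  qed (use Vm Vpos in \<open>auto intro: less_imp_le\<close>)
  moreover have "(\<integral>x. u x * riem_div (model_metric \<psi>) Y x \<partial>riem_measure (model_metric \<psi>))
      = (\<integral>x. V x *\<^sub>R (u x * (D x / V x)) \<partial>lborel)"
    unfolding riem_measure_def div V_def[symmetric]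
    by (rule integral_density) (use Vm Vpos um Dm in \<open>auto intro: less_imp_le\<close>)
  moreover have "V x *\<^sub>R (u x * (D x / V x)) = u x * D x" for x using Vpos[of x] by simp
  moreover have "(\<integral>x. u x * D x + V x * u' x (Y x) \<partial>lborel)
      = (\<integral>x. u x * D x \<partial>lborel) + (\<integral>x. V x * u' x (Y x) \<partial>lborel)"
    by (rule Bochner_Integration.integral_add[OF uD gint])
  ultimately show "(\<integral>x. model_metric \<psi> x (grad x) (Y x) \<partial>riem_measure (model_metric \<psi>))
      = - (\<integral>x. u x * riem_div (model_metric \<psi>) Y x \<partial>riem_measure (model_metric \<psi>))"
    using s0 by simp
qed

lemma L2_fun_iff:
  "L2_fun (model_metric \<psi>) u \<longleftrightarrow> set_integrable lborel {0..} (\<lambda>r. \<psi> r ^ (CARD('n) - 1) * (v r)\<^sup>2)"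
proof -
  have c: "continuous_on {0..} (\<lambda>r. (v r)\<^sup>2)" by (intro continuous_intros v_cont)
  have "(\<lambda>x. (u x)\<^sup>2) = (\<lambda>x. (v (norm x))\<^sup>2)" by (simp add: radial)
  then show ?thesis
    using integrable_riem_measure_radial[OF c, where 'n = 'n]
    by (simp add: L2_fun_def measurable_riem_measure borel_measurable_continuous_onI[OF u_cont])
qed

lemma L2_field_grad_iff:
  "L2_field (model_metric \<psi>) grad \<longleftrightarrow>
    set_integrable lborel {0..} (\<lambda>r. \<psi> r ^ (CARD('n) - 1) * (dv r)\<^sup>2)"
proof -
  have c: "continuous_on {0..} (\<lambda>r. (dv r)\<^sup>2)"
    by (intro continuous_intros continuous_on_subset[OF dv_cont]) auto
  show ?thesis
    using integrable_riem_measure_radial[OF c, where 'n = 'n]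
    by (simp add: L2_field_def metric_grad_grad measurable_riem_measure
        borel_measurable_continuous_onI[OF grad_cont])
qed

lemma sobolev_H1_I:
  assumes "set_integrable lborel {0..} (\<lambda>r. \<psi> r ^ (CARD('n) - 1) * (v r)\<^sup>2)"
    and "set_integrable lborel {0..} (\<lambda>r. \<psi> r ^ (CARD('n) - 1) * (dv r)\<^sup>2)"
  shows "u \<in> sobolev_H1 (model_metric \<psi>)"
  using assms L2_fun_iff L2_field_grad_iff weak_grad_u unfolding sobolev_H1_def by blast

lemma sobolev_H1_D:
  "u \<in> sobolev_H1 (model_metric \<psi>) \<Longrightarrow>
    set_integrable lborel {0..} (\<lambda>r. \<psi> r ^ (CARD('n) - 1) * (v r)\<^sup>2)"
  using L2_fun_iff unfolding sobolev_H1_def by blast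

end

section \<open>Positive radial solutions\<close>

locale positive_lane_emden_solution = radial_function_on_model u v u' u'' \<psi> \<psi>' \<psi>''
  for u :: "real^'n::finite \<Rightarrow> real" and v u' u'' \<psi> \<psi>' \<psi>'' +
  fixes m :: nat and p :: real
  assumes m_eq: "m = CARD('n) - 1" and m_pos: "m > 0" and p_gt: "p > 1"
    and psi'_nonneg: "\<And>r. r > 0 \<Longrightarrow> \<psi>' r \<ge> 0"
    and u_pos: "\<And>x. u x > 0"
    and equation: "\<And>x. - laplace_beltrami (model_metric \<psi>) u x = \<bar>u x\<bar> powr (p - 1) * u x"
begin

lemma v_pos: "r \<ge> 0 \<Longrightarrow> v r > 0"
  using u_pos[of "r *\<^sub>R e"] by (simp add: radial norm_e)

lemma ddv_eq: "r > 0 \<Longrightarrow> ddv r = - (real m * (\<psi>' r / \<psi> r) * dv r) - v r powr p"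
proof -
  assume r: "r > 0"
  have "v r powr (p - 1) * v r = v r powr p"
    using v_pos[of r] r powr_add[of "v r" "p - 1" 1] by simp
  then have "- laplace_beltrami (model_metric \<psi>) u (r *\<^sub>R e) = v r powr p"
    using equation[of "r *\<^sub>R e"] r v_pos[of r] by (simp add: radial norm_e)
  then show ?thesis
    using laplace_u[OF psi_pos psi_deriv[OF r] r] by (simp add: m_eq)
qed

lemma dv_ode: "r > 0 \<Longrightarrow>
    (dv has_real_derivative - (real m * (\<psi>' r / \<psi> r) * dv r) - v r powr p) (at r)"
  using dv_deriv[of r] ddv_eq[of r] by simp

text \<open>
  The flux form of the equation shows that \<open>\<psi> ^ m * v'\<close> is strictly decreasing, and it vanishes at the
  pole.
\<close>

lemma dv_neg:
  assumes r: "r > 0"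
  shows "dv r < 0"
proof -
  have "(\<lambda>r. \<psi> r ^ m * dv r) r < (\<lambda>r. \<psi> r ^ m * dv r) 0"
  proof (rule DERIV_neg_imp_decreasing_open[OF r])
    fix x assume x: "0 < x" "x < r"
    have px: "\<psi> x > 0" by (rule psi_pos[OF x(1)])
    have "\<psi> x ^ m = \<psi> x * \<psi> x ^ (m - 1)"
      using m_pos by (metis Suc_pred' power_Suc)
    then have "((\<lambda>r. \<psi> r ^ m * dv r) has_real_derivative - (\<psi> x ^ m * v x powr p)) (at x)"
      using px by (intro DERIV_cong[OF DERIV_mult[OF DERIV_power[OF psi_deriv[OF x(1)]] dv_ode[OF x(1)]]])
        (simp add: field_simps)
    moreover have "- (\<psi> x ^ m * v x powr p) < 0" using px v_pos[of x] x by simp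
    ultimately show "\<exists>y. ((\<lambda>r. \<psi> r ^ m * dv r) has_real_derivative y) (at x) \<and> y < 0" by blast
  next
    show "continuous_on {0..r} (\<lambda>r. \<psi> r ^ m * dv r)"
      by (intro continuous_intros continuous_on_subset[OF psi_cont] continuous_on_subset[OF dv_cont]) auto
  qed
  then show ?thesis using psi_0 m_pos psi_pos[OF r] by (simp add: mult_less_0_iff zero_power)
qed

lemma v_antimono: "0 < r \<Longrightarrow> r \<le> s \<Longrightarrow> v s \<le> v r"
proof (rule DERIV_nonpos_imp_nonincreasing[of r s])
  fix x assume "0 < r" "r \<le> x"
  then have "0 < x" by simp
  then show "\<exists>z. (v has_real_derivative z) (at x) \<and> z \<le> 0"
    using v_deriv[of x] dv_neg[of x] by (intro exI[of _ "dv x"]) auto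
qed

text \<open>
  If \<open>v\<close> had a limit \<open>w > 0\<close>, the source \<open>v powr p\<close> would be at least \<open>w powr p\<close>, while the friction
  coefficient \<open>m \<psi>' / \<psi>\<close> is bounded; this forces \<open>v'\<close> below a negative constant, and \<open>v\<close> would
  become negative.
\<close>

lemma v_vanishes:
  assumes lim: "((\<lambda>r. \<psi>' r / \<psi> r) \<longlongrightarrow> l) at_top"
  shows "(v \<longlongrightarrow> 0) at_top"
proof -
  obtain T where T: "((\<lambda>r. - v r) \<longlongrightarrow> T) at_top" "\<And>r. 1 \<le> r \<Longrightarrow> - v r \<le> T"
    by (rule bounded_mono_tendsto_at_top[of 1 "\<lambda>r. - v r" 0])
      (use v_antimono v_pos in \<open>auto simp: less_imp_le\<close>)
  define w where "w = - T"
  have w: "(v \<longlongrightarrow> w) at_top" "\<And>r. 1 \<le> r \<Longrightarrow> w \<le> v r"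
    using tendsto_minus[OF T(1)] T(2) by (auto simp: w_def minus_le_iff)
  have "w \<ge> 0"
  proof (rule tendsto_lowerbound[OF w(1)])
    have "0 \<le> v r" if "r \<ge> 1" for r using v_pos[of r] that by simp
    then show "\<forall>\<^sub>F r in at_top. 0 \<le> v r" using eventually_at_top_linorder by blast
  qed simp
  have "\<not> w > 0"
  proof
    assume "w > 0"
    define B where "B = \<bar>l\<bar> + 1"
    have "B > 0" by (simp add: B_def)
    \<comment> \<open>As long as \<open>- k \<le> dv r\<close>, friction uses up at most half of the source.\<close>
    define k where "k = w powr p / (2 * real m * B)"
    have "k > 0" using \<open>w > 0\<close> m_pos \<open>B > 0\<close> by (simp add: k_def)
    have "\<forall>\<^sub>F r in at_top. \<psi>' r / \<psi> r < B"
      using order_tendstoD(2)[OF lim, of B] abs_ge_self[of l] by (simp add: B_def)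
    then have "\<forall>\<^sub>F r in at_top. 1 \<le> r \<and> \<psi>' r / \<psi> r < B"
      using eventually_ge_at_top[of 1] by eventually_elim simp
    then obtain S where S: "\<And>r. r \<ge> S \<Longrightarrow> 1 \<le> r \<and> \<psi>' r / \<psi> r < B"
      unfolding eventually_at_top_linorder by blast
    have "\<forall>\<^sub>F r in at_top. dv r < - k"
    proof (rule eventually_below_barrier[of S dv _ _ "w powr p / 2"])
      show "(dv has_real_derivative - (real m * (\<psi>' r / \<psi> r) * dv r) - v r powr p) (at r)"
        if "S \<le> r" for r using dv_ode[of r] S[OF that] by simp
      show "- (real m * (\<psi>' r / \<psi> r) * dv r) - v r powr p \<le> - (w powr p / 2)"
        if "S \<le> r" "- k \<le> dv r" for r
      proof -
        have r: "r \<ge> 1" "\<psi>' r / \<psi> r < B" using S[OF that(1)] by auto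
        have Q: "\<psi>' r / \<psi> r \<ge> 0" using psi'_nonneg[of r] psi_pos[of r] r by simp
        have "(real m * (\<psi>' r / \<psi> r)) * (- dv r) \<le> (real m * B) * k"
          using that(2) r Q \<open>B > 0\<close> dv_neg[of r] by (intro mult_mono) auto
        also have "\<dots> = w powr p / 2" using m_pos \<open>B > 0\<close> by (simp add: k_def)
        finally have "- (real m * (\<psi>' r / \<psi> r) * dv r) \<le> w powr p / 2" by simp
        moreover have "w powr p \<le> v r powr p"
          using w(2)[OF r(1)] \<open>w > 0\<close> p_gt by (intro powr_mono2) auto
        ultimately show ?thesis by linarith
      qed
    qed (use \<open>w > 0\<close> in simp)
    then have "\<forall>\<^sub>F r in at_top. 1 \<le> r \<and> dv r \<le> - k"
      using eventually_ge_at_top[of 1] by eventually_elim simp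
    then obtain S' where S': "\<And>r. r \<ge> S' \<Longrightarrow> 1 \<le> r \<and> dv r \<le> - k"
      unfolding eventually_at_top_linorder by blast
    show False
    proof (rule not_always_decreasing_if_positive[of S' v dv k])
      show "(v has_real_derivative dv r) (at r)" if "S' \<le> r" for r
        using v_deriv[of r] S'[OF that] by simp
      show "v r > 0" if "S' \<le> r" for r using v_pos[of r] S'[OF that] by simp
    qed (use S' \<open>k > 0\<close> in auto)
  qed
  with \<open>w \<ge> 0\<close> w(1) show ?thesis by simp
qed

text \<open>
  For a constant \<open>q\<close>, the smallness of the forcing term is the vanishing of \<open>v\<close>.
\<close>

lemma ode_at_infinity_finite:
  assumes lim: "((\<lambda>r. \<psi>' r / \<psi> r) \<longlongrightarrow> l) at_top" and "l > 0"
  shows "lane_emden_ode \<psi> \<psi>' v dv (\<lambda>_. l) (\<lambda>_. 0) m p 1 l"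
proof
  have "((\<lambda>r. \<psi>' r / \<psi> r / l) \<longlongrightarrow> l / l) at_top"
    using \<open>l > 0\<close> by (intro tendsto_intros lim) simp
  then show "((\<lambda>r. \<psi>' r / \<psi> r / l) \<longlongrightarrow> 1) at_top" using \<open>l > 0\<close> by simp
  have "((\<lambda>r. v r powr (p - 1) / l\<^sup>2) \<longlongrightarrow> 0 / l\<^sup>2) at_top"
  proof (intro tendsto_divide tendsto_const)
    have "((\<lambda>r. v r powr (p - 1)) \<longlongrightarrow> 0 powr (p - 1)) at_top"
      by (rule tendsto_powr'[OF v_vanishes[OF lim] tendsto_const])
        (use p_gt eventually_mono[OF eventually_ge_at_top less_imp_le[OF v_pos]] in auto)
    then show "((\<lambda>r. v r powr (p - 1)) \<longlongrightarrow> 0) at_top" by simp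
  qed (use \<open>l > 0\<close> in simp)
  then show "((\<lambda>r. v r powr (p - 1) / l\<^sup>2) \<longlongrightarrow> 0) at_top" by simp
qed (use m_pos p_gt psi_deriv psi_pos v_deriv dv_ode v_pos dv_neg \<open>l > 0\<close> in auto)

text \<open>
  For \<open>q = \<psi>' / \<psi>\<close> one has \<open>q' / q\<^sup>2 = (ln q)' / q\<close>, a bounded function over a divergent one; and the forcing
  term vanishes since \<open>v\<close> is bounded.
\<close>

lemma ode_at_infinity_infinite:
  assumes lim: "filterlim (\<lambda>r. \<psi>' r / \<psi> r) at_top at_top"
    and log: "deriv (\<lambda>r. ln (\<psi>' r / \<psi> r)) \<in> O[at_top](\<lambda>_. 1)"
  shows "\<exists>R>0. lane_emden_ode \<psi> \<psi>' v dv (\<lambda>r. \<psi>' r / \<psi> r)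
    (\<lambda>r. \<psi>'' r / \<psi> r - (\<psi>' r / \<psi> r)\<^sup>2) m p R 1"
proof -
  define Q where "Q = (\<lambda>r. \<psi>' r / \<psi> r)"
  define Q' where "Q' = (\<lambda>r. \<psi>'' r / \<psi> r - (\<psi>' r / \<psi> r)\<^sup>2)"
  have limQ: "filterlim Q at_top at_top" using lim by (simp add: Q_def)
  have Qd: "(Q has_real_derivative Q' r) (at r)" if "r > 0" for r
    unfolding Q_def Q'_def using psi_pos[OF that]
    by (intro DERIV_cong[OF DERIV_divide[OF psi'_deriv[OF that] psi_deriv[OF that]]])
      (auto simp: field_simps power2_eq_square)
  have ev1: "\<forall>\<^sub>F r in at_top. Q r \<ge> 1"
    using limQ unfolding filterlim_at_top by blast
  then have "\<forall>\<^sub>F r in at_top. r \<ge> 1 \<and> Q r \<ge> 1"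
    using eventually_ge_at_top[of 1] by eventually_elim simp
  then obtain R where R: "\<And>r. r \<ge> R \<Longrightarrow> r \<ge> 1 \<and> Q r \<ge> 1"
    unfolding eventually_at_top_linorder by blast
  obtain C where C: "C > 0" "\<forall>\<^sub>F r in at_top. \<bar>deriv (\<lambda>r. ln (Q r)) r\<bar> \<le> C"
    using log unfolding Q_def by (elim landau_o.bigE) auto
  have inv: "((\<lambda>r. 1 / Q r) \<longlongrightarrow> 0) at_top"
    using tendsto_inverse_0_at_top[OF limQ] by (simp add: inverse_eq_divide)
  have small: "((\<lambda>r. Q' r / (Q r)\<^sup>2) \<longlongrightarrow> 0) at_top"
  proof (rule Lim_null_comparison)
    show "\<forall>\<^sub>F r in at_top. norm (Q' r / (Q r)\<^sup>2) \<le> C * (1 / Q r)"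
      using C(2) eventually_ge_at_top[of R]
    proof eventually_elim
      case (elim r)
      have r: "r > 0" "Q r > 0" using R[of r] elim by auto
      have "((\<lambda>r. ln (Q r)) has_real_derivative Q' r / Q r) (at r)"
        using Qd[OF r(1)] r by (auto intro!: derivative_eq_intros)
      then have "deriv (\<lambda>r. ln (Q r)) r = Q' r / Q r" by (rule DERIV_imp_deriv)
      then have "\<bar>Q' r / Q r\<bar> \<le> C" using elim by simp
      then have "\<bar>Q' r / Q r\<bar> * (1 / Q r) \<le> C * (1 / Q r)" using r by (intro mult_right_mono) auto
      then show ?case using r by (simp add: power2_eq_square abs_mult)
    qed
    have "((\<lambda>r. C * (1 / Q r)) \<longlongrightarrow> C * 0) at_top" by (intro tendsto_intros inv)
    then show "((\<lambda>r. C * (1 / Q r)) \<longlongrightarrow> 0) at_top" by simp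
  qed
  have forcing: "((\<lambda>r. v r powr (p - 1) / (Q r)\<^sup>2) \<longlongrightarrow> 0) at_top"
  proof (rule Lim_null_comparison)
    show "\<forall>\<^sub>F r in at_top. norm (v r powr (p - 1) / (Q r)\<^sup>2) \<le> v 1 powr (p - 1) * (1 / Q r)\<^sup>2"
      using eventually_ge_at_top[of R]
    proof eventually_elim
      case (elim r)
      have r: "r \<ge> 1" using R[of r] elim by auto
      have "v r powr (p - 1) \<le> v 1 powr (p - 1)"
        using r p_gt v_antimono[of 1 r] v_pos[of r] by (intro powr_mono2) auto
      then have "v r powr (p - 1) * (1 / Q r)\<^sup>2 \<le> v 1 powr (p - 1) * (1 / Q r)\<^sup>2"
        by (intro mult_right_mono) auto
      then show ?case by (simp add: power_divide)
    qed
    have "((\<lambda>r. v 1 powr (p - 1) * (1 / Q r)\<^sup>2) \<longlongrightarrow> v 1 powr (p - 1) * 0\<^sup>2) at_top"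
      by (intro tendsto_intros inv)
    then show "((\<lambda>r. v 1 powr (p - 1) * (1 / Q r)\<^sup>2) \<longlongrightarrow> 0) at_top" by simp
  qed
  have self: "((\<lambda>r. Q r / Q r) \<longlongrightarrow> 1) at_top"
  proof (rule tendsto_eventually)
    show "\<forall>\<^sub>F r in at_top. Q r / Q r = 1"
      using eventually_ge_at_top[of R]
    proof eventually_elim
      case (elim r)
      then show ?case using R[of r] by simp
    qed
  qed
  have R0: "R > 0 \<and> (\<forall>r\<ge>R. r > 0)" using R[of R] R by force
  have "lane_emden_ode \<psi> \<psi>' v dv Q Q' m p R 1"
  proof
    show "((\<lambda>r. \<psi>' r / \<psi> r / Q r) \<longlongrightarrow> 1) at_top" using self by (simp add: Q_def)
  qed (use m_pos p_gt psi_deriv psi_pos v_deriv dv_ode v_pos dv_neg R R0 Qd small forcing in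
      \<open>auto simp: less_imp_le\<close>)
  then show ?thesis unfolding Q_def Q'_def using R0 by blast
qed

end

section \<open>Asymptotics of positive radial solutions\<close>

context positive_lane_emden_solution
begin

lemma set_integrable_extend_to_0:
  fixes f :: "real \<Rightarrow> real"
  assumes "continuous_on {0..} f" "S \<ge> 0" "set_integrable lborel {S..} f"
  shows "set_integrable lborel {0..} f"
proof -
  have "set_integrable lborel ({0..S} \<union> {S..}) f"
    using assms by (intro set_integrable_Un set_integrable_bounded_interval(2)) auto
  then show ?thesis by (rule set_integrable_subset) (use assms in auto)
qed

lemma psi_power_cont:
  "continuous_on {0..} f \<Longrightarrow> continuous_on {0..} (\<lambda>r. \<psi> r ^ m * (f r)\<^sup>2)"
  by (intro continuous_intros psi_cont)

lemma fast_imp_sobolev_H1: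
  assumes ode: "lane_emden_ode \<psi> \<psi>' v dv q q' m p R c" and "R > 0"
    and fast: "(lane_emden_ode.y v dv q \<longlongrightarrow> real m) at_top"
  shows "u \<in> sobolev_H1 (model_metric \<psi>)"
proof -
  interpret E: lane_emden_ode \<psi> \<psi>' v dv q q' m p R c by (rule ode)
  obtain S where S: "S \<ge> R" "set_integrable lborel {S..} (\<lambda>r. \<psi> r ^ m * (v r)\<^sup>2)"
    using E.fast_mass_finite[OF fast] by blast
  obtain S' where S': "S' \<ge> R" "set_integrable lborel {S'..} (\<lambda>r. \<psi> r ^ m * (dv r)\<^sup>2)"
    using E.fast_energy_finite[OF fast] by blast
  have "set_integrable lborel {0..} (\<lambda>r. \<psi> r ^ m * (v r)\<^sup>2)"
    by (rule set_integrable_extend_to_0[OF psi_power_cont[OF v_cont] _ S(2)]) (use S \<open>R > 0\<close> in simp)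
  moreover have "set_integrable lborel {0..} (\<lambda>r. \<psi> r ^ m * (dv r)\<^sup>2)"
    by (rule set_integrable_extend_to_0[OF psi_power_cont _ S'(2)])
      (use S' \<open>R > 0\<close> in \<open>auto intro: continuous_on_subset[OF dv_cont]\<close>)
  ultimately show ?thesis using sobolev_H1_I by (simp add: m_eq)
qed

lemma slow_imp_not_sobolev_H1:
  assumes ode: "lane_emden_ode \<psi> \<psi>' v dv q q' m p R c" and "R > 0"
    and slow: "(lane_emden_ode.y v dv q \<longlongrightarrow> 0) at_top"
  shows "u \<notin> sobolev_H1 (model_metric \<psi>)"
proof
  interpret E: lane_emden_ode \<psi> \<psi>' v dv q q' m p R c by (rule ode)
  obtain S k where S: "S \<ge> R" "k > 0" "\<And>r. r \<ge> S \<Longrightarrow> k \<le> \<psi> r ^ m * (v r)\<^sup>2"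
    by (rule E.slow_mass_infinite[OF slow]) blast
  assume "u \<in> sobolev_H1 (model_metric \<psi>)"
  then have "set_integrable lborel {0..} (\<lambda>r. \<psi> r ^ m * (v r)\<^sup>2)"
    using sobolev_H1_D by (simp add: m_eq)
  then have "set_integrable lborel {S..} (\<lambda>r. \<psi> r ^ m * (v r)\<^sup>2)"
    by (rule set_integrable_subset) (use S \<open>R > 0\<close> in auto)
  moreover have "\<not> set_integrable lborel {S..} (\<lambda>r. \<psi> r ^ m * (v r)\<^sup>2)"
    by (rule not_set_integrable_bounded_below[OF S(2,3)])
  ultimately show False by simp
qed

text \<open>
  The two regimes exclude each other and exhaust all cases, so each of the preceding implications is an
  equivalence.
\<close>

lemma sobolev_H1_iff_fast:
  assumes ode: "lane_emden_ode \<psi> \<psi>' v dv q q' m p R c" and "R > 0"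
  shows "u \<in> sobolev_H1 (model_metric \<psi>) \<Longrightarrow> (lane_emden_ode.y v dv q \<longlongrightarrow> real m) at_top"
    and "u \<notin> sobolev_H1 (model_metric \<psi>) \<Longrightarrow> (lane_emden_ode.y v dv q \<longlongrightarrow> 0) at_top"
  using lane_emden_ode.slow_or_fast[OF ode] fast_imp_sobolev_H1[OF assms] slow_imp_not_sobolev_H1[OF assms]
  by blast+

lemma finite_energy_asymptotics:
  assumes ode: "lane_emden_ode \<psi> \<psi>' v dv q q' m p R c" and "R > 0"
    and H1: "u \<in> sobolev_H1 (model_metric \<psi>)"
  obtains L where "L > 0" "((\<lambda>r. \<psi> r ^ m * deriv v r) \<longlongrightarrow> - L) at_top"
    "\<And>l. l > 0 \<Longrightarrow> (q \<longlongrightarrow> l) at_top \<Longrightarrow> ((\<lambda>r. \<psi> r ^ m * v r) \<longlongrightarrow> L / (real m * l)) at_top"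
    "((\<lambda>r. v r / (LBINT s:{r<..}. \<psi> s powr (- real m))) \<longlongrightarrow> L) at_top"
proof -
  interpret E: lane_emden_ode \<psi> \<psi>' v dv q q' m p R c by (rule ode)
  note fast = sobolev_H1_iff_fast(1)[OF ode \<open>R > 0\<close> H1]
  obtain L where L: "L > 0" "(E.flux \<longlongrightarrow> L) at_top" "\<And>r. r \<ge> R \<Longrightarrow> E.flux r \<le> L"
    by (rule E.fast_flux_limit[OF fast]) blast
  have flux: "((\<lambda>r. \<psi> r ^ m * deriv v r) \<longlongrightarrow> - L) at_top"
  proof (rule Lim_transform_eventually)
    show "((\<lambda>r. - E.flux r) \<longlongrightarrow> - L) at_top" by (intro tendsto_intros L)
    show "\<forall>\<^sub>F r in at_top. - E.flux r = \<psi> r ^ m * deriv v r"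
      using eventually_gt_at_top[of 0]
    proof eventually_elim
      case (elim r)
      then have "deriv v r = dv r" by (intro DERIV_imp_deriv v_deriv)
      then show ?case by (simp add: E.flux_def)
    qed
  qed
  have J: "(LBINT s:{r<..}. \<psi> s powr (- real m)) = (LBINT s:{r..}. 1 / \<psi> s ^ m)" if "r > 0" for r
  proof -
    have eq: "\<psi> s powr (- real m) = 1 / \<psi> s ^ m" if "s > 0" for s
      using psi_pos[OF that] by (simp add: powr_minus powr_realpow inverse_eq_divide)
    have "\<psi> s \<noteq> 0" if "s \<ge> r" for s using psi_pos[of s] that \<open>r > 0\<close> by simp
    then have "continuous_on {r..} (\<lambda>s. 1 / \<psi> s ^ m)"
      using \<open>r > 0\<close> by (intro continuous_intros continuous_on_subset[OF psi_cont]) auto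
    from borel_measurable_continuous_on_indicator[OF _ this]
    have meas: "set_borel_measurable lborel {r..} (\<lambda>s. 1 / \<psi> s ^ m)"
      by (simp add: set_borel_measurable_def)
    have meas': "set_borel_measurable lborel {r<..} (\<lambda>s. 1 / \<psi> s ^ m)"
      by (rule set_borel_measurable_subset[OF meas]) auto
    have "(LBINT s:{r<..}. \<psi> s powr (- real m)) = (LBINT s:{r<..}. 1 / \<psi> s ^ m)"
      by (rule set_lebesgue_integral_cong) (use eq \<open>r > 0\<close> in auto)
    also have "\<dots> = (LBINT s:{r..}. 1 / \<psi> s ^ m)"
    proof (rule set_integral_cong_set[OF meas meas'])
      have "AE x in lborel. x \<noteq> r" by (rule AE_lborel_singleton)
      then show "AE x in lborel. (x \<in> {r..}) = (x \<in> {r<..})" by eventually_elim auto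
    qed
    finally show ?thesis .
  qed
  have "((\<lambda>r. v r / (LBINT s:{r<..}. \<psi> s powr (- real m))) \<longlongrightarrow> L) at_top"
  proof (rule Lim_transform_eventually[OF E.fast_profile_infinite[OF fast L(2,3)]])
    show "\<forall>\<^sub>F r in at_top. v r / (LBINT s:{r..}. 1 / \<psi> s ^ m) = v r / (LBINT s:{r<..}. \<psi> s powr (- real m))"
      using eventually_gt_at_top[of 0] by eventually_elim (simp add: J)
  qed
  then show ?thesis
    using that L(1) flux E.fast_profile_finite[OF fast L(2)] by blast
qed

context
  fixes r0 :: real
  assumes r0: "r0 \<ge> 0" "\<And>r. r \<ge> r0 \<Longrightarrow> \<psi>' r > 0"
begin

lemma ratio_cont: "continuous_on {r0..} (\<lambda>s. \<psi> s / \<psi>' s)"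
proof -
  have "\<psi>' s \<noteq> 0" if "s \<ge> r0" for s using r0(2)[OF that] by simp
  then show ?thesis
    using r0 by (intro continuous_intros continuous_on_subset[OF psi_cont] continuous_on_subset[OF psi'_cont]) auto
qed

lemma ratio_nonneg: "r \<ge> r0 \<Longrightarrow> \<psi> r / \<psi>' r \<ge> 0"
  using r0 psi_pos[of r] psi_0 by (cases "r = 0") (auto simp: less_imp_le)

lemma ratio_primitive_deriv:
  "\<forall>\<^sub>F r in at_top. ((\<lambda>r. LBINT s:{r0<..<r}. \<psi> s / \<psi>' s) has_real_derivative \<psi> r / \<psi>' r) (at r)"
  using eventually_gt_at_top[of r0] by eventually_elim (rule primitive_deriv[OF ratio_cont])

lemma infinite_energy_positive_limit:
  assumes ode: "lane_emden_ode \<psi> \<psi>' v dv q q' m p R c" and "R > 0"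
    and H1: "u \<notin> sobolev_H1 (model_metric \<psi>)"
    and int: "set_integrable lborel {r0<..} (\<lambda>s. \<psi> s / \<psi>' s)"
  shows "\<exists>C>0. (v \<longlongrightarrow> C) at_top"
proof -
  interpret E: lane_emden_ode \<psi> \<psi>' v dv q q' m p R c by (rule ode)
  show ?thesis
  proof (rule E.slow_positive_limit[OF sobolev_H1_iff_fast(2)[OF ode \<open>R > 0\<close> H1]])
    show "\<forall>\<^sub>F r in at_top. ((\<lambda>r. LBINT s:{r0<..<r}. \<psi> s / \<psi>' s) has_real_derivative 1 / E.Q r) (at r)"
      using ratio_primitive_deriv by (simp add: E.Q_def)
    show "\<forall>\<^sub>F r in at_top. (LBINT s:{r0<..<r}. \<psi> s / \<psi>' s) \<le> (LBINT s:{r0<..}. \<psi> s / \<psi>' s)"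
      by (intro always_eventually allI primitive_bounded[OF ratio_cont ratio_nonneg int])
  qed
qed

text \<open>
  The limit of \<open>v powr (1 - p) / H\<close> is raised to the power \<open>- 1 / (p - 1)\<close>. For finite \<open>l\<close>, l'Hospital's rule
  also gives \<open>H r / r \<longlongrightarrow> 1 / l\<close>.
\<close>

lemma infinite_energy_decay:
  assumes ode: "lane_emden_ode \<psi> \<psi>' v dv q q' m p R c" and "R > 0"
    and H1: "u \<notin> sobolev_H1 (model_metric \<psi>)"
    and int: "\<not> set_integrable lborel {r0<..} (\<lambda>s. \<psi> s / \<psi>' s)"
  shows "((\<lambda>r. (LBINT s:{r0<..<r}. \<psi> s / \<psi>' s) powr (1 / (p - 1)) * v r)
      \<longlongrightarrow> (real m / (p - 1)) powr (1 / (p - 1))) at_top" (is ?rate)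
    and "(v \<longlongrightarrow> 0) at_top" (is ?vanish)
    and "l > 0 \<Longrightarrow> ((\<lambda>r. \<psi>' r / \<psi> r) \<longlongrightarrow> l) at_top \<Longrightarrow>
      ((\<lambda>r. r powr (1 / (p - 1)) * v r) \<longlongrightarrow> (l * real m / (p - 1)) powr (1 / (p - 1))) at_top"
proof -
  interpret E: lane_emden_ode \<psi> \<psi>' v dv q q' m p R c by (rule ode)
  define H where "H = (\<lambda>r. LBINT s:{r0<..<r}. \<psi> s / \<psi>' s)"
  define \<alpha> where "\<alpha> = 1 / (p - 1)"
  have "\<alpha> > 0" using p_gt by (simp add: \<alpha>_def)
  have Hd: "\<forall>\<^sub>F r in at_top. (H has_real_derivative \<psi> r / \<psi>' r) (at r)"
    using ratio_primitive_deriv by (simp add: H_def)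
  have Htop: "filterlim H at_top at_top"
    unfolding H_def by (rule primitive_at_top[OF ratio_cont ratio_nonneg int])
  have lim: "((\<lambda>r. v r powr (1 - p) / H r) \<longlongrightarrow> (p - 1) / real m) at_top"
    by (rule E.slow_decay_rate[OF sobolev_H1_iff_fast(2)[OF ode \<open>R > 0\<close> H1] _ Htop])
      (use Hd in \<open>simp add: E.Q_def\<close>)
  have Hpos: "\<forall>\<^sub>F r in at_top. r > 0 \<and> H r > 0"
    using eventually_gt_at_top[of 0] filterlim_at_top_dense[THEN iffD1, OF Htop, rule_format, of 0]
    by eventually_elim simp
  have "((\<lambda>r. (v r powr (1 - p) / H r) powr (- \<alpha>)) \<longlongrightarrow> ((p - 1) / real m) powr (- \<alpha>)) at_top"
    by (intro tendsto_powr lim tendsto_const) (use p_gt m_pos in auto)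
  also have "((p - 1) / real m) powr (- \<alpha>) = (real m / (p - 1)) powr \<alpha>"
    using p_gt m_pos by (simp add: powr_minus powr_divide)
  finally have "((\<lambda>r. (v r powr (1 - p) / H r) powr (- \<alpha>)) \<longlongrightarrow> (real m / (p - 1)) powr \<alpha>) at_top" .
  moreover have "\<forall>\<^sub>F r in at_top. (v r powr (1 - p) / H r) powr (- \<alpha>) = H r powr \<alpha> * v r"
    using Hpos
  proof eventually_elim
    case (elim r)
    have vr: "v r > 0" using v_pos[of r] elim by simp
    have e: "(1 - p) * (- \<alpha>) = 1" using p_gt by (simp add: \<alpha>_def divide_simps)
    have "(v r powr (1 - p) / H r) powr (- \<alpha>) = (v r powr (1 - p)) powr (- \<alpha>) / H r powr (- \<alpha>)"
      by (rule powr_divide)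
    also have "(v r powr (1 - p)) powr (- \<alpha>) = v r" unfolding powr_powr e using vr by simp
    also have "v r / H r powr (- \<alpha>) = H r powr \<alpha> * v r" using elim by (simp add: powr_minus field_simps)
    finally show ?case .
  qed
  ultimately have rate: "((\<lambda>r. H r powr \<alpha> * v r) \<longlongrightarrow> (real m / (p - 1)) powr \<alpha>) at_top"
    by (rule Lim_transform_eventually)
  then show ?rate by (simp add: H_def \<alpha>_def)
  have "((\<lambda>r. (H r powr \<alpha> * v r) * H r powr (- \<alpha>)) \<longlongrightarrow> (real m / (p - 1)) powr \<alpha> * 0) at_top"
    using \<open>\<alpha> > 0\<close> by (intro tendsto_mult rate tendsto_neg_powr Htop) auto
  moreover have "\<forall>\<^sub>F r in at_top. (H r powr \<alpha> * v r) * H r powr (- \<alpha>) = v r"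
    using Hpos by eventually_elim (simp add: powr_minus)
  ultimately show ?vanish by (simp add: tendsto_cong)
  show "((\<lambda>r. r powr (1 / (p - 1)) * v r) \<longlongrightarrow> (l * real m / (p - 1)) powr (1 / (p - 1))) at_top"
    if "l > 0" and Q: "((\<lambda>r. \<psi>' r / \<psi> r) \<longlongrightarrow> l) at_top"
  proof -
    have "((\<lambda>r. H r / r) \<longlongrightarrow> 1 / l) at_top"
    proof (rule lhospital_at_top_at_top[OF filterlim_ident _ Hd])
      show "\<forall>\<^sub>F r in at_top. ((\<lambda>r. r) has_real_derivative 1) (at r)" by simp
      have "((\<lambda>r. 1 / (\<psi>' r / \<psi> r)) \<longlongrightarrow> 1 / l) at_top"
        using \<open>l > 0\<close> by (intro tendsto_intros Q) auto
      then show "((\<lambda>r. \<psi> r / \<psi>' r / 1) \<longlongrightarrow> 1 / l) at_top" by simp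
    qed simp
    then have "((\<lambda>r. (H r / r) powr (- \<alpha>)) \<longlongrightarrow> (1 / l) powr (- \<alpha>)) at_top"
      using \<open>l > 0\<close> by (intro tendsto_powr tendsto_const) auto
    then have "((\<lambda>r. (H r / r) powr (- \<alpha>) * (H r powr \<alpha> * v r))
        \<longlongrightarrow> (1 / l) powr (- \<alpha>) * (real m / (p - 1)) powr \<alpha>) at_top"
      by (intro tendsto_mult rate)
    also have "(1 / l) powr (- \<alpha>) * (real m / (p - 1)) powr \<alpha> = (l * real m / (p - 1)) powr \<alpha>"
      using \<open>l > 0\<close> p_gt by (simp add: powr_minus powr_divide powr_mult)
    finally have "((\<lambda>r. (H r / r) powr (- \<alpha>) * (H r powr \<alpha> * v r))
        \<longlongrightarrow> (l * real m / (p - 1)) powr \<alpha>) at_top" .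
    moreover have "\<forall>\<^sub>F r in at_top. (H r / r) powr (- \<alpha>) * (H r powr \<alpha> * v r) = r powr \<alpha> * v r"
      using Hpos
    proof eventually_elim
      case (elim r)
      then show ?case by (simp add: powr_divide powr_minus field_simps)
    qed
    ultimately show ?thesis
      unfolding \<alpha>_def by (rule Lim_transform_eventually)
  qed
qed

end

end

theorem theorem2p6:
  fixes \<psi> \<psi>' \<psi>'' :: "real \<Rightarrow> real" and n :: nat and p r\<^sub>0 :: real and l :: ereal
    and u :: "real^'n::finite \<Rightarrow> real" and v :: "real \<Rightarrow> real"
  assumes dim: "n = CARD('n)" and n3: "n \<ge> 3"
    and p: "1 < p" "p < (real n + 2) / (real n - 2)"
    and psi_C2: "\<forall>r\<ge>0. (\<psi> has_real_derivative \<psi>' r) (at r within {0..})"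
      "\<forall>r\<ge>0. (\<psi>' has_real_derivative \<psi>'' r) (at r within {0..})"
      "continuous_on {0..} \<psi>''"
    and psi_pos: "\<forall>r>0. \<psi> r > 0"
    and psi_0: "\<psi> 0 = 0" "\<psi>'' 0 = 0" "\<psi>' 0 = 1"
    and psi'_nonneg: "\<forall>r>0. \<psi>' r \<ge> 0"
    and l_pos: "0 < l"
    and l_lim: "((\<lambda>r. ereal (\<psi>' r / \<psi> r)) \<longlongrightarrow> l) at_top"
    and l_inf: "l = \<infinity> \<Longrightarrow> deriv (\<lambda>r. ln (\<psi>' r / \<psi> r)) \<in> O[at_top](\<lambda>_. 1)"
    and r0: "r\<^sub>0 \<ge> 0" "\<forall>r\<ge>r\<^sub>0. \<psi>' r > 0"
    and u_radial: "\<forall>x. u x = v (norm x)"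
    and u_pos: "\<forall>x. u x > 0"
    and u_sol: "lane_emden_solution (model_metric \<psi>) p u"
  shows
    "(u \<in> sobolev_H1 (model_metric \<psi>) \<longrightarrow>
        (\<exists>L<0. ((\<lambda>r. \<psi> r ^ (n - 1) * deriv v r) \<longlongrightarrow> L) at_top \<and>
          (l < \<infinity> \<longrightarrow>
             ((\<lambda>r. \<psi> r ^ (n - 1) * v r) \<longlongrightarrow> \<bar>L\<bar> / ((real n - 1) * real_of_ereal l)) at_top) \<and>
          (l = \<infinity> \<longrightarrow>
             ((\<lambda>r. v r / (LBINT s:{r<..}. \<psi> s powr (1 - real n))) \<longlongrightarrow> \<bar>L\<bar>) at_top))) \<and>
     (u \<notin> sobolev_H1 (model_metric \<psi>) \<and>
        set_integrable lborel {r\<^sub>0<..} (\<lambda>s. \<psi> s / \<psi>' s) \<longrightarrow>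
        (\<exists>c>0. (v \<longlongrightarrow> c) at_top)) \<and>
     (u \<notin> sobolev_H1 (model_metric \<psi>) \<and>
        \<not> set_integrable lborel {r\<^sub>0<..} (\<lambda>s. \<psi> s / \<psi>' s) \<longrightarrow>
        (v \<longlongrightarrow> 0) at_top \<and>
        ((\<lambda>r. (LBINT s:{r\<^sub>0<..<r}. \<psi> s / \<psi>' s) powr (1 / (p - 1)) * v r)
           \<longlongrightarrow> ((real n - 1) / (p - 1)) powr (1 / (p - 1))) at_top \<and>
        (l < \<infinity> \<longrightarrow>
           ((\<lambda>r. r powr (1 / (p - 1)) * v r)
              \<longlongrightarrow> (real_of_ereal l * (real n - 1) / (p - 1)) powr (1 / (p - 1))) at_top))"
proof -
  obtain u' :: "real^'n \<Rightarrow> (real^'n) \<Rightarrow>\<^sub>L real" and u'' :: "real^'n \<Rightarrow> (real^'n) \<Rightarrow>\<^sub>L ((real^'n) \<Rightarrow>\<^sub>L real)"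
    where u': "\<And>x. (u has_derivative blinfun_apply (u' x)) (at x)"
      and u'': "\<And>x. (u' has_derivative blinfun_apply (u'' x)) (at x)" "continuous_on UNIV u''"
    using u_sol unfolding lane_emden_solution_def C2_map_def C1_map_def by blast
  interpret U: positive_lane_emden_solution u v u' u'' \<psi> \<psi>' \<psi>'' "n - 1" p
    by unfold_locales (use assms u' u''(1) in \<open>auto simp: lane_emden_solution_def\<close>)
  have m: "real (n - 1) = real n - 1" "- real (n - 1) = 1 - real n" using n3 by auto
  \<comment> \<open>From here on both cases for \<open>l\<close> are treated at once; only the limit of \<open>q\<close> for finite \<open>l\<close> is remembered.\<close>
  have "\<exists>q q' R c. R > 0 \<and> lane_emden_ode \<psi> \<psi>' v U.dv q q' (n - 1) p R c \<and>
      (\<forall>k. l = ereal k \<longrightarrow> (q \<longlongrightarrow> k) at_top)"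
  proof (cases "l = \<infinity>")
    case True
    have "filterlim (\<lambda>r. \<psi>' r / \<psi> r) at_top at_top"
      using l_lim unfolding True tendsto_PInfty_eq_at_top .
    from U.ode_at_infinity_infinite[OF this l_inf[OF True]] obtain R where
      "R > 0 \<and> lane_emden_ode \<psi> \<psi>' v U.dv (\<lambda>r. \<psi>' r / \<psi> r)
        (\<lambda>r. \<psi>'' r / \<psi> r - (\<psi>' r / \<psi> r)\<^sup>2) (n - 1) p R 1" by blast
    then show ?thesis using True
      by (intro exI[of _ "\<lambda>r. \<psi>' r / \<psi> r"] exI[of _ "\<lambda>r. \<psi>'' r / \<psi> r - (\<psi>' r / \<psi> r)\<^sup>2"]
          exI[of _ R] exI[of _ 1]) auto
  next
    case False
    then obtain k where k: "l = ereal k" "k > 0" using l_pos by (cases l) auto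
    then have "((\<lambda>r. \<psi>' r / \<psi> r) \<longlongrightarrow> k) at_top" using l_lim by simp
    from U.ode_at_infinity_finite[OF this k(2)] k show ?thesis
      by (intro exI[of _ "\<lambda>_. k"] exI[of _ "\<lambda>_. 0"] exI[of _ 1] exI[of _ k]) auto
  qed
  then obtain q q' R c where R: "R > 0" and ode: "lane_emden_ode \<psi> \<psi>' v U.dv q q' (n - 1) p R c"
    and q: "\<And>k. l = ereal k \<Longrightarrow> (q \<longlongrightarrow> k) at_top" by blast
  have finite_l: "0 < real_of_ereal l" "l = ereal (real_of_ereal l)" if "l < \<infinity>"
    using that l_pos by (cases l; simp)+
  have r0': "\<And>r. r \<ge> r\<^sub>0 \<Longrightarrow> \<psi>' r > 0" using r0(2) by blast
  show ?thesis
  proof (intro conjI impI)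
    assume "u \<in> sobolev_H1 (model_metric \<psi>)"
    then obtain L where L: "L > 0" "((\<lambda>r. \<psi> r ^ (n - 1) * deriv v r) \<longlongrightarrow> - L) at_top"
      "\<And>l. l > 0 \<Longrightarrow> (q \<longlongrightarrow> l) at_top \<Longrightarrow>
        ((\<lambda>r. \<psi> r ^ (n - 1) * v r) \<longlongrightarrow> L / (real (n - 1) * l)) at_top"
      "((\<lambda>r. v r / (LBINT s:{r<..}. \<psi> s powr (- real (n - 1)))) \<longlongrightarrow> L) at_top"
      using U.finite_energy_asymptotics[OF ode R] by blast
    show "\<exists>L<0. ((\<lambda>r. \<psi> r ^ (n - 1) * deriv v r) \<longlongrightarrow> L) at_top \<and>
          (l < \<infinity> \<longrightarrow>
             ((\<lambda>r. \<psi> r ^ (n - 1) * v r) \<longlongrightarrow> \<bar>L\<bar> / ((real n - 1) * real_of_ereal l)) at_top) \<and>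
          (l = \<infinity> \<longrightarrow>
             ((\<lambda>r. v r / (LBINT s:{r<..}. \<psi> s powr (1 - real n))) \<longlongrightarrow> \<bar>L\<bar>) at_top)"
    proof (intro exI[of _ "- L"] conjI impI)
      assume "l < \<infinity>"
      from L(3)[OF finite_l(1)[OF this] q[OF finite_l(2)[OF this]]]
      show "((\<lambda>r. \<psi> r ^ (n - 1) * v r) \<longlongrightarrow> \<bar>- L\<bar> / ((real n - 1) * real_of_ereal l)) at_top"
        using L(1) unfolding m by simp
    qed (use L m in auto)
  next
    assume "u \<notin> sobolev_H1 (model_metric \<psi>) \<and> set_integrable lborel {r\<^sub>0<..} (\<lambda>s. \<psi> s / \<psi>' s)"
    then show "\<exists>c>0. (v \<longlongrightarrow> c) at_top"
      using U.infinite_energy_positive_limit[OF r0(1) r0' ode R] by blast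
  next
    assume *: "u \<notin> sobolev_H1 (model_metric \<psi>) \<and> \<not> set_integrable lborel {r\<^sub>0<..} (\<lambda>s. \<psi> s / \<psi>' s)"
    note decay = U.infinite_energy_decay[OF r0(1) r0' ode R conjunct1[OF *] conjunct2[OF *]]
    show "(v \<longlongrightarrow> 0) at_top" by (rule decay(2))
    show "((\<lambda>r. (LBINT s:{r\<^sub>0<..<r}. \<psi> s / \<psi>' s) powr (1 / (p - 1)) * v r)
           \<longlongrightarrow> ((real n - 1) / (p - 1)) powr (1 / (p - 1))) at_top"
      using decay(1) unfolding m by simp
    assume fin: "l < \<infinity>"
    have "((\<lambda>r. ereal (\<psi>' r / \<psi> r)) \<longlongrightarrow> ereal (real_of_ereal l)) at_top"
      using l_lim finite_l(2)[OF fin] by simp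
    then have "((\<lambda>r. \<psi>' r / \<psi> r) \<longlongrightarrow> real_of_ereal l) at_top" by simp
    from decay(3)[OF _ finite_l(1)[OF fin] this]
    show "((\<lambda>r. r powr (1 / (p - 1)) * v r)
              \<longlongrightarrow> (real_of_ereal l * (real n - 1) / (p - 1)) powr (1 / (p - 1))) at_top"
      unfolding m by blast
  qed
qed

end
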